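(* Let $R$ be a commutative Noetherian ring, let $C$ be a semidualizing $R$-module, and let $M$ and $N$ be $R$-modules. Suppose $C\text{-}\mathrm{qid}_R N<\infty$ and $\operatorname{Tor}^R_i(C,M)=0$ for all $i>0$. If $\operatorname{Ext}^i_R(M,N)=0$ for all sufficiently large $i$, then $\operatorname{Ext}^i_R(M,N)=0$ for all $i>C\text{-}\mathrm{qid}_R N$.
   Context: A finitely generated $R$-module $C$ is semidualizing if the homothety map $R\to\operatorname{Hom}_R(C,C)$ is an isomorphism and $\operatorname{Ext}^i_R(C,C)=0$ for all $i>0$. For a complex $X_\bullet$ of $R$-modules (homological indexing, differential lowering degree), $\inf X_\bullet=\inf\{i: X_i\neq0\}$ and $\operatorname{hinf}X_\bullet=\inf\{i:\mathrm H_i(X_\bullet)\neq0\}$. A $C$-quasi-injective resolution of an $R$-module $N$ is a bounded complex $I_\bullet$ of injective $R$-modules such that $\operatorname{Hom}_R(C,I_\bullet)$ is not acyclic and each of its homology modules is zero or a finite direct sum of copies of $N$. The $C$-quasi-injective dimension $C\text{-}\mathrm{qid}_R N$ is the infimum of $\operatorname{hinf}\operatorname{Hom}_R(C,I_\bullet)-\inf\operatorname{Hom}_R(C,I_\bullet)$ over all $C$-quasi-injective resolutions $I_\bullet$ of $N$ ($\infty$ if there are none), and it is $-\infty$ if $N=0$. Modules are not assumed finitely generated. *)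

theory Defs
  imports
    "HOL-Algebra.Module"
    "HOL-Algebra.QuotRing"
    "HOL-Algebra.Ring_Divisibility"
    "HOL-Library.FSet"
    "HOL-Library.Extended_Real"
begin

text \<open>
  Modules are those of \<^locale>\<open>module\<close>.  The fields \<open>mult\<close> and \<open>one\<close>, which the
  record type \<^typ>\<open>('r, 'm) module\<close> inherits from rings, play no role and are left
  \<^const>\<open>undefined\<close>.
\<close>

section \<open>Basic constructions with modules\<close>

definition zero_module :: "('r, 'm) module \<Rightarrow> bool" where
  "zero_module M \<longleftrightarrow> carrier M = {\<zero>\<^bsub>M\<^esub>}"

definition mod_hom :: "('r, 'e) ring_scheme \<Rightarrow> ('r, 'm) module \<Rightarrow> ('r, 'n) module \<Rightarrow> ('m \<Rightarrow> 'n) set" where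
  "mod_hom R M N = {f \<in> carrier M \<rightarrow> carrier N.
     (\<forall>x\<in>carrier M. \<forall>y\<in>carrier M. f (x \<oplus>\<^bsub>M\<^esub> y) = f x \<oplus>\<^bsub>N\<^esub> f y) \<and>
     (\<forall>r\<in>carrier R. \<forall>x\<in>carrier M. f (r \<odot>\<^bsub>M\<^esub> x) = r \<odot>\<^bsub>N\<^esub> f x)}"

lemma mod_homD:
  assumes "f \<in> mod_hom R M N"
  shows "x \<in> carrier M \<Longrightarrow> f x \<in> carrier N"
    and "x \<in> carrier M \<Longrightarrow> y \<in> carrier M \<Longrightarrow> f (x \<oplus>\<^bsub>M\<^esub> y) = f x \<oplus>\<^bsub>N\<^esub> f y"
    and "r \<in> carrier R \<Longrightarrow> x \<in> carrier M \<Longrightarrow> f (r \<odot>\<^bsub>M\<^esub> x) = r \<odot>\<^bsub>N\<^esub> f x"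
  using assms by (auto simp: mod_hom_def)

definition mod_iso :: "('r, 'e) ring_scheme \<Rightarrow> ('r, 'm) module \<Rightarrow> ('r, 'n) module \<Rightarrow> bool" where
  "mod_iso R M N \<longleftrightarrow> (\<exists>f\<in>mod_hom R M N. bij_betw f (carrier M) (carrier N))"

text \<open>Elements of the module of homomorphisms are \<^const>\<open>extensional\<close>, so that each
  homomorphism is represented by exactly one function.\<close>

definition Hom :: "('r, 'e) ring_scheme \<Rightarrow> ('r, 'm) module \<Rightarrow> ('r, 'n) module \<Rightarrow> ('r, 'm \<Rightarrow> 'n) module" where
  "Hom R M N =
    \<lparr>carrier = mod_hom R M N \<inter> extensional (carrier M), mult = undefined, one = undefined,
     zero = (\<lambda>x\<in>carrier M. \<zero>\<^bsub>N\<^esub>),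
     add = (\<lambda>f g. \<lambda>x\<in>carrier M. f x \<oplus>\<^bsub>N\<^esub> g x),
     smult = (\<lambda>r f. \<lambda>x\<in>carrier M. r \<odot>\<^bsub>N\<^esub> f x)\<rparr>"

definition quot_module :: "('r, 'm) module \<Rightarrow> 'm set \<Rightarrow> ('r, 'm set) module" where
  "quot_module M K =
    \<lparr>carrier = a_rcosets\<^bsub>M\<^esub> K, mult = undefined, one = undefined,
     zero = K, add = set_add M, smult = (\<lambda>r X. \<Union>x\<in>X. K +>\<^bsub>M\<^esub> (r \<odot>\<^bsub>M\<^esub> x))\<rparr>"

definition mod_span :: "('r, 'e) ring_scheme \<Rightarrow> ('r, 'm) module \<Rightarrow> 'm set \<Rightarrow> 'm set" where
  "mod_span R M S = \<Inter>{H. submodule H R M \<and> S \<subseteq> H}"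

definition fin_gen_module :: "('r, 'e) ring_scheme \<Rightarrow> ('r, 'm) module \<Rightarrow> bool" where
  "fin_gen_module R M \<longleftrightarrow> (\<exists>S \<subseteq> carrier M. finite S \<and> mod_span R M S = carrier M)"

definition direct_power :: "('r, 'm) module \<Rightarrow> nat \<Rightarrow> ('r, nat \<Rightarrow> 'm) module" where
  "direct_power N k =
    \<lparr>carrier = {..<k} \<rightarrow>\<^sub>E carrier N, mult = undefined, one = undefined,
     zero = (\<lambda>i\<in>{..<k}. \<zero>\<^bsub>N\<^esub>),
     add = (\<lambda>f g. \<lambda>i\<in>{..<k}. f i \<oplus>\<^bsub>N\<^esub> g i),
     smult = (\<lambda>r f. \<lambda>i\<in>{..<k}. r \<odot>\<^bsub>N\<^esub> f i)\<rparr>"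

text \<open>The free module on \<open>B\<close> consists of the finitely supported functions vanishing
  off \<open>B\<close>; \<open>lin_ext R M g\<close> is the linear map to \<open>M\<close> sending the basis vector at \<open>b\<close>
  to \<open>g b\<close>.\<close>

definition free_module :: "('r, 'e) ring_scheme \<Rightarrow> 'b set \<Rightarrow> ('r, 'b \<Rightarrow> 'r) module" where
  "free_module R B =
    \<lparr>carrier = {f. range f \<subseteq> carrier R \<and> finite {b. f b \<noteq> \<zero>\<^bsub>R\<^esub>} \<and> {b. f b \<noteq> \<zero>\<^bsub>R\<^esub>} \<subseteq> B},
     mult = undefined, one = undefined,
     zero = (\<lambda>_. \<zero>\<^bsub>R\<^esub>),
     add = (\<lambda>f g b. f b \<oplus>\<^bsub>R\<^esub> g b),
     smult = (\<lambda>r f b. r \<otimes>\<^bsub>R\<^esub> f b)\<rparr>"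

definition basis_vec :: "('r, 'e) ring_scheme \<Rightarrow> 'b \<Rightarrow> 'b \<Rightarrow> 'r" where
  "basis_vec R b = (\<lambda>c. if c = b then \<one>\<^bsub>R\<^esub> else \<zero>\<^bsub>R\<^esub>)"

definition lin_ext :: "('r, 'e) ring_scheme \<Rightarrow> ('r, 'm) module \<Rightarrow> ('b \<Rightarrow> 'm) \<Rightarrow> ('b \<Rightarrow> 'r) \<Rightarrow> 'm" where
  "lin_ext R M g f = (\<Oplus>\<^bsub>M\<^esub>b\<in>{b. f b \<noteq> \<zero>\<^bsub>R\<^esub>}. f b \<odot>\<^bsub>M\<^esub> g b)"

definition tensor_rels :: "('r, 'e) ring_scheme \<Rightarrow> ('r, 'm) module \<Rightarrow> ('r, 'n) module \<Rightarrow> ('m \<times> 'n \<Rightarrow> 'r) set" where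
  "tensor_rels R M N =
    (let F = free_module R (carrier M \<times> carrier N); e = (\<lambda>x y. basis_vec R (x, y)) in
      {e (x \<oplus>\<^bsub>M\<^esub> x') y \<ominus>\<^bsub>F\<^esub> (e x y \<oplus>\<^bsub>F\<^esub> e x' y) | x x' y.
         x \<in> carrier M \<and> x' \<in> carrier M \<and> y \<in> carrier N} \<union>
      {e x (y \<oplus>\<^bsub>N\<^esub> y') \<ominus>\<^bsub>F\<^esub> (e x y \<oplus>\<^bsub>F\<^esub> e x y') | x y y'.
         x \<in> carrier M \<and> y \<in> carrier N \<and> y' \<in> carrier N} \<union>
      {e (r \<odot>\<^bsub>M\<^esub> x) y \<ominus>\<^bsub>F\<^esub> r \<odot>\<^bsub>F\<^esub> e x y | r x y.
         r \<in> carrier R \<and> x \<in> carrier M \<and> y \<in> carrier N} \<union>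
      {e x (r \<odot>\<^bsub>N\<^esub> y) \<ominus>\<^bsub>F\<^esub> r \<odot>\<^bsub>F\<^esub> e x y | r x y.
         r \<in> carrier R \<and> x \<in> carrier M \<and> y \<in> carrier N})"

definition tensor_ker :: "('r, 'e) ring_scheme \<Rightarrow> ('r, 'm) module \<Rightarrow> ('r, 'n) module \<Rightarrow> ('m \<times> 'n \<Rightarrow> 'r) set" where
  "tensor_ker R M N = mod_span R (free_module R (carrier M \<times> carrier N)) (tensor_rels R M N)"

definition tensor :: "('r, 'e) ring_scheme \<Rightarrow> ('r, 'm) module \<Rightarrow> ('r, 'n) module \<Rightarrow> ('r, ('m \<times> 'n \<Rightarrow> 'r) set) module" where
  "tensor R M N = quot_module (free_module R (carrier M \<times> carrier N)) (tensor_ker R M N)"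

text \<open>The homomorphism \<open>M \<otimes> N \<rightarrow> M' \<otimes> N'\<close> induced by \<open>f : M \<rightarrow> M'\<close> and
  \<open>g : N \<rightarrow> N'\<close>; all representatives \<open>t\<close> of the class \<open>T\<close> give the same coset.\<close>

definition tensor_map :: "('r, 'e) ring_scheme \<Rightarrow> ('r, 'm) module \<Rightarrow> ('r, 'n) module \<Rightarrow>
    ('m \<Rightarrow> 'm) \<Rightarrow> ('n \<Rightarrow> 'n) \<Rightarrow> ('m \<times> 'n \<Rightarrow> 'r) set \<Rightarrow> ('m \<times> 'n \<Rightarrow> 'r) set" where
  "tensor_map R M' N' f g T =
    (let F' = free_module R (carrier M' \<times> carrier N') in
      \<Union>t\<in>T. tensor_ker R M' N' +>\<^bsub>F'\<^esub> lin_ext R F' (\<lambda>(x, y). basis_vec R (f x, g y)) t)"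


section \<open>Complexes\<close>

text \<open>A complex consists of modules \<open>X n\<close> and differentials \<open>d n : X n \<rightarrow> X (n - 1)\<close>
  for all integers \<open>n\<close>.\<close>

definition chain_complex :: "('r, 'e) ring_scheme \<Rightarrow> (int \<Rightarrow> ('r, 'x) module) \<Rightarrow> (int \<Rightarrow> 'x \<Rightarrow> 'x) \<Rightarrow> bool" where
  "chain_complex R X d \<longleftrightarrow>
    (\<forall>n. module R (X n) \<and> d n \<in> mod_hom R (X n) (X (n - 1)) \<and>
         (\<forall>x\<in>carrier (X n). d (n - 1) (d n x) = \<zero>\<^bsub>X (n - 2)\<^esub>))"

definition bounded_complex :: "(int \<Rightarrow> ('r, 'x) module) \<Rightarrow> bool" where
  "bounded_complex X \<longleftrightarrow> (\<exists>a b. \<forall>n. n < a \<or> b < n \<longrightarrow> zero_module (X n))"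

definition cycles :: "(int \<Rightarrow> ('r, 'x) module) \<Rightarrow> (int \<Rightarrow> 'x \<Rightarrow> 'x) \<Rightarrow> int \<Rightarrow> 'x set" where
  "cycles X d n = {x \<in> carrier (X n). d n x = \<zero>\<^bsub>X (n - 1)\<^esub>}"

definition boundaries :: "(int \<Rightarrow> ('r, 'x) module) \<Rightarrow> (int \<Rightarrow> 'x \<Rightarrow> 'x) \<Rightarrow> int \<Rightarrow> 'x set" where
  "boundaries X d n = d (n + 1) ` carrier (X (n + 1))"

definition homology :: "(int \<Rightarrow> ('r, 'x) module) \<Rightarrow> (int \<Rightarrow> 'x \<Rightarrow> 'x) \<Rightarrow> int \<Rightarrow> ('r, 'x set) module" where
  "homology X d n = quot_module ((X n)\<lparr>carrier := cycles X d n\<rparr>) (boundaries X d n)"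

definition acyclic_complex :: "(int \<Rightarrow> ('r, 'x) module) \<Rightarrow> (int \<Rightarrow> 'x \<Rightarrow> 'x) \<Rightarrow> bool" where
  "acyclic_complex X d \<longleftrightarrow> (\<forall>n. zero_module (homology X d n))"

definition inf_complex :: "(int \<Rightarrow> ('r, 'x) module) \<Rightarrow> ereal" where
  "inf_complex X = (INF n\<in>{n. \<not> zero_module (X n)}. ereal (of_int n))"

definition hinf_complex :: "(int \<Rightarrow> ('r, 'x) module) \<Rightarrow> (int \<Rightarrow> 'x \<Rightarrow> 'x) \<Rightarrow> ereal" where
  "hinf_complex X d = (INF n\<in>{n. \<not> zero_module (homology X d n)}. ereal (of_int n))"

text \<open>The covariant functor \<open>Hom R C\<close> applied to a complex.\<close>

definition Hom_cplx :: "('r, 'e) ring_scheme \<Rightarrow> ('r, 'c) module \<Rightarrow> (int \<Rightarrow> ('r, 'x) module) \<Rightarrow>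
    int \<Rightarrow> ('r, 'c \<Rightarrow> 'x) module" where
  "Hom_cplx R C X n = Hom R C (X n)"

definition Hom_diff :: "('r, 'c) module \<Rightarrow> (int \<Rightarrow> 'x \<Rightarrow> 'x) \<Rightarrow> int \<Rightarrow> ('c \<Rightarrow> 'x) \<Rightarrow> 'c \<Rightarrow> 'x" where
  "Hom_diff C d n \<phi> = (\<lambda>c\<in>carrier C. d n (\<phi> c))"

text \<open>The contravariant functor \<open>Hom R _ N\<close> applied to a complex \<open>P\<close>; the module
  \<open>Hom R (P n) N\<close> is placed in degree \<open>- n\<close>.\<close>

definition coHom_cplx :: "('r, 'e) ring_scheme \<Rightarrow> (int \<Rightarrow> ('r, 'x) module) \<Rightarrow> ('r, 'n) module \<Rightarrow>
    int \<Rightarrow> ('r, 'x \<Rightarrow> 'n) module" where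
  "coHom_cplx R P N n = Hom R (P (- n)) N"

definition coHom_diff :: "(int \<Rightarrow> ('r, 'x) module) \<Rightarrow> (int \<Rightarrow> 'x \<Rightarrow> 'x) \<Rightarrow> int \<Rightarrow> ('x \<Rightarrow> 'n) \<Rightarrow> 'x \<Rightarrow> 'n" where
  "coHom_diff P d n \<phi> = (\<lambda>x\<in>carrier (P (1 - n)). \<phi> (d (1 - n) x))"


section \<open>The standard free resolution, Ext and Tor\<close>

text \<open>
  Ext and Tor are computed from the functorial free resolution \<open>P\<close> of \<open>M\<close> in which
  \<open>P 0\<close> is free on the set of all elements of \<open>M\<close>, and \<open>P (n + 1)\<close> is free on the
  set of all elements of the kernel \<open>Z n\<close> of \<open>P n \<rightarrow> P (n - 1)\<close> (of \<open>P 0 \<rightarrow> M\<close> if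
  \<open>n = 0\<close>).  So that all \<open>P n\<close> live in the same type, the basis element belonging to
  the cycle \<open>z\<close> is the symbol \<open>Cyc\<close> applied to the graph of \<open>z\<close> on its (finite) support.
\<close>

datatype ('r, 'm) res_gen = Elt (elt: 'm) | Cyc "(('r, 'm) res_gen \<times> 'r) fset"

definition cyc :: "('r, 'e) ring_scheme \<Rightarrow> (('r, 'm) res_gen \<Rightarrow> 'r) \<Rightarrow> ('r, 'm) res_gen" where
  "cyc R z = Cyc (Abs_fset {(b, z b) |b. z b \<noteq> \<zero>\<^bsub>R\<^esub>})"

fun uncyc :: "('r, 'e) ring_scheme \<Rightarrow> ('r, 'm) res_gen \<Rightarrow> ('r, 'm) res_gen \<Rightarrow> 'r" where
  "uncyc R (Cyc S) = (\<lambda>b. if \<exists>r. (b, r) \<in> fset S then THE r. (b, r) \<in> fset S else \<zero>\<^bsub>R\<^esub>)"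
| "uncyc R (Elt m) = (\<lambda>b. \<zero>\<^bsub>R\<^esub>)"

definition res_aug :: "('r, 'e) ring_scheme \<Rightarrow> ('r, 'm) module \<Rightarrow> (('r, 'm) res_gen \<Rightarrow> 'r) \<Rightarrow> 'm" where
  "res_aug R M = lin_ext R M elt"

primrec res_cycles :: "('r, 'e) ring_scheme \<Rightarrow> ('r, 'm) module \<Rightarrow> nat \<Rightarrow> (('r, 'm) res_gen \<Rightarrow> 'r) set" where
  "res_cycles R M 0 =
    {f \<in> carrier (free_module R (Elt ` carrier M)). res_aug R M f = \<zero>\<^bsub>M\<^esub>}"
| "res_cycles R M (Suc n) =
    {f \<in> carrier (free_module R (cyc R ` res_cycles R M n)).
       lin_ext R (free_module R UNIV) (uncyc R) f = (\<lambda>_. \<zero>\<^bsub>R\<^esub>)}"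

definition res_basis :: "('r, 'e) ring_scheme \<Rightarrow> ('r, 'm) module \<Rightarrow> int \<Rightarrow> ('r, 'm) res_gen set" where
  "res_basis R M n =
    (if n < 0 then {} else if n = 0 then Elt ` carrier M
     else cyc R ` res_cycles R M (nat (n - 1)))"

definition res :: "('r, 'e) ring_scheme \<Rightarrow> ('r, 'm) module \<Rightarrow> int \<Rightarrow> ('r, ('r, 'm) res_gen \<Rightarrow> 'r) module" where
  "res R M n = free_module R (res_basis R M n)"

definition res_diff :: "('r, 'e) ring_scheme \<Rightarrow> int \<Rightarrow> (('r, 'm) res_gen \<Rightarrow> 'r) \<Rightarrow> ('r, 'm) res_gen \<Rightarrow> 'r" where
  "res_diff R n f =
    (if n \<le> 0 then (\<lambda>_. \<zero>\<^bsub>R\<^esub>) else lin_ext R (free_module R UNIV) (uncyc R) f)"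

text \<open>By \<open>res_free_resolution\<close> below, this is indeed a free resolution of \<open>M\<close>.\<close>

lemma mod_hom_ker_submodule:
  assumes "module R M" "module R N" "f \<in> mod_hom R M N"
  shows "submodule {x \<in> carrier M. f x = \<zero>\<^bsub>N\<^esub>} R M"
proof -
  interpret M: module R M by fact
  interpret N: module R N by fact
  note f = mod_homD[OF assms(3)]
  have sm: "r \<odot>\<^bsub>M\<^esub> x \<in> {x \<in> carrier M. f x = \<zero>\<^bsub>N\<^esub>}"
    if "r \<in> carrier R" "x \<in> {x \<in> carrier M. f x = \<zero>\<^bsub>N\<^esub>}" for r x
    using that f by simp
  show ?thesis
  proof (rule M.submoduleI)
    show "\<zero>\<^bsub>M\<^esub> \<in> {x \<in> carrier M. f x = \<zero>\<^bsub>N\<^esub>}"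
      using f(3)[of "\<zero>\<^bsub>R\<^esub>" "\<zero>\<^bsub>M\<^esub>"] f(1)[of "\<zero>\<^bsub>M\<^esub>"] by simp
    show "\<ominus>\<^bsub>M\<^esub> a \<in> {x \<in> carrier M. f x = \<zero>\<^bsub>N\<^esub>}" if "a \<in> {x \<in> carrier M. f x = \<zero>\<^bsub>N\<^esub>}" for a
      using sm[OF _ that, of "\<ominus>\<^bsub>R\<^esub> \<one>\<^bsub>R\<^esub>"] that by (simp add: M.smult_l_minus)
  qed (use f sm in auto)
qed

lemma free_module_simps [simp]:
  "\<zero>\<^bsub>free_module R B\<^esub> = (\<lambda>_. \<zero>\<^bsub>R\<^esub>)"
  "f \<oplus>\<^bsub>free_module R B\<^esub> g = (\<lambda>b. f b \<oplus>\<^bsub>R\<^esub> g b)"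
  "r \<odot>\<^bsub>free_module R B\<^esub> f = (\<lambda>b. r \<otimes>\<^bsub>R\<^esub> f b)"
  by (simp_all add: free_module_def)

lemma free_module_carrier:
  "f \<in> carrier (free_module R B) \<longleftrightarrow>
     (\<forall>b. f b \<in> carrier R) \<and> finite {b. f b \<noteq> \<zero>\<^bsub>R\<^esub>} \<and> (\<forall>b. f b \<noteq> \<zero>\<^bsub>R\<^esub> \<longrightarrow> b \<in> B)"
  by (auto simp: free_module_def)

lemma module_free_module:
  assumes "cring R"
  shows "module R (free_module R B)"
proof -
  interpret cring R by fact
  let ?F = "free_module R B"
  have add: "f \<oplus>\<^bsub>?F\<^esub> g \<in> carrier ?F" if "f \<in> carrier ?F" "g \<in> carrier ?F" for f g
  proof -
    have "{b. f b \<oplus>\<^bsub>R\<^esub> g b \<noteq> \<zero>\<^bsub>R\<^esub>} \<subseteq> {b. f b \<noteq> \<zero>\<^bsub>R\<^esub>} \<union> {b. g b \<noteq> \<zero>\<^bsub>R\<^esub>}" by auto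
    then show ?thesis
      using that unfolding free_module_carrier free_module_simps
      by (metis (mono_tags, lifting) add.m_closed finite_UnI finite_subset r_zero zero_closed)
  qed
  have smult: "r \<odot>\<^bsub>?F\<^esub> f \<in> carrier ?F" if "r \<in> carrier R" "f \<in> carrier ?F" for r f
  proof -
    have "{b. r \<otimes>\<^bsub>R\<^esub> f b \<noteq> \<zero>\<^bsub>R\<^esub>} \<subseteq> {b. f b \<noteq> \<zero>\<^bsub>R\<^esub>}" using that(1) by auto
    then show ?thesis
      using that unfolding free_module_carrier free_module_simps
      by (metis (mono_tags, lifting) m_closed finite_subset r_null)
  qed
  have "abelian_group ?F"
  proof (rule abelian_groupI)
    show "\<exists>y\<in>carrier ?F. y \<oplus>\<^bsub>?F\<^esub> f = \<zero>\<^bsub>?F\<^esub>" if f: "f \<in> carrier ?F" for f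
    proof (rule bexI)
      show "(\<ominus>\<^bsub>R\<^esub> \<one>\<^bsub>R\<^esub>) \<odot>\<^bsub>?F\<^esub> f \<in> carrier ?F" using f by (intro smult) auto
      show "(\<ominus>\<^bsub>R\<^esub> \<one>\<^bsub>R\<^esub>) \<odot>\<^bsub>?F\<^esub> f \<oplus>\<^bsub>?F\<^esub> f = \<zero>\<^bsub>?F\<^esub>"
        using f by (auto simp: free_module_carrier l_minus l_neg)
    qed
    show "\<zero>\<^bsub>?F\<^esub> \<in> carrier ?F" by (simp add: free_module_carrier)
    fix f g h assume f: "f \<in> carrier ?F" and g: "g \<in> carrier ?F" and h: "h \<in> carrier ?F"
    have *: "f b \<in> carrier R" "g b \<in> carrier R" "h b \<in> carrier R" for b
      using f g h by (auto simp: free_module_carrier)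
    show "f \<oplus>\<^bsub>?F\<^esub> g \<in> carrier ?F" using f g by (rule add)
    show "f \<oplus>\<^bsub>?F\<^esub> g \<oplus>\<^bsub>?F\<^esub> h = f \<oplus>\<^bsub>?F\<^esub> (g \<oplus>\<^bsub>?F\<^esub> h)"
      using * by (simp add: a_assoc)
    show "f \<oplus>\<^bsub>?F\<^esub> g = g \<oplus>\<^bsub>?F\<^esub> f" using * by (simp add: a_comm)
    show "\<zero>\<^bsub>?F\<^esub> \<oplus>\<^bsub>?F\<^esub> f = f" using * by simp
  qed
  then show ?thesis
    by (intro moduleI smult assms) (auto simp: free_module_carrier l_distr r_distr m_assoc)
qed

lemma lin_ext_supp:
  assumes "module R M" "g \<in> B \<rightarrow> carrier M" "f \<in> carrier (free_module R B)"
    and "finite S" "{b. f b \<noteq> \<zero>\<^bsub>R\<^esub>} \<subseteq> S" "S \<subseteq> B"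
  shows "lin_ext R M g f = (\<Oplus>\<^bsub>M\<^esub>b\<in>S. f b \<odot>\<^bsub>M\<^esub> g b)"
proof -
  interpret module R M by fact
  show ?thesis
    unfolding lin_ext_def using assms
    by (intro add.finprod_mono_neutral_cong_left) (auto simp: free_module_carrier Pi_iff subset_iff)
qed

lemma lin_ext_hom:
  assumes "module R M" "g \<in> B \<rightarrow> carrier M"
  shows "lin_ext R M g \<in> mod_hom R (free_module R B) M"
proof -
  interpret module R M by fact
  interpret F: module R "free_module R B" by (rule module_free_module) (rule R.is_cring)
  have cl: "f b \<odot>\<^bsub>M\<^esub> g b \<in> carrier M" if "f \<in> carrier (free_module R B)" "b \<in> B" for f b
    using that assms(2) by (auto simp: free_module_carrier)
  have "lin_ext R M g f \<in> carrier M" if f: "f \<in> carrier (free_module R B)" for f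
    unfolding lin_ext_def using f cl[OF f]
    by (intro M.finsum_closed) (auto simp: free_module_carrier)
  moreover have "lin_ext R M g (f \<oplus>\<^bsub>free_module R B\<^esub> h) = lin_ext R M g f \<oplus>\<^bsub>M\<^esub> lin_ext R M g h"
    if f: "f \<in> carrier (free_module R B)" and h: "h \<in> carrier (free_module R B)" for f h
  proof -
    let ?S = "{b. f b \<noteq> \<zero>\<^bsub>R\<^esub>}"
    let ?T = "?S \<union> {b. h b \<noteq> \<zero>\<^bsub>R\<^esub>}"
    have T: "finite ?T" "?T \<subseteq> B" using f h by (auto simp: free_module_carrier)
    have fh: "f \<oplus>\<^bsub>free_module R B\<^esub> h \<in> carrier (free_module R B)" using f h by (rule F.M.a_closed)
    have "lin_ext R M g (f \<oplus>\<^bsub>free_module R B\<^esub> h)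
        = (\<Oplus>\<^bsub>M\<^esub>b\<in>?T. (f \<oplus>\<^bsub>free_module R B\<^esub> h) b \<odot>\<^bsub>M\<^esub> g b)"
      using T by (intro lin_ext_supp[OF assms fh]) auto
    also have "\<dots> = (\<Oplus>\<^bsub>M\<^esub>b\<in>?T. f b \<odot>\<^bsub>M\<^esub> g b \<oplus>\<^bsub>M\<^esub> h b \<odot>\<^bsub>M\<^esub> g b)"
      using T(2) f h assms(2) cl[OF f] cl[OF h]
      by (intro M.add.finprod_cong') (auto simp: free_module_carrier smult_l_distr Pi_iff subset_iff)
    also have "\<dots> = (\<Oplus>\<^bsub>M\<^esub>b\<in>?T. f b \<odot>\<^bsub>M\<^esub> g b) \<oplus>\<^bsub>M\<^esub> (\<Oplus>\<^bsub>M\<^esub>b\<in>?T. h b \<odot>\<^bsub>M\<^esub> g b)"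
      using T cl[OF f] cl[OF h] by (intro M.finsum_addf) auto
    also have "\<dots> = lin_ext R M g f \<oplus>\<^bsub>M\<^esub> lin_ext R M g h"
      using T lin_ext_supp[OF assms f, of ?T] lin_ext_supp[OF assms h, of ?T] by simp
    finally show ?thesis .
  qed
  moreover have "lin_ext R M g (r \<odot>\<^bsub>free_module R B\<^esub> f) = r \<odot>\<^bsub>M\<^esub> lin_ext R M g f"
    if f: "f \<in> carrier (free_module R B)" and r: "r \<in> carrier R" for f r
  proof -
    let ?S = "{b. f b \<noteq> \<zero>\<^bsub>R\<^esub>}"
    have S: "finite ?S" "?S \<subseteq> B" using f by (auto simp: free_module_carrier)
    have rf: "r \<odot>\<^bsub>free_module R B\<^esub> f \<in> carrier (free_module R B)" using r f by (rule F.smult_closed)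
    have "lin_ext R M g (r \<odot>\<^bsub>free_module R B\<^esub> f)
        = (\<Oplus>\<^bsub>M\<^esub>b\<in>?S. (r \<odot>\<^bsub>free_module R B\<^esub> f) b \<odot>\<^bsub>M\<^esub> g b)"
      using S r by (intro lin_ext_supp[OF assms rf]) auto
    also have "\<dots> = (\<Oplus>\<^bsub>M\<^esub>b\<in>?S. r \<odot>\<^bsub>M\<^esub> (f b \<odot>\<^bsub>M\<^esub> g b))"
      using S(2) f r assms(2) cl[OF f]
      by (intro M.add.finprod_cong') (auto simp: free_module_carrier smult_assoc1 Pi_iff subset_iff)
    also have "\<dots> = r \<odot>\<^bsub>M\<^esub> lin_ext R M g f"
      unfolding lin_ext_def using S cl[OF f] r by (intro finsum_smult_ldistr[symmetric]) auto
    finally show ?thesis .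
  qed
  ultimately show ?thesis unfolding mod_hom_def by blast
qed

lemma basis_vec_carrier:
  assumes "cring R" "b \<in> B"
  shows "basis_vec R b \<in> carrier (free_module R B)"
proof -
  interpret cring R by fact
  have supp: "c = b" if "basis_vec R b c \<noteq> \<zero>\<^bsub>R\<^esub>" for c
    using that unfolding basis_vec_def by presburger
  then have "{c. basis_vec R b c \<noteq> \<zero>\<^bsub>R\<^esub>} \<subseteq> {b}" by blast
  then have "finite {c. basis_vec R b c \<noteq> \<zero>\<^bsub>R\<^esub>}" by (rule finite_subset) simp
  moreover have "basis_vec R b c \<in> carrier R" for c unfolding basis_vec_def by simp
  ultimately show ?thesis unfolding free_module_carrier using assms(2) supp by blast
qed

lemma lin_ext_basis_vec:
  assumes "module R M" "g b \<in> carrier M"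
  shows "lin_ext R M g (basis_vec R b) = g b"
proof -
  interpret module R M by fact
  have "lin_ext R M g (basis_vec R b) = (\<Oplus>\<^bsub>M\<^esub>c\<in>{b}. basis_vec R b c \<odot>\<^bsub>M\<^esub> g c)"
    using assms basis_vec_carrier[OF R.is_cring, of b "{b}"]
    by (intro lin_ext_supp[where B = "{b}"]) (auto simp: basis_vec_def)
  also have "\<dots> = g b" using assms by (simp add: basis_vec_def)
  finally show ?thesis .
qed

lemma lin_ext_submodule:
  assumes "module R M" "submodule H R M" "g \<in> B \<rightarrow> H" "f \<in> carrier (free_module R B)"
  shows "lin_ext R M g f \<in> H"
proof -
  interpret module R M by fact
  note H = submoduleE[OF assms(2)]
  have "(\<Oplus>\<^bsub>M\<^esub>b\<in>S. f b \<odot>\<^bsub>M\<^esub> g b) \<in> H" if "finite S" "S \<subseteq> B" for S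
    using that
  proof (induction S)
    case empty
    obtain h where "h \<in> H" using H(2) by blast
    then have "\<zero>\<^bsub>M\<^esub> \<in> H" using H(4)[OF R.zero_closed] H(1) by (metis smult_l_null subsetD)
    then show ?case by simp
  next
    case (insert b S)
    have *: "f c \<odot>\<^bsub>M\<^esub> g c \<in> H" if "c \<in> insert b S" for c
      using that insert.prems assms(3,4) by (intro H(4)) (auto simp: free_module_carrier)
    then have "f c \<odot>\<^bsub>M\<^esub> g c \<in> carrier M" if "c \<in> insert b S" for c using that H(1) by blast
    then show ?case using insert * H(5) by (simp add: Pi_iff)
  qed
  then show ?thesis unfolding lin_ext_def using assms(4) by (auto simp: free_module_carrier)
qed

lemma uncyc_cyc:
  assumes "finite {b. z b \<noteq> \<zero>\<^bsub>R\<^esub>}"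
  shows "uncyc R (cyc R z) = z"
proof -
  have "{(b, z b) |b. z b \<noteq> \<zero>\<^bsub>R\<^esub>} = (\<lambda>b. (b, z b)) ` {b. z b \<noteq> \<zero>\<^bsub>R\<^esub>}" by auto
  then have "fset (Abs_fset {(b, z b) |b. z b \<noteq> \<zero>\<^bsub>R\<^esub>}) = {(b, z b) |b. z b \<noteq> \<zero>\<^bsub>R\<^esub>}"
    using assms by (intro Abs_fset_inverse) simp
  then show ?thesis by (auto simp: cyc_def)
qed

lemma res_aug_hom:
  assumes "module R M"
  shows "res_aug R M \<in> mod_hom R (free_module R (Elt ` carrier M)) M"
  unfolding res_aug_def using assms by (intro lin_ext_hom) auto

lemma submodule_free_mono:
  assumes "cring R" "submodule H R (free_module R B)"
  shows "submodule H R (free_module R UNIV)"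
proof -
  interpret B: module R "free_module R B" by (rule module_free_module) fact
  interpret U: module R "free_module R UNIV" by (rule module_free_module) fact
  note H = B.submoduleE[OF assms(2)]
  have eq: "free_module R B = (free_module R UNIV)\<lparr>carrier := carrier (free_module R B)\<rparr>"
    by (simp add: free_module_def)
  have sm: "r \<odot>\<^bsub>free_module R UNIV\<^esub> x \<in> H" if "r \<in> carrier R" "x \<in> H" for r x
    using H(4)[OF that] by simp
  show ?thesis
  proof (rule U.submoduleI)
    show sub: "H \<subseteq> carrier (free_module R UNIV)" using H(1) by (auto simp: free_module_carrier)
    show "\<zero>\<^bsub>free_module R UNIV\<^esub> \<in> H"
      using submodule.axioms(1)[OF assms(2)] subgroup.one_closed by fastforce
    show "\<ominus>\<^bsub>free_module R UNIV\<^esub> a \<in> H" if "a \<in> H" for a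
      using sm[OF _ that, of "\<ominus>\<^bsub>R\<^esub> \<one>\<^bsub>R\<^esub>"] sub that U.smult_l_minus[of "\<one>\<^bsub>R\<^esub>" a] U.smult_one[of a]
      by (metis B.R.add.inv_closed B.R.one_closed subsetD)
  qed (use H(5) sm in auto)
qed

lemma res_cycles_submodule:
  assumes "module R M"
  shows "submodule (res_cycles R M n) R (free_module R UNIV)"
proof (induction n)
  interpret module R M by fact
  case 0
  show ?case
    using mod_hom_ker_submodule[OF module_free_module[OF R.is_cring] assms res_aug_hom[OF assms]]
    by (intro submodule_free_mono[OF R.is_cring]) simp
next
  interpret module R M by fact
  case (Suc n)
  interpret U: module R "free_module R UNIV" by (rule module_free_module) (rule R.is_cring)
  have sub: "res_cycles R M n \<subseteq> carrier (free_module R UNIV)" by (rule U.submoduleE(1)[OF Suc])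
  then have "uncyc R \<in> cyc R ` res_cycles R M n \<rightarrow> carrier (free_module R UNIV)"
    by (auto simp: uncyc_cyc free_module_carrier)
  from mod_hom_ker_submodule[OF module_free_module[OF R.is_cring] U.module_axioms lin_ext_hom[OF U.module_axioms this]]
  show ?case by (intro submodule_free_mono[OF R.is_cring]) simp
qed

lemma res_cycles_eq:
  assumes "0 \<le> n"
  shows "res_cycles R M (nat n) =
    {f \<in> carrier (res R M n). if n = 0 then res_aug R M f = \<zero>\<^bsub>M\<^esub> else res_diff R n f = (\<lambda>_. \<zero>\<^bsub>R\<^esub>)}"
proof (cases "n = 0")
  case False
  then have pos: "\<not> n < 0" "\<not> n \<le> 0" and n: "nat n = Suc (nat (n - 1))" using assms by linarith+
  show ?thesis unfolding n res_cycles.simps res_def res_basis_def res_diff_def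
    by (simp only: False pos if_False)
qed (simp add: res_def res_basis_def)

lemma res_diff_image:
  assumes "module R M" "1 \<le> n"
  shows "res_diff R n ` carrier (res R M n) = res_cycles R M (nat (n - 1))"
    and "res_diff R n \<in> mod_hom R (res R M n) (free_module R UNIV)"
proof -
  interpret module R M by fact
  interpret U: module R "free_module R UNIV" by (rule module_free_module) (rule R.is_cring)
  let ?Z = "res_cycles R M (nat (n - 1))"
  have Z: "submodule ?Z R (free_module R UNIV)" by (rule res_cycles_submodule) fact
  have sub: "?Z \<subseteq> carrier (free_module R UNIV)" by (rule U.submoduleE(1)[OF Z])
  then have un: "uncyc R (cyc R z) = z" if "z \<in> ?Z" for z
    using that by (auto simp: uncyc_cyc free_module_carrier)
  have d: "res_diff R n = lin_ext R (free_module R UNIV) (uncyc R)"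
    and P: "res R M n = free_module R (cyc R ` ?Z)"
    using assms(2) by (auto simp: res_diff_def res_def res_basis_def fun_eq_iff)
  show "res_diff R n \<in> mod_hom R (res R M n) (free_module R UNIV)"
    unfolding d P using sub by (intro lin_ext_hom U.module_axioms) (auto simp: un)
  show "res_diff R n ` carrier (res R M n) = ?Z"
  proof (intro equalityI subsetI)
    fix z assume "z \<in> res_diff R n ` carrier (res R M n)"
    then obtain f where f: "f \<in> carrier (free_module R (cyc R ` ?Z))"
      and z: "z = lin_ext R (free_module R UNIV) (uncyc R) f"
      unfolding d P by blast
    have "uncyc R \<in> cyc R ` ?Z \<rightarrow> ?Z" using un by auto
    from lin_ext_submodule[OF U.module_axioms Z this f] show "z \<in> ?Z" unfolding z .
  next
    fix z assume z: "z \<in> ?Z"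
    then have "res_diff R n (basis_vec R (cyc R z)) = z"
      unfolding d using sub by (subst lin_ext_basis_vec[OF U.module_axioms]) (auto simp: un)
    moreover have "basis_vec R (cyc R z) \<in> carrier (res R M n)"
      unfolding P using z by (intro basis_vec_carrier R.is_cring) auto
    ultimately show "z \<in> res_diff R n ` carrier (res R M n)" by (metis image_eqI)
  qed
qed

theorem res_free_resolution:
  assumes "module R M"
  shows "chain_complex R (res R M) (res_diff R)"
    and "n < 0 \<Longrightarrow> zero_module (res R M n)"
    and "0 < n \<Longrightarrow> cycles (res R M) (res_diff R) n = boundaries (res R M) (res_diff R) n"
    and "res_aug R M \<in> mod_hom R (res R M 0) M"
    and "{x \<in> carrier (res R M 0). res_aug R M x = \<zero>\<^bsub>M\<^esub>} = boundaries (res R M) (res_diff R) 0"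
    and "res_aug R M ` carrier (res R M 0) = carrier M"
proof -
  interpret module R M by fact
  have modP: "module R (res R M k)" for k unfolding res_def by (rule module_free_module) (rule R.is_cring)
  have P0: "(\<lambda>_. \<zero>\<^bsub>R\<^esub>) \<in> carrier (res R M k)" for k by (simp add: res_def free_module_carrier)
  have zP: "\<zero>\<^bsub>res R M k\<^esub> = (\<lambda>_. \<zero>\<^bsub>R\<^esub>)" for k by (simp add: res_def)
  have d0: "res_diff R k = (\<lambda>_ _. \<zero>\<^bsub>R\<^esub>)" if "k \<le> 0" for k using that by (simp add: res_diff_def fun_eq_iff)
  show cyc_bd: "cycles (res R M) (res_diff R) k = boundaries (res R M) (res_diff R) k" if "0 < k" for k
    using that res_diff_image(1)[OF assms, of "k + 1"] res_cycles_eq[of k R M]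
    by (simp add: cycles_def boundaries_def zP)
  show aug_bd: "{x \<in> carrier (res R M 0). res_aug R M x = \<zero>\<^bsub>M\<^esub>} = boundaries (res R M) (res_diff R) 0"
    using res_diff_image(1)[OF assms, of 1] res_cycles_eq[of 0 R M] by (simp add: boundaries_def)
  show "chain_complex R (res R M) (res_diff R)"
    unfolding chain_complex_def
  proof (intro allI conjI ballI modP)
    fix k
    show "res_diff R k \<in> mod_hom R (res R M k) (res R M (k - 1))"
    proof (cases "k \<le> 0")
      case True
      then show ?thesis using P0 by (simp add: d0 mod_hom_def res_def)
    next
      case False
      then have "res_diff R k ` carrier (res R M k) \<subseteq> carrier (res R M (k - 1))"
        using res_diff_image(1)[OF assms, of k] res_cycles_eq[of "k - 1" R M] by auto
      then show ?thesis using res_diff_image(2)[OF assms, of k] False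
        by (auto simp: mod_hom_def res_def)
    qed
    fix x assume x: "x \<in> carrier (res R M k)"
    show "res_diff R (k - 1) (res_diff R k x) = \<zero>\<^bsub>res R M (k - 2)\<^esub>"
    proof (cases "k \<le> 1")
      case True
      then show ?thesis by (simp add: d0 zP)
    next
      case False
      then have "res_diff R k x \<in> boundaries (res R M) (res_diff R) (k - 1)"
        using x by (simp add: boundaries_def)
      then show ?thesis using cyc_bd[of "k - 1"] False by (auto simp: cycles_def zP)
    qed
  qed
  show "zero_module (res R M n)" if "n < 0"
    using that by (auto simp: zero_module_def res_def res_basis_def free_module_carrier)
  show "res_aug R M \<in> mod_hom R (res R M 0) M"
    using res_aug_hom[OF assms] by (simp add: res_def res_basis_def)
  then have "res_aug R M ` carrier (res R M 0) \<subseteq> carrier M" by (auto simp: mod_hom_def)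
  moreover have "m \<in> res_aug R M ` carrier (res R M 0)" if "m \<in> carrier M" for m
  proof
    show "m = res_aug R M (basis_vec R (Elt m))"
      unfolding res_aug_def using that by (subst lin_ext_basis_vec[OF assms]) auto
    show "basis_vec R (Elt m) \<in> carrier (res R M 0)"
      unfolding res_def res_basis_def using that by (intro basis_vec_carrier R.is_cring) auto
  qed
  ultimately show "res_aug R M ` carrier (res R M 0) = carrier M" by blast
qed

definition Ext :: "('r, 'e) ring_scheme \<Rightarrow> nat \<Rightarrow> ('r, 'm) module \<Rightarrow> ('r, 'n) module \<Rightarrow>
    ('r, ((('r, 'm) res_gen \<Rightarrow> 'r) \<Rightarrow> 'n) set) module" where
  "Ext R i M N =
    homology (coHom_cplx R (res R M) N) (coHom_diff (res R M) (res_diff R)) (- int i)"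

definition Tor :: "('r, 'e) ring_scheme \<Rightarrow> nat \<Rightarrow> ('r, 'c) module \<Rightarrow> ('r, 'm) module \<Rightarrow>
    ('r, ('c \<times> (('r, 'm) res_gen \<Rightarrow> 'r) \<Rightarrow> 'r) set set) module" where
  "Tor R i C M =
    homology (\<lambda>n. tensor R C (res R M n))
      (\<lambda>n. tensor_map R C (res R M (n - 1)) id (res_diff R n)) (int i)"


section \<open>Semidualizing modules, injective modules and quasi-injective dimension\<close>

definition semidualizing :: "('r, 'e) ring_scheme \<Rightarrow> ('r, 'c) module \<Rightarrow> bool" where
  "semidualizing R C \<longleftrightarrow>
    module R C \<and> fin_gen_module R C \<and>
    bij_betw (\<lambda>r. \<lambda>c\<in>carrier C. r \<odot>\<^bsub>C\<^esub> c) (carrier R) (carrier (Hom R C C)) \<and>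
    (\<forall>i>0. zero_module (Ext R i C C))"

text \<open>
  A definition cannot quantify over all types, so the modules \<open>A\<close> and \<open>B\<close> in the
  lifting property have elements of type \<^typ>\<open>'r\<close>.  This is no restriction: lemma
  \<open>injective_module_extend\<close> below (Baer) gives the lifting property for \<open>A\<close> and \<open>B\<close> over
  arbitrary types.
\<close>

definition injective_module :: "('r, 'e) ring_scheme \<Rightarrow> ('r, 'i) module \<Rightarrow> bool" where
  "injective_module R I \<longleftrightarrow> module R I \<and>
    (\<forall>(A :: ('r, 'r) module) (B :: ('r, 'r) module). \<forall>f\<in>mod_hom R A B. \<forall>g\<in>mod_hom R A I.
       module R A \<and> module R B \<and> inj_on f (carrier A) \<longrightarrow>
       (\<exists>h\<in>mod_hom R B I. \<forall>x\<in>carrier A. h (f x) = g x))"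

definition ring_module :: "('r, 'e) ring_scheme \<Rightarrow> ('r, 'r) module" where
  "ring_module R = \<lparr>carrier = carrier R, mult = undefined, one = undefined,
     zero = \<zero>\<^bsub>R\<^esub>, add = add R, smult = mult R\<rparr>"

lemma ring_module_simps [simp]:
  "carrier (ring_module R) = carrier R" "\<zero>\<^bsub>ring_module R\<^esub> = \<zero>\<^bsub>R\<^esub>"
  "x \<oplus>\<^bsub>ring_module R\<^esub> y = x \<oplus>\<^bsub>R\<^esub> y" "r \<odot>\<^bsub>ring_module R\<^esub> y = r \<otimes>\<^bsub>R\<^esub> y"
  by (simp_all add: ring_module_def)

lemma module_ring_module:
  assumes "cring R"
  shows "module R (ring_module R)"
proof -
  interpret cring R by fact
  have "abelian_group (ring_module R)"
    by (rule abelian_groupI) (auto simp: a_ac intro: l_neg)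
  then show ?thesis
    by (intro moduleI) (auto simp: l_distr r_distr m_assoc assms)
qed

lemma injective_module_ideal_extend:
  assumes inj: "injective_module R I" and J: "submodule J R (ring_module R)"
    and \<phi>: "\<phi> \<in> mod_hom R ((ring_module R)\<lparr>carrier := J\<rparr>) I"
  obtains y where "y \<in> carrier I" "\<And>r. r \<in> J \<Longrightarrow> \<phi> r = r \<odot>\<^bsub>I\<^esub> y"
proof -
  interpret I: module R I using inj by (simp add: injective_module_def)
  have R: "module R (ring_module R)" by (rule module_ring_module) (rule I.R.is_cring)
  have JR: "J \<subseteq> carrier R" using module.submoduleE(1)[OF R J] by simp
  have "id \<in> mod_hom R ((ring_module R)\<lparr>carrier := J\<rparr>) (ring_module R)"
    using JR by (auto simp: mod_hom_def)
  moreover have "module R ((ring_module R)\<lparr>carrier := J\<rparr>)"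
    by (rule submodule.submodule_is_module[OF J R])
  ultimately obtain h where h: "h \<in> mod_hom R (ring_module R) I" "\<And>x. x \<in> J \<Longrightarrow> h x = \<phi> x"
    using inj R \<phi> unfolding injective_module_def
    by (metis (no_types, lifting) id_apply inj_on_id partial_object.simps(1) partial_object.update_convs(1) partial_object.surjective)
  show thesis
  proof
    show "h \<one>\<^bsub>R\<^esub> \<in> carrier I" using mod_homD(1)[OF h(1)] by simp
    fix r assume "r \<in> J"
    then show "\<phi> r = r \<odot>\<^bsub>I\<^esub> h \<one>\<^bsub>R\<^esub>"
      using mod_homD(3)[OF h(1), of r "\<one>\<^bsub>R\<^esub>"] h(2) JR by auto
  qed
qed

lemma injective_module_extend:
  fixes A :: "('r, 'a) module" and B :: "('r, 'b) module" and I :: "('r, 'i) module"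
  assumes inj: "injective_module R I" and A: "module R A" and B: "module R B"
    and f: "f \<in> mod_hom R A B" "inj_on f (carrier A)" and g: "g \<in> mod_hom R A I"
  shows "\<exists>h\<in>mod_hom R B I. \<forall>x\<in>carrier A. h (f x) = g x"
proof -
  interpret I: module R I using inj by (simp add: injective_module_def)
  interpret A: module R A by fact
  interpret B: module R B by fact
  define good where "good G \<longleftrightarrow> G \<subseteq> carrier B \<times> carrier I \<and> (\<forall>a\<in>carrier A. (f a, g a) \<in> G) \<and>
     (\<forall>x y x' y'. (x, y) \<in> G \<longrightarrow> (x', y') \<in> G \<longrightarrow> (x \<oplus>\<^bsub>B\<^esub> x', y \<oplus>\<^bsub>I\<^esub> y') \<in> G) \<and>
     (\<forall>r\<in>carrier R. \<forall>x y. (x, y) \<in> G \<longrightarrow> (r \<odot>\<^bsub>B\<^esub> x, r \<odot>\<^bsub>I\<^esub> y) \<in> G) \<and>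
     (\<forall>y. (\<zero>\<^bsub>B\<^esub>, y) \<in> G \<longrightarrow> y = \<zero>\<^bsub>I\<^esub>)" for G
  note f' = mod_homD[OF f(1)] and g' = mod_homD[OF g]
  have f0: "f \<zero>\<^bsub>A\<^esub> = \<zero>\<^bsub>B\<^esub>" and g0: "g \<zero>\<^bsub>A\<^esub> = \<zero>\<^bsub>I\<^esub>"
    using f'(3)[of "\<zero>\<^bsub>R\<^esub>" "\<zero>\<^bsub>A\<^esub>"] g'(3)[of "\<zero>\<^bsub>R\<^esub>" "\<zero>\<^bsub>A\<^esub>"] f'(1) g'(1) by simp_all
  define G0 where "G0 = (\<lambda>a. (f a, g a)) ` carrier A"
  have "good G0"
    unfolding good_def
  proof (intro conjI allI impI ballI)
    show "G0 \<subseteq> carrier B \<times> carrier I" using f'(1) g'(1) by (auto simp: G0_def)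
    show "(f a, g a) \<in> G0" if "a \<in> carrier A" for a using that by (auto simp: G0_def)
    show "(x \<oplus>\<^bsub>B\<^esub> x', y \<oplus>\<^bsub>I\<^esub> y') \<in> G0" if "(x, y) \<in> G0" "(x', y') \<in> G0" for x y x' y'
      using that f'(2) g'(2) unfolding G0_def image_iff by (metis A.add.m_closed prod.inject)
    show "(r \<odot>\<^bsub>B\<^esub> x, r \<odot>\<^bsub>I\<^esub> y) \<in> G0" if "r \<in> carrier R" "(x, y) \<in> G0" for r x y
      using that f'(3) g'(3) unfolding G0_def image_iff by (metis A.smult_closed prod.inject)
    show "y = \<zero>\<^bsub>I\<^esub>" if "(\<zero>\<^bsub>B\<^esub>, y) \<in> G0" for y
      using that f0 g0 f(2) unfolding G0_def image_iff by (metis A.M.zero_closed inj_onD prod.inject)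
  qed
  have chainU: "good (\<Union>\<C>)" if "\<C> \<noteq> {}" "subset.chain {G. good G} \<C>" for \<C>
  proof -
    have gd: "good G" if "G \<in> \<C>" for G using that \<open>subset.chain _ \<C>\<close> by (auto simp: subset.chain_def)
    have un: "\<exists>G\<in>\<C>. p \<in> G \<and> q \<in> G" if "p \<in> \<Union>\<C>" "q \<in> \<Union>\<C>" for p q
      using that \<open>subset.chain _ \<C>\<close> unfolding subset_chain_def by blast
    obtain G1 where "G1 \<in> \<C>" using \<open>\<C> \<noteq> {}\<close> by auto
    show ?thesis unfolding good_def
    proof (intro conjI allI impI ballI)
      show "\<Union>\<C> \<subseteq> carrier B \<times> carrier I" using gd unfolding good_def by blast
      show "(f a, g a) \<in> \<Union>\<C>" if "a \<in> carrier A" for a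
        using gd[OF \<open>G1 \<in> \<C>\<close>] that \<open>G1 \<in> \<C>\<close> unfolding good_def by blast
      show "(x \<oplus>\<^bsub>B\<^esub> x', y \<oplus>\<^bsub>I\<^esub> y') \<in> \<Union>\<C>" if "(x, y) \<in> \<Union>\<C>" "(x', y') \<in> \<Union>\<C>" for x y x' y'
        using un[OF that] gd unfolding good_def by blast
      show "(r \<odot>\<^bsub>B\<^esub> x, r \<odot>\<^bsub>I\<^esub> y) \<in> \<Union>\<C>" if "r \<in> carrier R" "(x, y) \<in> \<Union>\<C>" for r x y
        using that gd unfolding good_def by blast
      show "y = \<zero>\<^bsub>I\<^esub>" if "(\<zero>\<^bsub>B\<^esub>, y) \<in> \<Union>\<C>" for y
        using that gd unfolding good_def by blast
    qed
  qed
  obtain G where "good G" and max: "\<And>G'. good G' \<Longrightarrow> G \<subseteq> G' \<Longrightarrow> G' = G"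
    using subset_Zorn_nonempty[of "{G. good G}"] \<open>good G0\<close> chainU by auto
  note gG = \<open>good G\<close>[unfolded good_def]
  have Gsub: "x \<in> carrier B \<and> y \<in> carrier I" if "(x, y) \<in> G" for x y using gG that by blast
  have Gadd: "(x \<oplus>\<^bsub>B\<^esub> x', y \<oplus>\<^bsub>I\<^esub> y') \<in> G" if "(x, y) \<in> G" "(x', y') \<in> G" for x y x' y' using gG that by blast
  have Gsm: "(r \<odot>\<^bsub>B\<^esub> x, r \<odot>\<^bsub>I\<^esub> y) \<in> G" if "r \<in> carrier R" "(x, y) \<in> G" for r x y using gG that by blast
  have Gz: "y = \<zero>\<^bsub>I\<^esub>" if "(\<zero>\<^bsub>B\<^esub>, y) \<in> G" for y using gG that by blast
  have GA: "(f a, g a) \<in> G" if "a \<in> carrier A" for a using gG that by blast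
  have G00: "(\<zero>\<^bsub>B\<^esub>, \<zero>\<^bsub>I\<^esub>) \<in> G" using GA[of "\<zero>\<^bsub>A\<^esub>"] f0 g0 by simp
  have Gneg: "(\<ominus>\<^bsub>B\<^esub> x, \<ominus>\<^bsub>I\<^esub> y) \<in> G" if "(x, y) \<in> G" for x y
    using Gsm[OF _ that, of "\<ominus>\<^bsub>R\<^esub> \<one>\<^bsub>R\<^esub>"] Gsub[OF that] by (simp add: B.smult_l_minus I.smult_l_minus)
  have Gfun: "y = y'" if "(x, y) \<in> G" "(x, y') \<in> G" for x y y'
  proof -
    have "y \<oplus>\<^bsub>I\<^esub> \<ominus>\<^bsub>I\<^esub> y' = \<zero>\<^bsub>I\<^esub>"
      using Gz Gadd[OF that(1) Gneg[OF that(2)]] Gsub[OF that(1)] by (simp add: B.M.r_neg)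
    then show ?thesis using Gsub[OF that(1)] Gsub[OF that(2)]
      by (metis I.M.add.inv_closed I.M.add.inv_equality I.M.minus_minus)
  qed
  have total: "b \<in> fst ` G" if b: "b \<in> carrier B" for b
  proof -
    define J where "J = {r \<in> carrier R. r \<odot>\<^bsub>B\<^esub> b \<in> fst ` G}"
    define \<phi> where "\<phi> r = (THE y. (r \<odot>\<^bsub>B\<^esub> b, y) \<in> G)" for r
    have \<phi>: "(r \<odot>\<^bsub>B\<^esub> b, \<phi> r) \<in> G" if rJ: "r \<in> J" for r
      unfolding \<phi>_def
    proof (rule theI'[of "\<lambda>y. (r \<odot>\<^bsub>B\<^esub> b, y) \<in> G"])
      obtain y where "(r \<odot>\<^bsub>B\<^esub> b, y) \<in> G" using rJ by (auto simp: J_def)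
      then show "\<exists>!y. (r \<odot>\<^bsub>B\<^esub> b, y) \<in> G" using Gfun by blast
    qed
    have \<phi>eq: "\<phi> r = y" if "(r \<odot>\<^bsub>B\<^esub> b, y) \<in> G" for r y
      unfolding \<phi>_def using that Gfun by blast
    have Jin: "r \<in> J" if "r \<in> carrier R" "(r \<odot>\<^bsub>B\<^esub> b, y) \<in> G" for r y
      using that by (force simp: J_def)
    have JR: "J \<subseteq> carrier R" by (auto simp: J_def)
    have Jadd: "(( r \<oplus>\<^bsub>R\<^esub> s) \<odot>\<^bsub>B\<^esub> b, \<phi> r \<oplus>\<^bsub>I\<^esub> \<phi> s) \<in> G" if "r \<in> J" "s \<in> J" for r s
      using Gadd[OF \<phi>[OF that(1)] \<phi>[OF that(2)]] that JR b by (simp add: B.smult_l_distr subsetD)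
    have Jsm: "(( r \<otimes>\<^bsub>R\<^esub> s) \<odot>\<^bsub>B\<^esub> b, r \<odot>\<^bsub>I\<^esub> \<phi> s) \<in> G" if "r \<in> carrier R" "s \<in> J" for r s
      using Gsm[OF that(1) \<phi>[OF that(2)]] that JR b by (simp add: B.smult_assoc1 subsetD)
    interpret RM: module R "ring_module R" by (rule module_ring_module) (rule I.R.is_cring)
    have sm: "r \<otimes>\<^bsub>R\<^esub> s \<in> J" if "r \<in> carrier R" "s \<in> J" for r s
      using Jin Jsm[OF that] that JR by auto
    have neg: "\<ominus>\<^bsub>ring_module R\<^esub> s \<in> J" if "s \<in> J" for s
      using sm[OF _ that, of "\<ominus>\<^bsub>R\<^esub> \<one>\<^bsub>R\<^esub>"] RM.smult_l_minus[of "\<one>\<^bsub>R\<^esub>" s] that JR by auto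
    have J: "submodule J R (ring_module R)"
    proof (rule RM.submoduleI)
      show "J \<subseteq> carrier (ring_module R)" using JR by simp
      show "\<zero>\<^bsub>ring_module R\<^esub> \<in> J" using Jin[of "\<zero>\<^bsub>R\<^esub>" "\<zero>\<^bsub>I\<^esub>"] G00 b by simp
      show "a \<oplus>\<^bsub>ring_module R\<^esub> c \<in> J" if "a \<in> J" "c \<in> J" for a c
        using Jin Jadd[OF that] that JR by (auto simp: subsetD)
    qed (use neg sm in auto)
    have "\<phi> \<in> mod_hom R ((ring_module R)\<lparr>carrier := J\<rparr>) I"
      using Gsub[OF \<phi>] \<phi>eq[OF Jadd] \<phi>eq[OF Jsm] by (auto simp: mod_hom_def)
    then obtain y where y: "y \<in> carrier I" and \<phi>y: "\<And>r. r \<in> J \<Longrightarrow> \<phi> r = r \<odot>\<^bsub>I\<^esub> y"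
      using injective_module_ideal_extend[OF inj J] by blast
    define G' where "G' = {(x \<oplus>\<^bsub>B\<^esub> r \<odot>\<^bsub>B\<^esub> b, v \<oplus>\<^bsub>I\<^esub> r \<odot>\<^bsub>I\<^esub> y) |x v r. (x, v) \<in> G \<and> r \<in> carrier R}"
    have GG': "G \<subseteq> G'"
    proof
      fix p assume "p \<in> G"
      moreover obtain x v where "p = (x, v)" by (cases p)
      ultimately have "p = (x \<oplus>\<^bsub>B\<^esub> \<zero>\<^bsub>R\<^esub> \<odot>\<^bsub>B\<^esub> b, v \<oplus>\<^bsub>I\<^esub> \<zero>\<^bsub>R\<^esub> \<odot>\<^bsub>I\<^esub> y) \<and> (x, v) \<in> G"
        using b y Gsub by simp
      then show "p \<in> G'" unfolding G'_def using I.R.zero_closed by blast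
    qed
    have "good G'" unfolding good_def
    proof (intro conjI allI impI ballI)
      show "G' \<subseteq> carrier B \<times> carrier I" using Gsub b y by (auto simp: G'_def)
      show "(f a, g a) \<in> G'" if "a \<in> carrier A" for a using GG' GA that by blast
      show "(x1 \<oplus>\<^bsub>B\<^esub> x1', y1 \<oplus>\<^bsub>I\<^esub> y1') \<in> G'" if "(x1, y1) \<in> G'" "(x1', y1') \<in> G'" for x1 y1 x1' y1'
      proof -
        note asm = that
        obtain x v r where 1: "x1 = x \<oplus>\<^bsub>B\<^esub> r \<odot>\<^bsub>B\<^esub> b" "y1 = v \<oplus>\<^bsub>I\<^esub> r \<odot>\<^bsub>I\<^esub> y" "(x, v) \<in> G" "r \<in> carrier R"
          using asm(1) unfolding G'_def by blast
        obtain x' v' r' where 2: "x1' = x' \<oplus>\<^bsub>B\<^esub> r' \<odot>\<^bsub>B\<^esub> b" "y1' = v' \<oplus>\<^bsub>I\<^esub> r' \<odot>\<^bsub>I\<^esub> y" "(x', v') \<in> G" "r' \<in> carrier R"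
          using asm(2) unfolding G'_def by blast
        have "x1 \<oplus>\<^bsub>B\<^esub> x1' = (x \<oplus>\<^bsub>B\<^esub> x') \<oplus>\<^bsub>B\<^esub> (r \<oplus>\<^bsub>R\<^esub> r') \<odot>\<^bsub>B\<^esub> b"
          using 1 2 b Gsub[OF 1(3)] Gsub[OF 2(3)] by (simp add: B.smult_l_distr B.M.a_ac)
        moreover have "y1 \<oplus>\<^bsub>I\<^esub> y1' = (v \<oplus>\<^bsub>I\<^esub> v') \<oplus>\<^bsub>I\<^esub> (r \<oplus>\<^bsub>R\<^esub> r') \<odot>\<^bsub>I\<^esub> y"
          using 1 2 y Gsub[OF 1(3)] Gsub[OF 2(3)] by (simp add: I.smult_l_distr I.M.a_ac)
        ultimately show ?thesis
          unfolding G'_def using Gadd[OF 1(3) 2(3)] I.R.add.m_closed[OF 1(4) 2(4)] by blast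
      qed
      show "(s \<odot>\<^bsub>B\<^esub> x1, s \<odot>\<^bsub>I\<^esub> y1) \<in> G'" if "s \<in> carrier R" "(x1, y1) \<in> G'" for s x1 y1
      proof -
        note asm = that
        obtain x v r where 1: "x1 = x \<oplus>\<^bsub>B\<^esub> r \<odot>\<^bsub>B\<^esub> b" "y1 = v \<oplus>\<^bsub>I\<^esub> r \<odot>\<^bsub>I\<^esub> y" "(x, v) \<in> G" "r \<in> carrier R"
          using asm(2) unfolding G'_def by blast
        have "s \<odot>\<^bsub>B\<^esub> x1 = s \<odot>\<^bsub>B\<^esub> x \<oplus>\<^bsub>B\<^esub> (s \<otimes>\<^bsub>R\<^esub> r) \<odot>\<^bsub>B\<^esub> b" "s \<odot>\<^bsub>I\<^esub> y1 = s \<odot>\<^bsub>I\<^esub> v \<oplus>\<^bsub>I\<^esub> (s \<otimes>\<^bsub>R\<^esub> r) \<odot>\<^bsub>I\<^esub> y"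
          using 1 that(1) b y Gsub[OF 1(3)]
          by (simp_all add: B.smult_r_distr B.smult_assoc1 I.smult_r_distr I.smult_assoc1)
        then show ?thesis
          unfolding G'_def using Gsm[OF that(1) 1(3)] I.R.m_closed[OF that(1) 1(4)] by blast
      qed
      show "y1 = \<zero>\<^bsub>I\<^esub>" if "(\<zero>\<^bsub>B\<^esub>, y1) \<in> G'" for y1
      proof -
        note asm = that
        obtain x v r where 1: "\<zero>\<^bsub>B\<^esub> = x \<oplus>\<^bsub>B\<^esub> r \<odot>\<^bsub>B\<^esub> b" "y1 = v \<oplus>\<^bsub>I\<^esub> r \<odot>\<^bsub>I\<^esub> y" "(x, v) \<in> G" "r \<in> carrier R"
          using asm unfolding G'_def by blast
        have eq: "r \<odot>\<^bsub>B\<^esub> b = \<ominus>\<^bsub>B\<^esub> x"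
          using 1 b Gsub[OF 1(3)] by (metis B.M.add.inv_equality B.M.add.m_comm B.smult_closed)
        then have "(r \<odot>\<^bsub>B\<^esub> b, \<ominus>\<^bsub>I\<^esub> v) \<in> G" using Gneg[OF 1(3)] by simp
        then have "r \<odot>\<^bsub>I\<^esub> y = \<ominus>\<^bsub>I\<^esub> v" using \<phi>y \<phi>eq Jin 1(4) by metis
        then show ?thesis using 1 Gsub[OF 1(3)] by (simp add: I.M.r_neg)
      qed
    qed
    then have "G' = G" using max GG' by blast
    moreover have "(\<zero>\<^bsub>B\<^esub> \<oplus>\<^bsub>B\<^esub> \<one>\<^bsub>R\<^esub> \<odot>\<^bsub>B\<^esub> b, \<zero>\<^bsub>I\<^esub> \<oplus>\<^bsub>I\<^esub> \<one>\<^bsub>R\<^esub> \<odot>\<^bsub>I\<^esub> y) \<in> G'"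
      unfolding G'_def using G00 I.R.one_closed by blast
    ultimately show ?thesis using b by force
  qed
  define h where "h x = (THE y. (x, y) \<in> G)" for x
  have hG: "(x, h x) \<in> G" if xB: "x \<in> carrier B" for x
    unfolding h_def
  proof (rule theI'[of "\<lambda>y. (x, y) \<in> G"])
    obtain y where "(x, y) \<in> G" using total[OF xB] by auto
    then show "\<exists>!y. (x, y) \<in> G" using Gfun by blast
  qed
  have heq: "h x = y" if "(x, y) \<in> G" for x y
    unfolding h_def using that Gfun by blast
  have "h \<in> mod_hom R B I"
    using Gsub[OF hG] heq[OF Gadd[OF hG hG]] heq[OF Gsm[OF _ hG]] by (auto simp: mod_hom_def)
  then show ?thesis using heq[OF GA] by blast
qed

definition C_quasi_injective_resolution ::
  "('r, 'e) ring_scheme \<Rightarrow> ('r, 'c) module \<Rightarrow> ('r, 'n) module \<Rightarrow>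
    (int \<Rightarrow> ('r, 'i) module) \<Rightarrow> (int \<Rightarrow> 'i \<Rightarrow> 'i) \<Rightarrow> bool" where
  "C_quasi_injective_resolution R C N I d \<longleftrightarrow>
    chain_complex R I d \<and> bounded_complex I \<and> (\<forall>n. injective_module R (I n)) \<and>
    \<not> acyclic_complex (Hom_cplx R C I) (Hom_diff C d) \<and>
    (\<forall>n. zero_module (homology (Hom_cplx R C I) (Hom_diff C d) n) \<or>
         (\<exists>k. mod_iso R (homology (Hom_cplx R C I) (Hom_diff C d) n) (direct_power N k)))"

text \<open>
  The infimum is taken over the resolutions whose modules have elements of type
  \<^typ>\<open>'i\<close>, since a definition cannot quantify over all types.  The dimension proper is
  the least value over all \<^typ>\<open>'i\<close>; it is attained for some \<^typ>\<open>'i\<close> because the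
  finite values are natural numbers.  Statements about the dimension must therefore leave
  \<^typ>\<open>'i\<close> arbitrary.
\<close>

definition C_qid :: "'i itself \<Rightarrow> ('r, 'e) ring_scheme \<Rightarrow> ('r, 'c) module \<Rightarrow> ('r, 'n) module \<Rightarrow> ereal" where
  "C_qid T R C N =
    (if zero_module N then - \<infinity>
     else INF (I, d) \<in> {(I :: int \<Rightarrow> ('r, 'i) module, d). C_quasi_injective_resolution R C N I d}.
            hinf_complex (Hom_cplx R C I) (Hom_diff C d) - inf_complex (Hom_cplx R C I))"

end

(* Put X = Hom(C, I) for a C-quasi-injective resolution I of N.  Each X n is acyclic for Hom(M, _):
   by adjunction Ext^i(M, X n) is Hom(Tor_i(C, M), I n), which vanishes for i > 0.  Let a be the lowest
   degree of X, h the lowest degree of its homology, and suppose Ext^i(M, N) = 0 for i > t, where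
   t > h - a.  Going down from the top of X along the sequences 0 -> B_n -> Z_n -> H_n -> 0 and
   0 -> Z_n -> X_n -> B_(n-1) -> 0 gives Ext^i(M, B_n) = 0 for i >= t.  Going up from a, where
   B_n = Z_n as long as n < h, gives Ext^t(M, Z_h) = 0.  Hence Ext^t(M, H_h) = 0, and H_h is a nonzero
   power of N, so Ext^t(M, N) = 0; descend on t. *)
theory Submission
  imports Defs
begin

section \<open>Homomorphisms\<close>

text \<open>\<open>Ext\<close> and \<open>Tor\<close> are homology modules built from cosets over
  one standard resolution, and the coefficients, from \<open>X n\<close> to the powers of
  \<open>N\<close>, live in different types. The argument therefore runs on the predicate
  \<open>Ext_vanishes\<close>: every cocycle on \<open>P n\<close> with values in \<open>Y\<close>
  is a coboundary. Over a degreewise free \<open>P\<close>, three segments of the long exact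
  sequence of Ext can be checked on it by lifting maps, and every move up or down the complex
  combines them. The adjunction is likewise carried out on the free modules that present the tensor
  products of \<open>C\<close> with \<open>P n\<close>.

  The bound arises on the way up: each degree passed costs one degree of Ext, so \<open>Z h\<close>
  is reached with Ext zero from degree \<open>h - a + 1\<close> on. The way down costs nothing,
  whatever the length of \<open>X\<close>: a step trades degree \<open>i + 1\<close> for degree
  \<open>i\<close>, and \<open>i + 1 > t\<close> holds again for every
  \<open>i \<ge> t\<close>.\<close>

lemma (in abelian_group) minus_self: "x \<in> carrier G \<Longrightarrow> x \<ominus> x = \<zero>"
  by (simp add: a_minus_def r_neg)

lemma (in abelian_group) minus_eq_zero_iff:
  assumes "x \<in> carrier G" "y \<in> carrier G"
  shows "x \<ominus> y = \<zero> \<longleftrightarrow> x = y"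
proof
  assume "x \<ominus> y = \<zero>"
  then show "x = y" using assms minus_equality[of x "\<ominus> y"] by (simp add: a_minus_def)
qed (simp add: minus_self assms)

lemma mod_hom_zero:
  assumes "module R M" "module R N" "f \<in> mod_hom R M N"
  shows "f \<zero>\<^bsub>M\<^esub> = \<zero>\<^bsub>N\<^esub>"
proof -
  interpret M: module R M by fact
  interpret N: module R N by fact
  show ?thesis
    using mod_homD(3)[OF assms(3), of "\<zero>\<^bsub>R\<^esub>" "\<zero>\<^bsub>M\<^esub>"] mod_homD(1)[OF assms(3), of "\<zero>\<^bsub>M\<^esub>"] by simp
qed

lemma mod_hom_diff:
  assumes "module R M" "module R N" "f \<in> mod_hom R M N" "x \<in> carrier M" "y \<in> carrier M"
  shows "f (x \<ominus>\<^bsub>M\<^esub> y) = f x \<ominus>\<^bsub>N\<^esub> f y"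
proof -
  interpret M: module R M by fact
  interpret N: module R N by fact
  note f = mod_homD[OF assms(3)]
  have "f (\<ominus>\<^bsub>M\<^esub> y) \<oplus>\<^bsub>N\<^esub> f y = \<zero>\<^bsub>N\<^esub>"
    using f(2)[of "\<ominus>\<^bsub>M\<^esub> y" y] assms(5) mod_hom_zero[OF assms(1-3)] by (simp add: M.M.l_neg)
  then have "f (\<ominus>\<^bsub>M\<^esub> y) = \<ominus>\<^bsub>N\<^esub> f y"
    using f(1) assms(5) by (metis M.M.a_inv_closed N.M.minus_equality)
  then show ?thesis using f(2)[of x "\<ominus>\<^bsub>M\<^esub> y"] assms(4,5) by (simp add: a_minus_def)
qed

lemma mod_hom_comp:
  assumes "f \<in> mod_hom R L M" "g \<in> mod_hom R M N"
  shows "(\<lambda>x. g (f x)) \<in> mod_hom R L N"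
  using assms by (auto simp: mod_hom_def Pi_iff)

lemma mod_hom_add:
  assumes "module R N" "f \<in> mod_hom R M N" "g \<in> mod_hom R M N"
  shows "(\<lambda>x. f x \<oplus>\<^bsub>N\<^esub> g x) \<in> mod_hom R M N"
proof -
  interpret N: module R N by fact
  show ?thesis using assms(2,3) by (auto simp: mod_hom_def Pi_iff N.smult_r_distr N.M.a_ac)
qed

lemma mod_hom_sub:
  assumes "module R N" "f \<in> mod_hom R M N" "g \<in> mod_hom R M N"
  shows "(\<lambda>x. f x \<ominus>\<^bsub>N\<^esub> g x) \<in> mod_hom R M N"
proof -
  interpret N: module R N by fact
  have *: "r \<odot>\<^bsub>N\<^esub> (u \<ominus>\<^bsub>N\<^esub> v) = r \<odot>\<^bsub>N\<^esub> u \<ominus>\<^bsub>N\<^esub> r \<odot>\<^bsub>N\<^esub> v"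
    if "r \<in> carrier R" "u \<in> carrier N" "v \<in> carrier N" for r u v
    using that by (simp add: a_minus_def N.smult_r_distr N.smult_r_minus)
  show ?thesis using assms(2,3)
    by (auto simp: mod_hom_def Pi_iff * ) (simp add: a_minus_def N.M.minus_add N.M.a_ac)
qed

text \<open>Submodules appear as the ambient record with its carrier replaced, so zero and the
  operations stay those of \<open>N\<close> and no inclusion map occurs.\<close>

lemma mod_hom_restrict_codomain:
  assumes "A \<subseteq> carrier N"
  shows "f \<in> mod_hom R M (N\<lparr>carrier := A\<rparr>) \<longleftrightarrow> f \<in> mod_hom R M N \<and> (\<forall>x\<in>carrier M. f x \<in> A)"
  using assms by (auto simp: mod_hom_def)

lemma mod_hom_image_submodule:
  assumes "module R M" "module R N" "f \<in> mod_hom R M N"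
  shows "submodule (f ` carrier M) R N"
proof -
  interpret M: module R M by fact
  interpret N: module R N by fact
  note f = mod_homD[OF assms(3)]
  show ?thesis
  proof (rule N.submoduleI)
    show "f ` carrier M \<subseteq> carrier N" using f(1) by blast
    show "\<zero>\<^bsub>N\<^esub> \<in> f ` carrier M" using mod_hom_zero[OF assms] by force
    show "\<ominus>\<^bsub>N\<^esub> a \<in> f ` carrier M" if a: "a \<in> f ` carrier M" for a
    proof -
      obtain x where x: "x \<in> carrier M" "a = f x" using a by auto
      have "f (\<zero>\<^bsub>M\<^esub> \<ominus>\<^bsub>M\<^esub> x) = \<ominus>\<^bsub>N\<^esub> a"
        using x f(1) mod_hom_diff[OF assms, of "\<zero>\<^bsub>M\<^esub>" x] mod_hom_zero[OF assms] by (simp add: a_minus_def)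
      then show ?thesis using x by (metis M.M.minus_closed M.M.zero_closed image_eqI)
    qed
    show "a \<oplus>\<^bsub>N\<^esub> b \<in> f ` carrier M" if "a \<in> f ` carrier M" "b \<in> f ` carrier M" for a b
      using that f(2) by (metis (no_types, lifting) M.M.a_closed imageE image_eqI)
    show "r \<odot>\<^bsub>N\<^esub> a \<in> f ` carrier M" if "r \<in> carrier R" "a \<in> f ` carrier M" for r a
      using that f(3) by (metis (no_types, lifting) M.smult_closed imageE image_eqI)
  qed
qed

section \<open>Maps out of free modules\<close>

lemma free_module_hom_eqI:
  assumes "module R N" "h \<in> mod_hom R (free_module R B) N" "h' \<in> mod_hom R (free_module R B) N"
    and eq: "\<And>b. b \<in> B \<Longrightarrow> h (basis_vec R b) = h' (basis_vec R b)"
    and f: "f \<in> carrier (free_module R B)"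
  shows "h f = h' f"
proof -
  interpret N: module R N by fact
  interpret F: module R "free_module R B" by (rule module_free_module) (rule N.R.is_cring)
  \<comment> \<open>Induction on a finite set containing the support, not on the support itself, so
    that clearing one coordinate stays within the induction hypothesis.\<close>
  have "h f = h' f" if "finite S" "{b. f b \<noteq> \<zero>\<^bsub>R\<^esub>} \<subseteq> S" "f \<in> carrier (free_module R B)" for S f
    using that
  proof (induction S arbitrary: f)
    case empty
    then have "f = \<zero>\<^bsub>free_module R B\<^esub>" by auto
    then show ?case using mod_hom_zero[OF F.module_axioms assms(1)] assms(2,3) by metis
  next
    case (insert b S)
    define f' where "f' = f(b := \<zero>\<^bsub>R\<^esub>)"
    have "{c. f' c \<noteq> \<zero>\<^bsub>R\<^esub>} \<subseteq> {c. f c \<noteq> \<zero>\<^bsub>R\<^esub>}" by (auto simp: f'_def)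
    then have f': "f' \<in> carrier (free_module R B)"
      using insert.prems(2) unfolding free_module_carrier f'_def
      by (auto intro: finite_subset)
    have eq': "h f' = h' f'" using insert.prems(1) by (intro insert.IH f') (auto simp: f'_def)
    show ?case
    proof (cases "b \<in> B")
      case False
      \<comment> \<open>Outside \<open>B\<close> the coordinate of \<open>f\<close> is already
        zero.\<close>
      then have "f = f'" using insert.prems(2) by (auto simp: f'_def free_module_carrier fun_eq_iff)
      then show ?thesis using eq' by simp
    next
      case True
      have e: "basis_vec R b \<in> carrier (free_module R B)"
        using True by (intro basis_vec_carrier N.R.is_cring)
      have fb: "f c \<in> carrier R" for c using insert.prems(2) by (simp add: free_module_carrier)
      have dec: "f = f' \<oplus>\<^bsub>free_module R B\<^esub> f b \<odot>\<^bsub>free_module R B\<^esub> basis_vec R b"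
      proof
        fix c show "f c = (f' \<oplus>\<^bsub>free_module R B\<^esub> f b \<odot>\<^bsub>free_module R B\<^esub> basis_vec R b) c"
          using fb[of b] fb[of c] by (cases "c = b") (simp_all add: f'_def basis_vec_def)
      qed
      have dec_hom: "k f = k f' \<oplus>\<^bsub>N\<^esub> f b \<odot>\<^bsub>N\<^esub> k (basis_vec R b)" if "k \<in> mod_hom R (free_module R B) N" for k
        by (subst dec) (simp only: mod_homD(2)[OF that f' F.smult_closed[OF fb e]] mod_homD(3)[OF that fb e])
      show ?thesis unfolding dec_hom[OF assms(2)] dec_hom[OF assms(3)] eq' eq[OF True] ..
    qed
  qed
  then show ?thesis using f by (auto simp: free_module_carrier)
qed

text \<open>Preimages of the values at the basis vectors are chosen and extended linearly. This
  lifting is what makes \<open>Hom\<close> out of a free module exact.\<close>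

lemma free_module_projective:
  assumes "module R M" "module R N" "g \<in> mod_hom R M N" "g ` carrier M = carrier N"
    and "f \<in> mod_hom R (free_module R B) N"
  obtains h where "h \<in> mod_hom R (free_module R B) M"
    "\<And>x. x \<in> carrier (free_module R B) \<Longrightarrow> g (h x) = f x"
proof -
  interpret M: module R M by fact
  define s where "s b = (SOME y. y \<in> carrier M \<and> g y = f (basis_vec R b))" for b
  have "f (basis_vec R b) \<in> g ` carrier M" if "b \<in> B" for b
    unfolding assms(4) using that by (intro mod_homD(1)[OF assms(5)] basis_vec_carrier M.R.is_cring)
  then have "\<exists>y. y \<in> carrier M \<and> g y = f (basis_vec R b)" if "b \<in> B" for b
    using that unfolding image_iff by metis
  then have s: "s b \<in> carrier M \<and> g (s b) = f (basis_vec R b)" if "b \<in> B" for b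
    unfolding s_def by (rule someI_ex) (rule that)
  then have s': "s \<in> B \<rightarrow> carrier M" by blast
  have h: "lin_ext R M s \<in> mod_hom R (free_module R B) M" by (rule lin_ext_hom[OF assms(1) s'])
  have "g (lin_ext R M s x) = f x" if "x \<in> carrier (free_module R B)" for x
  proof (rule free_module_hom_eqI[OF assms(2) mod_hom_comp[OF h assms(3)] assms(5) _ that])
    show "g (lin_ext R M s (basis_vec R b)) = f (basis_vec R b)" if "b \<in> B" for b
      using s[OF that] by (simp add: lin_ext_basis_vec[OF assms(1)])
  qed
  then show thesis using h that by blast
qed

section \<open>Module structure on Hom and on finite powers\<close>

lemma module_Hom:
  assumes "module R M" "module R N"
  shows "module R (Hom R M N)"
proof -
  interpret M: module R M by fact
  interpret N: module R N by fact
  have cl: "f x \<in> carrier N" if "f \<in> carrier (Hom R M N)" "x \<in> carrier M" for f x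
    using that by (auto simp: Hom_def mod_hom_def)
  have restr: "(\<lambda>x\<in>carrier M. f x) \<in> carrier (Hom R M N)" if "f \<in> mod_hom R M N" for f
    using that by (auto simp: Hom_def mod_hom_def)
  have ext: "f \<in> extensional (carrier M)" "f \<in> mod_hom R M N" if "f \<in> carrier (Hom R M N)" for f
    using that by (auto simp: Hom_def)
  have z: "(\<lambda>x. \<zero>\<^bsub>N\<^esub>) \<in> mod_hom R M N" by (auto simp: mod_hom_def)
  have sm: "(\<lambda>x. r \<odot>\<^bsub>N\<^esub> f x) \<in> mod_hom R M N" if "f \<in> mod_hom R M N" "r \<in> carrier R" for f r
    using that by (auto simp: mod_hom_def Pi_iff N.smult_r_distr N.smult_assoc1[symmetric] M.R.m_comm)
  have ops: "\<zero>\<^bsub>Hom R M N\<^esub> = (\<lambda>x\<in>carrier M. \<zero>\<^bsub>N\<^esub>)"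
    "f \<oplus>\<^bsub>Hom R M N\<^esub> g = (\<lambda>x\<in>carrier M. f x \<oplus>\<^bsub>N\<^esub> g x)"
    "r \<odot>\<^bsub>Hom R M N\<^esub> f = (\<lambda>x\<in>carrier M. r \<odot>\<^bsub>N\<^esub> f x)" for f g r
    by (simp_all add: Hom_def)
  have "abelian_group (Hom R M N)"
  proof (rule abelian_groupI)
    show "\<exists>y\<in>carrier (Hom R M N). y \<oplus>\<^bsub>Hom R M N\<^esub> f = \<zero>\<^bsub>Hom R M N\<^esub>" if f: "f \<in> carrier (Hom R M N)" for f
    \<comment> \<open>The negative of \<open>f\<close> is written as a difference, so that
      \<open>mod_hom_sub\<close> supplies its linearity.\<close>
    proof (rule bexI)
      show "(\<lambda>x\<in>carrier M. \<zero>\<^bsub>N\<^esub> \<ominus>\<^bsub>N\<^esub> f x) \<in> carrier (Hom R M N)"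
        by (intro restr mod_hom_sub assms z ext f)
      show "(\<lambda>x\<in>carrier M. \<zero>\<^bsub>N\<^esub> \<ominus>\<^bsub>N\<^esub> f x) \<oplus>\<^bsub>Hom R M N\<^esub> f = \<zero>\<^bsub>Hom R M N\<^esub>"
        unfolding ops using cl[OF f] by (intro restrict_ext) (simp add: a_minus_def N.M.l_neg)
    qed
    show "\<zero>\<^bsub>Hom R M N\<^esub> \<in> carrier (Hom R M N)" unfolding ops by (intro restr z)
    show "f \<oplus>\<^bsub>Hom R M N\<^esub> g \<in> carrier (Hom R M N)"
      if "f \<in> carrier (Hom R M N)" "g \<in> carrier (Hom R M N)" for f g
      unfolding ops using that by (intro restr mod_hom_add assms ext)
    show "f \<oplus>\<^bsub>Hom R M N\<^esub> g \<oplus>\<^bsub>Hom R M N\<^esub> h = f \<oplus>\<^bsub>Hom R M N\<^esub> (g \<oplus>\<^bsub>Hom R M N\<^esub> h)"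
      if "f \<in> carrier (Hom R M N)" "g \<in> carrier (Hom R M N)" "h \<in> carrier (Hom R M N)" for f g h
      unfolding ops using that by (intro restrict_ext) (simp add: cl N.M.a_assoc)
    show "f \<oplus>\<^bsub>Hom R M N\<^esub> g = g \<oplus>\<^bsub>Hom R M N\<^esub> f"
      if "f \<in> carrier (Hom R M N)" "g \<in> carrier (Hom R M N)" for f g
      unfolding ops using that by (intro restrict_ext) (simp add: cl N.M.a_comm)
    show "\<zero>\<^bsub>Hom R M N\<^esub> \<oplus>\<^bsub>Hom R M N\<^esub> f = f" if "f \<in> carrier (Hom R M N)" for f
      unfolding ops using cl[OF that] by (intro extensionalityI[OF _ ext(1)[OF that]]) auto
  qed
  then show ?thesis
  proof (intro moduleI M.R.is_cring)
    show "r \<odot>\<^bsub>Hom R M N\<^esub> f \<in> carrier (Hom R M N)" if "r \<in> carrier R" "f \<in> carrier (Hom R M N)" for r f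
      unfolding ops using that by (intro restr sm ext)
    show "\<one>\<^bsub>R\<^esub> \<odot>\<^bsub>Hom R M N\<^esub> f = f" if "f \<in> carrier (Hom R M N)" for f
      unfolding ops using cl[OF that] by (intro extensionalityI[OF _ ext(1)[OF that]]) auto
  qed (auto simp: ops cl N.smult_l_distr N.smult_r_distr N.smult_assoc1 intro!: restrict_ext)
qed

lemma module_direct_power:
  assumes "module R N"
  shows "module R (direct_power N k)"
proof -
  interpret N: module R N by fact
  let ?D = "direct_power N k"
  have cl: "f j \<in> carrier N" if "f \<in> carrier ?D" "j < k" for f j
    using that by (auto simp: direct_power_def)
  have ops: "carrier ?D = {..<k} \<rightarrow>\<^sub>E carrier N" "\<zero>\<^bsub>?D\<^esub> = (\<lambda>j\<in>{..<k}. \<zero>\<^bsub>N\<^esub>)"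
    "f \<oplus>\<^bsub>?D\<^esub> g = (\<lambda>j\<in>{..<k}. f j \<oplus>\<^bsub>N\<^esub> g j)"
    "r \<odot>\<^bsub>?D\<^esub> f = (\<lambda>j\<in>{..<k}. r \<odot>\<^bsub>N\<^esub> f j)" for f g r
    by (simp_all add: direct_power_def)
  have eta: "(\<lambda>j\<in>{..<k}. f' j) = f"
    if "f \<in> carrier ?D" "\<And>j. j < k \<Longrightarrow> f' j = f j" for f f'
    using that by (intro extensionalityI[where A = "{..<k}"]) (auto simp: ops PiE_def)
  have "abelian_group ?D"
  proof (rule abelian_groupI)
    show "\<exists>y\<in>carrier ?D. y \<oplus>\<^bsub>?D\<^esub> f = \<zero>\<^bsub>?D\<^esub>" if f: "f \<in> carrier ?D" for f
    proof (rule bexI)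
      show "(\<lambda>j\<in>{..<k}. \<ominus>\<^bsub>N\<^esub> f j) \<in> carrier ?D" using cl[OF f] by (auto simp: ops)
      show "(\<lambda>j\<in>{..<k}. \<ominus>\<^bsub>N\<^esub> f j) \<oplus>\<^bsub>?D\<^esub> f = \<zero>\<^bsub>?D\<^esub>"
        unfolding ops using cl[OF f] by (intro restrict_ext) (simp add: N.M.l_neg)
    qed
    show "\<zero>\<^bsub>?D\<^esub> \<oplus>\<^bsub>?D\<^esub> f = f" if "f \<in> carrier ?D" for f
      unfolding ops(2,3) using cl[OF that] by (intro eta[OF that]) auto
    show "\<zero>\<^bsub>?D\<^esub> \<in> carrier ?D" unfolding ops by auto
    fix f g h assume f: "f \<in> carrier ?D" and g: "g \<in> carrier ?D" and h: "h \<in> carrier ?D"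
    show "f \<oplus>\<^bsub>?D\<^esub> g \<in> carrier ?D" using cl[OF f] cl[OF g] unfolding ops by auto
    show "f \<oplus>\<^bsub>?D\<^esub> g \<oplus>\<^bsub>?D\<^esub> h = f \<oplus>\<^bsub>?D\<^esub> (g \<oplus>\<^bsub>?D\<^esub> h)"
      unfolding ops using cl[OF f] cl[OF g] cl[OF h] by (intro restrict_ext) (simp add: N.M.a_assoc)
    show "f \<oplus>\<^bsub>?D\<^esub> g = g \<oplus>\<^bsub>?D\<^esub> f"
      unfolding ops using cl[OF f] cl[OF g] by (intro restrict_ext) (simp add: N.M.a_comm)
  qed
  then show ?thesis
  proof (intro moduleI N.R.is_cring)
    show "r \<odot>\<^bsub>?D\<^esub> f \<in> carrier ?D" if "r \<in> carrier R" "f \<in> carrier ?D" for r f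
      using that cl[OF that(2)] unfolding ops by auto
    show "\<one>\<^bsub>R\<^esub> \<odot>\<^bsub>?D\<^esub> f = f" if "f \<in> carrier ?D" for f
      unfolding ops(4) using cl[OF that] by (intro eta[OF that]) auto
  qed (auto simp: ops(2-4) cl N.smult_l_distr N.smult_r_distr N.smult_assoc1 intro!: restrict_ext)
qed

section \<open>Vanishing of Ext along a free complex\<close>

text \<open>This says that the cohomology of \<open>Hom(P, Y)\<close> is zero in degree
  \<open>n\<close>, spelled out on maps: no quotient is formed, degrees are integers, and maps may
  take any values off the carrier. \<open>zero_Ext_iff\<close> ties it to
  \<open>Ext\<close>.\<close>

definition Ext_vanishes :: "('r, 'e) ring_scheme \<Rightarrow> (int \<Rightarrow> ('r, 'x) module) \<Rightarrow> (int \<Rightarrow> 'x \<Rightarrow> 'x) \<Rightarrow>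
    int \<Rightarrow> ('r, 'n) module \<Rightarrow> bool" where
  "Ext_vanishes R P d n Y \<longleftrightarrow>
    (\<forall>f\<in>mod_hom R (P n) Y. (\<forall>x\<in>carrier (P (n + 1)). f (d (n + 1) x) = \<zero>\<^bsub>Y\<^esub>) \<longrightarrow>
       (\<exists>g\<in>mod_hom R (P (n - 1)) Y. \<forall>x\<in>carrier (P n). f x = g (d n x)))"

lemma Ext_vanishesI:
  assumes "\<And>f. f \<in> mod_hom R (P n) Y \<Longrightarrow> (\<And>x. x \<in> carrier (P (n + 1)) \<Longrightarrow> f (d (n + 1) x) = \<zero>\<^bsub>Y\<^esub>) \<Longrightarrow>
     \<exists>g\<in>mod_hom R (P (n - 1)) Y. \<forall>x\<in>carrier (P n). f x = g (d n x)"
  shows "Ext_vanishes R P d n Y"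
  using assms by (simp add: Ext_vanishes_def)

lemma Ext_vanishesE:
  assumes "Ext_vanishes R P d n Y" "f \<in> mod_hom R (P n) Y"
    "\<And>x. x \<in> carrier (P (n + 1)) \<Longrightarrow> f (d (n + 1) x) = \<zero>\<^bsub>Y\<^esub>"
  obtains g where "g \<in> mod_hom R (P (n - 1)) Y" "\<And>x. x \<in> carrier (P n) \<Longrightarrow> f x = g (d n x)"
  using assms unfolding Ext_vanishes_def by blast

text \<open>A cocycle into the retract \<open>A\<close> is pushed to \<open>B\<close> by
  \<open>s\<close>, bounded there, and the bounding map is brought back by \<open>r\<close>.\<close>

lemma Ext_vanishes_retract:
  assumes "Ext_vanishes R P d n B" "module R A" "module R B"
    and "s \<in> mod_hom R A B" "r \<in> mod_hom R B A" "\<And>x. x \<in> carrier A \<Longrightarrow> r (s x) = x"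
  shows "Ext_vanishes R P d n A"
proof (rule Ext_vanishesI)
  fix f assume f: "f \<in> mod_hom R (P n) A"
    and c: "\<And>x. x \<in> carrier (P (n + 1)) \<Longrightarrow> f (d (n + 1) x) = \<zero>\<^bsub>A\<^esub>"
  have c': "s (f (d (n + 1) x)) = \<zero>\<^bsub>B\<^esub>" if "x \<in> carrier (P (n + 1))" for x
    using c[OF that] mod_hom_zero[OF assms(2,3,4)] by simp
  obtain g where g: "g \<in> mod_hom R (P (n - 1)) B" "\<And>x. x \<in> carrier (P n) \<Longrightarrow> s (f x) = g (d n x)"
    by (rule Ext_vanishesE[OF assms(1) mod_hom_comp[OF f assms(4)]], rule c', assumption, rule that)
  have "\<forall>x\<in>carrier (P n). f x = r (g (d n x))"
    using g(2) assms(6) mod_homD(1)[OF f] by metis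
  then show "\<exists>g\<in>mod_hom R (P (n - 1)) A. \<forall>x\<in>carrier (P n). f x = g (d n x)"
    using mod_hom_comp[OF g(1) assms(5)] by (intro bexI[where x = "\<lambda>x. r (g x)"])
qed

text \<open>A map into a power is a family of coordinates, and each coordinate of a cocycle is
  bounded separately; \<open>k = 0\<close> is included.\<close>

lemma Ext_vanishes_direct_power:
  assumes "Ext_vanishes R P d n N"
  shows "Ext_vanishes R P d n (direct_power N k)"
proof (rule Ext_vanishesI)
  fix f assume f: "f \<in> mod_hom R (P n) (direct_power N k)"
    and c: "\<And>x. x \<in> carrier (P (n + 1)) \<Longrightarrow> f (d (n + 1) x) = \<zero>\<^bsub>direct_power N k\<^esub>"
  have "\<exists>g\<in>mod_hom R (P (n - 1)) N. \<forall>x\<in>carrier (P n). f x j = g (d n x)" if j: "j < k" for j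
  proof -
    have h: "(\<lambda>x. f x j) \<in> mod_hom R (P n) N"
      using f j by (auto simp: mod_hom_def direct_power_def Pi_iff PiE_iff)
    have c': "f (d (n + 1) x) j = \<zero>\<^bsub>N\<^esub>" if "x \<in> carrier (P (n + 1))" for x
      using c[OF that] j by (simp add: direct_power_def)
    show ?thesis by (rule Ext_vanishesE[OF assms h], rule c', assumption, rule bexI) auto
  qed
  then have "\<forall>j\<in>{..<k}. \<exists>g. g \<in> mod_hom R (P (n - 1)) N \<and> (\<forall>x\<in>carrier (P n). f x j = g (d n x))"
    by blast
  from bchoice[OF this] obtain g where g: "\<And>j. j < k \<Longrightarrow> g j \<in> mod_hom R (P (n - 1)) N"
    "\<And>j x. j < k \<Longrightarrow> x \<in> carrier (P n) \<Longrightarrow> f x j = g j (d n x)" by blast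
  have "(\<lambda>y. \<lambda>j\<in>{..<k}. g j y) \<in> mod_hom R (P (n - 1)) (direct_power N k)"
    using g(1) by (auto simp: mod_hom_def direct_power_def Pi_iff fun_eq_iff)
  moreover have "f x = (\<lambda>j\<in>{..<k}. g j (d n x))" if "x \<in> carrier (P n)" for x
    using mod_homD(1)[OF f that] g(2)[OF _ that]
    by (intro extensionalityI[where A = "{..<k}"]) (auto simp: direct_power_def PiE_def)
  ultimately show "\<exists>g\<in>mod_hom R (P (n - 1)) (direct_power N k). \<forall>x\<in>carrier (P n). f x = g (d n x)"
    by (intro bexI[where x = "\<lambda>y. \<lambda>j\<in>{..<k}. g j y"]) auto
qed

lemma Ext_vanishes_direct_power_iff:
  assumes "module R N" "0 < k"
  shows "Ext_vanishes R P d n (direct_power N k) \<longleftrightarrow> Ext_vanishes R P d n N"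
proof
  assume *: "Ext_vanishes R P d n (direct_power N k)"
  show "Ext_vanishes R P d n N"
  proof (rule Ext_vanishes_retract[OF * assms(1) module_direct_power[OF assms(1)]])
    \<comment> \<open>\<open>N\<close> is a retract of its power: the diagonal map is split by
      coordinate 0, which exists since \<open>0 < k\<close>.\<close>
    show "(\<lambda>y. \<lambda>j\<in>{..<k}. y) \<in> mod_hom R N (direct_power N k)"
      by (auto simp: mod_hom_def direct_power_def fun_eq_iff)
    show "(\<lambda>f. f 0) \<in> mod_hom R (direct_power N k) N"
      using assms(2) by (auto simp: mod_hom_def direct_power_def)
  qed (use assms(2) in auto)
qed (rule Ext_vanishes_direct_power)

section \<open>Free complexes and the long exact sequence of Ext\<close>

locale free_complex =
  fixes R :: "('r, 'e) ring_scheme" and P :: "int \<Rightarrow> ('r, 'b \<Rightarrow> 'r) module"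
    and d :: "int \<Rightarrow> ('b \<Rightarrow> 'r) \<Rightarrow> 'b \<Rightarrow> 'r" and S :: "int \<Rightarrow> 'b set"
  assumes complex: "chain_complex R P d" and free: "P n = free_module R (S n)"
begin

lemma diff_closed [simp]: "x \<in> carrier (P n) \<Longrightarrow> d n x \<in> carrier (P (n - 1))"
  and diff_hom: "d n \<in> mod_hom R (P n) (P (n - 1))"
  and module_P: "module R (P n)"
  using complex unfolding chain_complex_def mod_hom_def by auto

lemma diff_hom_Suc: "d (n + 1) \<in> mod_hom R (P (n + 1)) (P n)"
  using diff_hom[of "n + 1"] by simp

lemma diff_closed_Suc [simp]: "x \<in> carrier (P (n + 1)) \<Longrightarrow> d (n + 1) x \<in> carrier (P n)"
  using diff_closed[of x "n + 1"] by simp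

lemma diff_diff: "x \<in> carrier (P (n + 1)) \<Longrightarrow> d n (d (n + 1) x) = \<zero>\<^bsub>P (n - 1)\<^esub>"
  using complex[unfolded chain_complex_def, rule_format, of "n + 1"] by auto

lemma projective:
  assumes "module R M" "module R N" "g \<in> mod_hom R M N" "g ` carrier M = carrier N"
    and "f \<in> mod_hom R (P n) N"
  obtains h where "h \<in> mod_hom R (P n) M" "\<And>x. x \<in> carrier (P n) \<Longrightarrow> g (h x) = f x"
  using free_module_projective[OF assms(1-4) assms(5)[unfolded free]] unfolding free by blast

text \<open>The data describe a short exact sequence 0 -> A -> M -> N -> 0, with \<open>A\<close>
  the kernel of \<open>g\<close> as a set. Since each \<open>P n\<close> is free, it induces a long
  exact sequence of Ext, of which the lemmas below are three segments.\<close>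

context
  fixes A :: "'m set" and M :: "('r, 'm) module" and N :: "('r, 'n) module" and g :: "'m \<Rightarrow> 'n"
  assumes M: "module R M" and N: "module R N" and g: "g \<in> mod_hom R M N"
    and surj: "g ` carrier M = carrier N" and A: "A = {x \<in> carrier M. g x = \<zero>\<^bsub>N\<^esub>}"
begin

interpretation M: module R M by (rule M)
interpretation N: module R N by (rule N)

lemma hom_kernel:
  "f \<in> mod_hom R L (M\<lparr>carrier := A\<rparr>) \<longleftrightarrow> f \<in> mod_hom R L M \<and> (\<forall>x\<in>carrier L. g (f x) = \<zero>\<^bsub>N\<^esub>)"
  unfolding A by (subst mod_hom_restrict_codomain) (auto simp: mod_hom_def)

text \<open>Exactness at Ext of \<open>M\<close>: once the image in \<open>N\<close> is bounded by
  \<open>u\<close>, a lift \<open>u'\<close> of \<open>u\<close> composed with \<open>d\<close> is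
  subtracted from the cocycle, which leaves a cocycle with values in \<open>A\<close>.\<close>

lemma Ext_vanishes_middle:
  assumes "Ext_vanishes R P d n (M\<lparr>carrier := A\<rparr>)" "Ext_vanishes R P d n N"
  shows "Ext_vanishes R P d n M"
proof (rule Ext_vanishesI)
  fix f assume f: "f \<in> mod_hom R (P n) M"
    and c: "\<And>x. x \<in> carrier (P (n + 1)) \<Longrightarrow> f (d (n + 1) x) = \<zero>\<^bsub>M\<^esub>"
  have c': "g (f (d (n + 1) x)) = \<zero>\<^bsub>N\<^esub>" if "x \<in> carrier (P (n + 1))" for x
    using c[OF that] mod_hom_zero[OF M N g] by simp
  obtain u where u: "u \<in> mod_hom R (P (n - 1)) N" "\<And>x. x \<in> carrier (P n) \<Longrightarrow> g (f x) = u (d n x)"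
    by (rule Ext_vanishesE[OF assms(2) mod_hom_comp[OF f g]], rule c', assumption, rule that)
  obtain u' where u': "u' \<in> mod_hom R (P (n - 1)) M" "\<And>x. x \<in> carrier (P (n - 1)) \<Longrightarrow> g (u' x) = u x"
    using projective[OF M N g surj u(1)] by blast
  have ud: "(\<lambda>x. u' (d n x)) \<in> mod_hom R (P n) M" by (rule mod_hom_comp[OF diff_hom u'(1)])
  have fu: "(\<lambda>x. f x \<ominus>\<^bsub>M\<^esub> u' (d n x)) \<in> mod_hom R (P n) (M\<lparr>carrier := A\<rparr>)"
    unfolding hom_kernel
  proof (intro conjI ballI mod_hom_sub M f ud)
    fix x assume x: "x \<in> carrier (P n)"
    show "g (f x \<ominus>\<^bsub>M\<^esub> u' (d n x)) = \<zero>\<^bsub>N\<^esub>"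
      using x u(2) u'(2) mod_homD(1)[OF u(1)]
      by (simp add: mod_hom_diff[OF M N g] mod_homD(1)[OF f] mod_homD(1)[OF u'(1)] N.M.minus_self)
  qed
  have fu_cocycle: "f (d (n + 1) x) \<ominus>\<^bsub>M\<^esub> u' (d n (d (n + 1) x)) = \<zero>\<^bsub>M\<lparr>carrier := A\<rparr>\<^esub>"
    if "x \<in> carrier (P (n + 1))" for x
    using c[OF that] that mod_hom_zero[OF module_P M u'(1)] by (simp add: diff_diff M.M.minus_self)
  obtain v where v: "v \<in> mod_hom R (P (n - 1)) (M\<lparr>carrier := A\<rparr>)"
    "\<And>x. x \<in> carrier (P n) \<Longrightarrow> f x \<ominus>\<^bsub>M\<^esub> u' (d n x) = v (d n x)"
    by (rule Ext_vanishesE[OF assms(1) fu], rule fu_cocycle, assumption, rule that)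
  have v': "v \<in> mod_hom R (P (n - 1)) M" using v(1) unfolding hom_kernel by simp
  have "f x = v (d n x) \<oplus>\<^bsub>M\<^esub> u' (d n x)" if x: "x \<in> carrier (P n)" for x
    using v(2)[OF x, symmetric] mod_homD(1)[OF f x] mod_homD(1)[OF ud x]
    by (simp add: a_minus_def M.M.a_assoc M.M.l_neg)
  then show "\<exists>g\<in>mod_hom R (P (n - 1)) M. \<forall>x\<in>carrier (P n). f x = g (d n x)"
    using mod_hom_add[OF M v' u'(1)] by (intro bexI[where x = "\<lambda>x. v x \<oplus>\<^bsub>M\<^esub> u' x"]) auto
qed

text \<open>The connecting map is at work here. A lift \<open>f'\<close> of the cocycle need not be
  a cocycle, but \<open>f'\<close> composed with \<open>d\<close> takes values in \<open>A\<close>.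
  Bounding it there by \<open>u\<close> makes the difference of \<open>f'\<close> and
  \<open>u\<close> a cocycle in \<open>M\<close> that still lifts \<open>f\<close>.\<close>

lemma Ext_vanishes_quotient:
  assumes "Ext_vanishes R P d n M" "Ext_vanishes R P d (n + 1) (M\<lparr>carrier := A\<rparr>)"
  shows "Ext_vanishes R P d n N"
proof (rule Ext_vanishesI)
  fix f assume f: "f \<in> mod_hom R (P n) N"
    and c: "\<And>x. x \<in> carrier (P (n + 1)) \<Longrightarrow> f (d (n + 1) x) = \<zero>\<^bsub>N\<^esub>"
  obtain f' where f': "f' \<in> mod_hom R (P n) M" "\<And>x. x \<in> carrier (P n) \<Longrightarrow> g (f' x) = f x"
    using projective[OF M N g surj f] by blast
  have fd: "(\<lambda>x. f' (d (n + 1) x)) \<in> mod_hom R (P (n + 1)) (M\<lparr>carrier := A\<rparr>)"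
    unfolding hom_kernel using mod_hom_comp[OF diff_hom_Suc f'(1)] c f'(2) by simp
  have fd_cocycle: "f' (d (n + 1) (d (n + 1 + 1) x)) = \<zero>\<^bsub>M\<lparr>carrier := A\<rparr>\<^esub>"
    if "x \<in> carrier (P (n + 1 + 1))" for x
    using diff_diff[OF that] mod_hom_zero[OF module_P M f'(1)] by simp
  obtain u where u: "u \<in> mod_hom R (P (n + 1 - 1)) (M\<lparr>carrier := A\<rparr>)"
    "\<And>x. x \<in> carrier (P (n + 1)) \<Longrightarrow> f' (d (n + 1) x) = u (d (n + 1) x)"
    by (rule Ext_vanishesE[OF assms(2) fd], rule fd_cocycle, assumption, rule that)
  have u': "u \<in> mod_hom R (P n) M" "\<And>x. x \<in> carrier (P n) \<Longrightarrow> g (u x) = \<zero>\<^bsub>N\<^esub>"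
    using u(1) unfolding hom_kernel by simp_all
  have c': "f' (d (n + 1) x) \<ominus>\<^bsub>M\<^esub> u (d (n + 1) x) = \<zero>\<^bsub>M\<^esub>" if "x \<in> carrier (P (n + 1))" for x
    using u(2)[OF that] mod_homD(1)[OF u'(1)] that by (simp add: M.M.minus_self)
  obtain v where v: "v \<in> mod_hom R (P (n - 1)) M"
    "\<And>x. x \<in> carrier (P n) \<Longrightarrow> f' x \<ominus>\<^bsub>M\<^esub> u x = v (d n x)"
    by (rule Ext_vanishesE[OF assms(1) mod_hom_sub[OF M f'(1) u'(1)]], rule c', assumption, rule that)
  have "f x = g (v (d n x))" if x: "x \<in> carrier (P n)" for x
  proof -
    have "g (v (d n x)) = g (f' x) \<ominus>\<^bsub>N\<^esub> g (u x)"
      unfolding v(2)[OF x, symmetric]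
      by (rule mod_hom_diff[OF M N g mod_homD(1)[OF f'(1) x] mod_homD(1)[OF u'(1) x]])
    then show ?thesis
      using f'(2)[OF x] u'(2)[OF x] mod_homD(1)[OF f x] by (simp add: a_minus_def)
  qed
  then show "\<exists>g\<in>mod_hom R (P (n - 1)) N. \<forall>x\<in>carrier (P n). f x = g (d n x)"
    using mod_hom_comp[OF v(1) g] by (intro bexI[where x = "\<lambda>x. g (v x)"]) auto
qed

text \<open>The map \<open>u\<close> bounding the cocycle in \<open>M\<close> may leave
  \<open>A\<close>, but \<open>g\<close> composed with \<open>u\<close> is a cocycle in
  \<open>N\<close>. Lifting its bounding map \<open>v\<close> to \<open>w\<close> and subtracting
  moves \<open>u\<close> into \<open>A\<close>; the cocycle does not see the correction since
  \<open>d\<close> squares to zero.\<close>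

lemma Ext_vanishes_kernel:
  assumes "Ext_vanishes R P d n N" "Ext_vanishes R P d (n + 1) M"
  shows "Ext_vanishes R P d (n + 1) (M\<lparr>carrier := A\<rparr>)"
proof (rule Ext_vanishesI)
  fix f assume f: "f \<in> mod_hom R (P (n + 1)) (M\<lparr>carrier := A\<rparr>)"
    and c: "\<And>x. x \<in> carrier (P (n + 1 + 1)) \<Longrightarrow> f (d (n + 1 + 1) x) = \<zero>\<^bsub>M\<lparr>carrier := A\<rparr>\<^esub>"
  have f': "f \<in> mod_hom R (P (n + 1)) M" "\<And>x. x \<in> carrier (P (n + 1)) \<Longrightarrow> g (f x) = \<zero>\<^bsub>N\<^esub>"
    using f unfolding hom_kernel by auto
  obtain u where u: "u \<in> mod_hom R (P (n + 1 - 1)) M"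
    "\<And>x. x \<in> carrier (P (n + 1)) \<Longrightarrow> f x = u (d (n + 1) x)"
    using Ext_vanishesE[OF assms(2) f'(1)] c by auto
  have u1: "u \<in> mod_hom R (P n) M" using u(1) by simp
  have c': "g (u (d (n + 1) x)) = \<zero>\<^bsub>N\<^esub>" if "x \<in> carrier (P (n + 1))" for x
    using f'(2)[OF that] u(2)[OF that] by simp
  obtain v where v: "v \<in> mod_hom R (P (n - 1)) N"
    "\<And>x. x \<in> carrier (P n) \<Longrightarrow> g (u x) = v (d n x)"
    by (rule Ext_vanishesE[OF assms(1) mod_hom_comp[OF u1 g]], rule c', assumption, rule that)
  obtain w where w: "w \<in> mod_hom R (P (n - 1)) M" "\<And>x. x \<in> carrier (P (n - 1)) \<Longrightarrow> g (w x) = v x"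
    using projective[OF M N g surj v(1)] by blast
  have wd: "(\<lambda>x. w (d n x)) \<in> mod_hom R (P n) M" by (rule mod_hom_comp[OF diff_hom w(1)])
  have "(\<lambda>x. u x \<ominus>\<^bsub>M\<^esub> w (d n x)) \<in> mod_hom R (P n) (M\<lparr>carrier := A\<rparr>)"
    unfolding hom_kernel
  proof (intro conjI ballI mod_hom_sub M u1 wd)
    fix x assume x: "x \<in> carrier (P n)"
    show "g (u x \<ominus>\<^bsub>M\<^esub> w (d n x)) = \<zero>\<^bsub>N\<^esub>"
      using x v(2) w(2) mod_homD(1)[OF v(1)]
      by (simp add: mod_hom_diff[OF M N g] mod_homD(1)[OF u1] mod_homD(1)[OF w(1)] N.M.minus_self)
  qed
  moreover have "f x = u (d (n + 1) x) \<ominus>\<^bsub>M\<^esub> w (d n (d (n + 1) x))" if x: "x \<in> carrier (P (n + 1))" for x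
    using u(2)[OF x] x mod_homD(1)[OF f'(1) x] mod_hom_zero[OF module_P M w(1)]
    by (simp add: diff_diff a_minus_def)
  ultimately show "\<exists>g\<in>mod_hom R (P (n + 1 - 1)) (M\<lparr>carrier := A\<rparr>). \<forall>x\<in>carrier (P (n + 1)). f x = g (d (n + 1) x)"
    by (intro bexI[where x = "\<lambda>x. u x \<ominus>\<^bsub>M\<^esub> w (d n x)"]) auto
qed

end

end

section \<open>Submodules and quotients\<close>

lemma (in module) submoduleI':
  assumes "H \<subseteq> carrier M" "\<zero>\<^bsub>M\<^esub> \<in> H"
    and "\<And>a b. a \<in> H \<Longrightarrow> b \<in> H \<Longrightarrow> a \<oplus>\<^bsub>M\<^esub> b \<in> H"
    and sm: "\<And>r a. r \<in> carrier R \<Longrightarrow> a \<in> H \<Longrightarrow> r \<odot>\<^bsub>M\<^esub> a \<in> H"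
  shows "submodule H R M"
proof (rule submoduleI)
  show "\<ominus>\<^bsub>M\<^esub> a \<in> H" if "a \<in> H" for a
  proof -
    have "\<ominus>\<^bsub>M\<^esub> a = (\<ominus>\<^bsub>R\<^esub> \<one>\<^bsub>R\<^esub>) \<odot>\<^bsub>M\<^esub> a"
      using that assms(1) by (subst smult_l_minus) (auto simp: subset_iff)
    then show ?thesis using sm[OF _ that] by simp
  qed
qed (use assms in auto)

lemma (in module) submodule_zero_closed: "submodule H R M \<Longrightarrow> \<zero>\<^bsub>M\<^esub> \<in> H"
  using submodule.axioms(1) subgroup.one_closed by fastforce

lemma submodule_vimage:
  assumes "module R M" "module R N" "f \<in> mod_hom R M N" "submodule H R N"
  shows "submodule {x \<in> carrier M. f x \<in> H} R M"
proof -
  interpret M: module R M by fact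
  interpret N: module R N by fact
  note f = mod_homD[OF assms(3)]
  show ?thesis
  proof (rule M.submoduleI')
    show "\<zero>\<^bsub>M\<^esub> \<in> {x \<in> carrier M. f x \<in> H}"
      using mod_hom_zero[OF assms(1-3)] N.submodule_zero_closed[OF assms(4)] by simp
  qed (use f N.submoduleE(4,5)[OF assms(4)] in auto)
qed

lemma mod_span_submodule:
  assumes "module R M" "S \<subseteq> carrier M"
  shows "submodule (mod_span R M S) R M"
proof -
  interpret module R M by fact
  have "mod_span R M S \<subseteq> carrier M"
    unfolding mod_span_def using carrier_is_submodule assms(2) by blast
  then show ?thesis
    by (rule submoduleI') (auto simp: mod_span_def submodule_zero_closed submoduleE(4,5))
qed

lemma mod_span_superset: "S \<subseteq> mod_span R M S"
  by (auto simp: mod_span_def)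

lemma mod_span_least: "submodule H R M \<Longrightarrow> S \<subseteq> H \<Longrightarrow> mod_span R M S \<subseteq> H"
  by (auto simp: mod_span_def)

lemma submodule_abelian_subgroup:
  assumes "module R M" "submodule K R M"
  shows "abelian_subgroup K M"
proof -
  interpret module R M by fact
  show ?thesis
    by (intro abelian_subgroupI3 additive_subgroup.intro submodule.axioms(1)[OF assms(2)]
        abelian_group_axioms)
qed

section \<open>Cosets and quotient modules\<close>

context
  fixes R :: "('r, 'e) ring_scheme" and M :: "('r, 'm) module" and K :: "'m set"
  assumes M: "module R M" and K: "submodule K R M"
begin

interpretation module R M by (rule M)
interpretation K: abelian_subgroup K M by (rule submodule_abelian_subgroup[OF M K])

lemma coset_eq_iff:
  assumes "x \<in> carrier M" "y \<in> carrier M"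
  shows "K +>\<^bsub>M\<^esub> x = K +>\<^bsub>M\<^esub> y \<longleftrightarrow> x \<ominus>\<^bsub>M\<^esub> y \<in> K"
proof -
  have "K +>\<^bsub>M\<^esub> x = K +>\<^bsub>M\<^esub> y \<longleftrightarrow> x \<in> K +>\<^bsub>M\<^esub> y"
    using K.a_repr_independence'[of x y] K.a_repr_independenceD[of x y] assms by auto
  then show ?thesis using K.a_rcos_module[of y x] assms by (simp add: a_minus_def)
qed

lemma coset_eq_self_iff:
  assumes "x \<in> carrier M"
  shows "K +>\<^bsub>M\<^esub> x = K \<longleftrightarrow> x \<in> K"
  using K.a_rcos_const[of x] K.a_rcos_self[OF assms] by auto

text \<open>Scalar multiplication on quotients and \<open>tensor_map\<close> are unions over all
  representatives of a coset. Such a union is a single value when all representatives give the same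
  one.\<close>

lemma UN_coset_eq:
  assumes "x \<in> carrier M" "\<And>t. t \<in> carrier M \<Longrightarrow> t \<ominus>\<^bsub>M\<^esub> x \<in> K \<Longrightarrow> f t = f x"
  shows "(\<Union>t\<in>K +>\<^bsub>M\<^esub> x. f t) = f x"
proof -
  have eq: "f t = f x" if t: "t \<in> K +>\<^bsub>M\<^esub> x" for t
  proof (rule assms(2))
    show "t \<in> carrier M" by (rule K.a_elemrcos_carrier[OF assms(1) t])
    show "t \<ominus>\<^bsub>M\<^esub> x \<in> K"
      unfolding a_minus_def by (rule K.a_rcos_module_imp[OF assms(1) t])
  qed
  show ?thesis
  proof (rule SUP_eq_const)
    show "K +>\<^bsub>M\<^esub> x \<noteq> {}" using K.a_rcos_self[OF assms(1)] by blast
  qed (rule eq)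
qed

lemma quot_module_carrier: "carrier (quot_module M K) = (\<lambda>x. K +>\<^bsub>M\<^esub> x) ` carrier M"
  by (auto simp: quot_module_def A_RCOSETS_def')

lemma quot_module_zero: "\<zero>\<^bsub>quot_module M K\<^esub> = K"
  by (simp add: quot_module_def)

lemma quot_module_proj: "(\<lambda>x. K +>\<^bsub>M\<^esub> x) \<in> mod_hom R M (quot_module M K)"
proof -
  have "(\<Union>y\<in>K +>\<^bsub>M\<^esub> x. K +>\<^bsub>M\<^esub> (r \<odot>\<^bsub>M\<^esub> y)) = K +>\<^bsub>M\<^esub> (r \<odot>\<^bsub>M\<^esub> x)"
    if r: "r \<in> carrier R" and x: "x \<in> carrier M" for r x
  proof (rule UN_coset_eq[OF x])
    fix t assume t: "t \<in> carrier M" "t \<ominus>\<^bsub>M\<^esub> x \<in> K"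
    have "r \<odot>\<^bsub>M\<^esub> t \<ominus>\<^bsub>M\<^esub> r \<odot>\<^bsub>M\<^esub> x = r \<odot>\<^bsub>M\<^esub> (t \<ominus>\<^bsub>M\<^esub> x)"
      using r x t(1) by (simp add: a_minus_def smult_r_distr smult_r_minus)
    then show "K +>\<^bsub>M\<^esub> (r \<odot>\<^bsub>M\<^esub> t) = K +>\<^bsub>M\<^esub> (r \<odot>\<^bsub>M\<^esub> x)"
      using r x t submoduleE(4)[OF K r t(2)] by (simp add: coset_eq_iff)
  qed
  then show ?thesis
    unfolding mod_hom_def quot_module_carrier
    by (auto simp: quot_module_def K.a_rcos_sum)
qed

lemma zero_module_quot: "zero_module (quot_module M K) \<longleftrightarrow> carrier M \<subseteq> K"
proof -
  have "zero_module (quot_module M K) \<longleftrightarrow> (\<forall>x\<in>carrier M. K +>\<^bsub>M\<^esub> x = K)"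
    unfolding zero_module_def quot_module_carrier quot_module_zero by auto
  then show ?thesis using coset_eq_self_iff by auto
qed

end

text \<open>One identity stands in for the module axioms: if every coset is \<open>K\<close>, then
  \<open>x\<close>, being \<open>0 + x\<close>, lies in the coset of \<open>x\<close>, which is
  \<open>K\<close>. This form applies to the homology of a tensored complex without a module
  structure on tensor products.\<close>

lemma zero_module_quotD:
  assumes "zero_module (quot_module M K)" "\<zero>\<^bsub>M\<^esub> \<in> K" "x \<in> carrier M" "\<zero>\<^bsub>M\<^esub> \<oplus>\<^bsub>M\<^esub> x = x"
  shows "x \<in> K"
proof -
  have "K +>\<^bsub>M\<^esub> x = K"
    using assms(1,3) by (auto simp: zero_module_def quot_module_def A_RCOSETS_def')
  then show ?thesis using assms(2,4) by (force simp: a_r_coset_def')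
qed

section \<open>Tensor products\<close>

text \<open>The disjunctive form lets the four kinds of relation be split and introduced by plain
  rules.\<close>

lemma tensor_rels_iff:
  fixes R M N defines "F \<equiv> free_module R (carrier M \<times> carrier N)"
  shows "t \<in> tensor_rels R M N \<longleftrightarrow>
    (\<exists>x x' y. t = basis_vec R (x \<oplus>\<^bsub>M\<^esub> x', y) \<ominus>\<^bsub>F\<^esub> (basis_vec R (x, y) \<oplus>\<^bsub>F\<^esub> basis_vec R (x', y)) \<and>
       x \<in> carrier M \<and> x' \<in> carrier M \<and> y \<in> carrier N) \<or>
    (\<exists>x y y'. t = basis_vec R (x, y \<oplus>\<^bsub>N\<^esub> y') \<ominus>\<^bsub>F\<^esub> (basis_vec R (x, y) \<oplus>\<^bsub>F\<^esub> basis_vec R (x, y')) \<and>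
       x \<in> carrier M \<and> y \<in> carrier N \<and> y' \<in> carrier N) \<or>
    (\<exists>r x y. t = basis_vec R (r \<odot>\<^bsub>M\<^esub> x, y) \<ominus>\<^bsub>F\<^esub> r \<odot>\<^bsub>F\<^esub> basis_vec R (x, y) \<and>
       r \<in> carrier R \<and> x \<in> carrier M \<and> y \<in> carrier N) \<or>
    (\<exists>r x y. t = basis_vec R (x, r \<odot>\<^bsub>N\<^esub> y) \<ominus>\<^bsub>F\<^esub> r \<odot>\<^bsub>F\<^esub> basis_vec R (x, y) \<and>
       r \<in> carrier R \<and> x \<in> carrier M \<and> y \<in> carrier N)"
  unfolding tensor_rels_def F_def Let_def by blast

context
  fixes R :: "('r, 'e) ring_scheme" and M :: "('r, 'm) module" and N :: "('r, 'n) module"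
    and F :: "('r, 'm \<times> 'n \<Rightarrow> 'r) module"
  assumes M: "module R M" and N: "module R N"
  defines "F \<equiv> free_module R (carrier M \<times> carrier N)"
begin

interpretation M: module R M by (rule M)
interpretation N: module R N by (rule N)
interpretation F: module R F unfolding F_def by (rule module_free_module) (rule M.R.is_cring)

lemma basis_vec_tensor: "x \<in> carrier M \<Longrightarrow> y \<in> carrier N \<Longrightarrow> basis_vec R (x, y) \<in> carrier F"
  unfolding F_def by (intro basis_vec_carrier M.R.is_cring) auto

lemma tensor_rels_subset: "tensor_rels R M N \<subseteq> carrier F"
  unfolding subset_iff tensor_rels_iff F_def[symmetric]
  by (auto intro!: F.M.minus_closed F.M.a_closed F.smult_closed basis_vec_tensor)

lemma tensor_ker_submodule: "submodule (tensor_ker R M N) R F"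
  unfolding tensor_ker_def F_def[symmetric] by (rule mod_span_submodule[OF F.module_axioms tensor_rels_subset])

text \<open>The preimage of \<open>H\<close> is a submodule, so it contains the span of the
  relations once it contains the relations. \<open>H\<close> is general for two uses: zero, for maps
  that factor through the tensor product, and another \<open>tensor_ker\<close>, for
  functoriality.\<close>

lemma tensor_ker_hom:
  assumes L: "module R L" and h: "h \<in> mod_hom R F L" and H: "submodule H R L"
    and b: "\<And>x y. x \<in> carrier M \<Longrightarrow> y \<in> carrier N \<Longrightarrow> h (basis_vec R (x, y)) = b x y"
    and "\<And>x x' y. x \<in> carrier M \<Longrightarrow> x' \<in> carrier M \<Longrightarrow> y \<in> carrier N \<Longrightarrow>
      b (x \<oplus>\<^bsub>M\<^esub> x') y \<ominus>\<^bsub>L\<^esub> (b x y \<oplus>\<^bsub>L\<^esub> b x' y) \<in> H"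
    and "\<And>x y y'. x \<in> carrier M \<Longrightarrow> y \<in> carrier N \<Longrightarrow> y' \<in> carrier N \<Longrightarrow>
      b x (y \<oplus>\<^bsub>N\<^esub> y') \<ominus>\<^bsub>L\<^esub> (b x y \<oplus>\<^bsub>L\<^esub> b x y') \<in> H"
    and "\<And>r x y. r \<in> carrier R \<Longrightarrow> x \<in> carrier M \<Longrightarrow> y \<in> carrier N \<Longrightarrow>
      b (r \<odot>\<^bsub>M\<^esub> x) y \<ominus>\<^bsub>L\<^esub> r \<odot>\<^bsub>L\<^esub> b x y \<in> H"
    and "\<And>r x y. r \<in> carrier R \<Longrightarrow> x \<in> carrier M \<Longrightarrow> y \<in> carrier N \<Longrightarrow>
      b x (r \<odot>\<^bsub>N\<^esub> y) \<ominus>\<^bsub>L\<^esub> r \<odot>\<^bsub>L\<^esub> b x y \<in> H"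
    and "t \<in> tensor_ker R M N"
  shows "h t \<in> H"
proof -
  note hD = mod_hom_diff[OF F.module_axioms L h] mod_homD(2,3)[OF h] b
  have "tensor_rels R M N \<subseteq> {t \<in> carrier F. h t \<in> H}"
  proof
    fix t assume t: "t \<in> tensor_rels R M N"
    then have "h t \<in> H"
      unfolding tensor_rels_iff F_def[symmetric]
      by (elim disjE exE conjE)
        (simp_all only: hD basis_vec_tensor F.M.a_closed F.smult_closed M.M.a_closed N.M.a_closed
          M.smult_closed N.smult_closed assms(5-8))
    then show "t \<in> {t \<in> carrier F. h t \<in> H}" using t tensor_rels_subset by blast
  qed
  from mod_span_least[OF submodule_vimage[OF F.module_axioms L h H] this]
  have "t \<in> {t \<in> carrier F. h t \<in> H}"
    using assms(9) unfolding tensor_ker_def F_def[symmetric] by (rule subsetD)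
  then show ?thesis by simp
qed

lemma tensor_ker_rels:
  "x \<in> carrier M \<Longrightarrow> x' \<in> carrier M \<Longrightarrow> y \<in> carrier N \<Longrightarrow>
    basis_vec R (x \<oplus>\<^bsub>M\<^esub> x', y) \<ominus>\<^bsub>F\<^esub> (basis_vec R (x, y) \<oplus>\<^bsub>F\<^esub> basis_vec R (x', y)) \<in> tensor_ker R M N"
  "x \<in> carrier M \<Longrightarrow> y \<in> carrier N \<Longrightarrow> y' \<in> carrier N \<Longrightarrow>
    basis_vec R (x, y \<oplus>\<^bsub>N\<^esub> y') \<ominus>\<^bsub>F\<^esub> (basis_vec R (x, y) \<oplus>\<^bsub>F\<^esub> basis_vec R (x, y')) \<in> tensor_ker R M N"
  "r \<in> carrier R \<Longrightarrow> x \<in> carrier M \<Longrightarrow> y \<in> carrier N \<Longrightarrow>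
    basis_vec R (r \<odot>\<^bsub>M\<^esub> x, y) \<ominus>\<^bsub>F\<^esub> r \<odot>\<^bsub>F\<^esub> basis_vec R (x, y) \<in> tensor_ker R M N"
  "r \<in> carrier R \<Longrightarrow> x \<in> carrier M \<Longrightarrow> y \<in> carrier N \<Longrightarrow>
    basis_vec R (x, r \<odot>\<^bsub>N\<^esub> y) \<ominus>\<^bsub>F\<^esub> r \<odot>\<^bsub>F\<^esub> basis_vec R (x, y) \<in> tensor_ker R M N"
proof -
  have "t \<in> tensor_ker R M N" if "t \<in> tensor_rels R M N" for t
    unfolding tensor_ker_def by (rule subsetD[OF mod_span_superset that])
  note * = this[unfolded tensor_rels_iff F_def[symmetric]]
  show "x \<in> carrier M \<Longrightarrow> x' \<in> carrier M \<Longrightarrow> y \<in> carrier N \<Longrightarrow>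
      basis_vec R (x \<oplus>\<^bsub>M\<^esub> x', y) \<ominus>\<^bsub>F\<^esub> (basis_vec R (x, y) \<oplus>\<^bsub>F\<^esub> basis_vec R (x', y)) \<in> tensor_ker R M N"
    by (rule *[OF disjI1]) (intro exI conjI, rule refl)
  show "x \<in> carrier M \<Longrightarrow> y \<in> carrier N \<Longrightarrow> y' \<in> carrier N \<Longrightarrow>
      basis_vec R (x, y \<oplus>\<^bsub>N\<^esub> y') \<ominus>\<^bsub>F\<^esub> (basis_vec R (x, y) \<oplus>\<^bsub>F\<^esub> basis_vec R (x, y')) \<in> tensor_ker R M N"
    by (rule *[OF disjI2[OF disjI1]]) (intro exI conjI, rule refl)
  show "r \<in> carrier R \<Longrightarrow> x \<in> carrier M \<Longrightarrow> y \<in> carrier N \<Longrightarrow>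
      basis_vec R (r \<odot>\<^bsub>M\<^esub> x, y) \<ominus>\<^bsub>F\<^esub> r \<odot>\<^bsub>F\<^esub> basis_vec R (x, y) \<in> tensor_ker R M N"
    by (rule *[OF disjI2[OF disjI2[OF disjI1]]]) (intro exI conjI, rule refl)
  show "r \<in> carrier R \<Longrightarrow> x \<in> carrier M \<Longrightarrow> y \<in> carrier N \<Longrightarrow>
      basis_vec R (x, r \<odot>\<^bsub>N\<^esub> y) \<ominus>\<^bsub>F\<^esub> r \<odot>\<^bsub>F\<^esub> basis_vec R (x, y) \<in> tensor_ker R M N"
    by (rule *[OF disjI2[OF disjI2[OF disjI2]]]) (intro exI conjI, rule refl)
qed

text \<open>The converse half of the universal property: the two sides of each identity differ by a
  relation, and \<open>h\<close> is zero on relations.\<close>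

lemma tensor_hom_bilinear:
  assumes L: "module R L" and h: "h \<in> mod_hom R F L"
    and z: "\<And>t. t \<in> tensor_ker R M N \<Longrightarrow> h t = \<zero>\<^bsub>L\<^esub>"
  shows "x \<in> carrier M \<Longrightarrow> x' \<in> carrier M \<Longrightarrow> y \<in> carrier N \<Longrightarrow>
      h (basis_vec R (x \<oplus>\<^bsub>M\<^esub> x', y)) = h (basis_vec R (x, y)) \<oplus>\<^bsub>L\<^esub> h (basis_vec R (x', y))"
    and "x \<in> carrier M \<Longrightarrow> y \<in> carrier N \<Longrightarrow> y' \<in> carrier N \<Longrightarrow>
      h (basis_vec R (x, y \<oplus>\<^bsub>N\<^esub> y')) = h (basis_vec R (x, y)) \<oplus>\<^bsub>L\<^esub> h (basis_vec R (x, y'))"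
    and "r \<in> carrier R \<Longrightarrow> x \<in> carrier M \<Longrightarrow> y \<in> carrier N \<Longrightarrow>
      h (basis_vec R (r \<odot>\<^bsub>M\<^esub> x, y)) = r \<odot>\<^bsub>L\<^esub> h (basis_vec R (x, y))"
    and "r \<in> carrier R \<Longrightarrow> x \<in> carrier M \<Longrightarrow> y \<in> carrier N \<Longrightarrow>
      h (basis_vec R (x, r \<odot>\<^bsub>N\<^esub> y)) = r \<odot>\<^bsub>L\<^esub> h (basis_vec R (x, y))"
proof -
  interpret L: module R L by fact
  have eq: "h a = h b" if "a \<ominus>\<^bsub>F\<^esub> b \<in> tensor_ker R M N" "a \<in> carrier F" "b \<in> carrier F" for a b
    using z[OF that(1)] mod_hom_diff[OF F.module_axioms L h that(2,3)] that(2,3)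
    by (simp add: L.M.minus_eq_zero_iff mod_homD(1)[OF h])
  note hD = mod_homD(2,3)[OF h, symmetric]
  show "h (basis_vec R (x \<oplus>\<^bsub>M\<^esub> x', y)) = h (basis_vec R (x, y)) \<oplus>\<^bsub>L\<^esub> h (basis_vec R (x', y))"
    if "x \<in> carrier M" "x' \<in> carrier M" "y \<in> carrier N"
    using that by (subst hD(1); (intro eq tensor_ker_rels F.M.a_closed basis_vec_tensor)?) auto
  show "h (basis_vec R (x, y \<oplus>\<^bsub>N\<^esub> y')) = h (basis_vec R (x, y)) \<oplus>\<^bsub>L\<^esub> h (basis_vec R (x, y'))"
    if "x \<in> carrier M" "y \<in> carrier N" "y' \<in> carrier N"
    using that by (subst hD(1); (intro eq tensor_ker_rels F.M.a_closed basis_vec_tensor)?) auto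
  show "h (basis_vec R (r \<odot>\<^bsub>M\<^esub> x, y)) = r \<odot>\<^bsub>L\<^esub> h (basis_vec R (x, y))"
    if "r \<in> carrier R" "x \<in> carrier M" "y \<in> carrier N"
    using that by (subst hD(2); (intro eq tensor_ker_rels F.smult_closed basis_vec_tensor)?) auto
  show "h (basis_vec R (x, r \<odot>\<^bsub>N\<^esub> y)) = r \<odot>\<^bsub>L\<^esub> h (basis_vec R (x, y))"
    if "r \<in> carrier R" "x \<in> carrier M" "y \<in> carrier N"
    using that by (subst hD(2); (intro eq tensor_ker_rels F.smult_closed basis_vec_tensor)?) auto
qed

end

text \<open>This extends \<open>\<phi>\<close> along the map from \<open>F\<close> to the quotient
  of \<open>L\<close> by \<open>K\<close>. The quotient itself is avoided: \<open>\<phi>\<close> is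
  transported to the submodule of \<open>L\<close> generated by \<open>K\<close> and the image of
  \<open>t\<close>, and extended from there.\<close>

lemma injective_module_extend_along:
  assumes inj: "injective_module R I" and F: "module R F" and L: "module R L"
    and t: "t \<in> mod_hom R F L" and K: "submodule K R L" and \<phi>: "\<phi> \<in> mod_hom R F I"
    and ker: "\<And>x. x \<in> carrier F \<Longrightarrow> t x \<in> K \<Longrightarrow> \<phi> x = \<zero>\<^bsub>I\<^esub>"
  obtains G where "G \<in> mod_hom R L I" "\<And>k. k \<in> K \<Longrightarrow> G k = \<zero>\<^bsub>I\<^esub>"
    "\<And>x. x \<in> carrier F \<Longrightarrow> G (t x) = \<phi> x"
proof -
  have I: "module R I" using inj by (simp add: injective_module_def)
  interpret I: module R I by (rule I)
  interpret F: module R F by (rule F)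
  interpret L: module R L by (rule L)
  note t' = mod_homD[OF t] and \<phi>' = mod_homD[OF \<phi>]
  note proj = mod_homD(2,3)[OF quot_module_proj[OF L K]]
  \<comment> \<open>\<open>T a x\<close> says that \<open>a\<close> is congruent to
    \<open>t x\<close> modulo \<open>K\<close>. So \<open>A\<close> is the sum of \<open>K\<close>
    and the image of \<open>t\<close>, and \<open>g\<close> is well defined by
    \<open>ker\<close>.\<close>
  define T where "T a x \<longleftrightarrow> a \<in> carrier L \<and> x \<in> carrier F \<and> K +>\<^bsub>L\<^esub> a = K +>\<^bsub>L\<^esub> t x" for a x
  define A where "A = {a. \<exists>x. T a x}"
  define g where "g a = \<phi> (SOME x. T a x)" for a
  have T_unique: "\<phi> x = \<phi> y" if "T a x" "T a y" for a x y
  proof -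
    have xy: "x \<in> carrier F" "y \<in> carrier F" and eq: "K +>\<^bsub>L\<^esub> t x = K +>\<^bsub>L\<^esub> t y"
      using that by (simp_all add: T_def)
    have "t (x \<ominus>\<^bsub>F\<^esub> y) \<in> K"
      using eq xy t'(1) by (simp add: coset_eq_iff[OF L K] mod_hom_diff[OF F L t])
    then have "\<phi> x \<ominus>\<^bsub>I\<^esub> \<phi> y = \<zero>\<^bsub>I\<^esub>"
      using ker[of "x \<ominus>\<^bsub>F\<^esub> y"] xy by (simp add: mod_hom_diff[OF F I \<phi>])
    then show ?thesis using xy \<phi>'(1) by (simp add: I.M.minus_eq_zero_iff)
  qed
  have g: "g a = \<phi> x" if "T a x" for a x
    unfolding g_def by (rule T_unique[OF someI[of "T a" x, OF that] that])
  have T_add: "T (a \<oplus>\<^bsub>L\<^esub> b) (x \<oplus>\<^bsub>F\<^esub> y)" if "T a x" "T b y" for a b x y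
    using that by (simp add: T_def proj t')
  have T_smult: "T (r \<odot>\<^bsub>L\<^esub> a) (r \<odot>\<^bsub>F\<^esub> x)" if "r \<in> carrier R" "T a x" for a x r
    using that by (simp add: T_def proj t')
  \<comment> \<open>Elements of \<open>K\<close> are congruent to the image of zero, hence the
    extension is zero on \<open>K\<close>.\<close>
  have T_K: "T k \<zero>\<^bsub>F\<^esub>" if k: "k \<in> K" for k
  proof -
    have "k \<in> carrier L" using L.submoduleE(1)[OF K] k by blast
    moreover have "K +>\<^bsub>L\<^esub> k = K" "K +>\<^bsub>L\<^esub> \<zero>\<^bsub>L\<^esub> = K"
      using k calculation L.submodule_zero_closed[OF K] by (simp_all add: coset_eq_self_iff[OF L K])
    ultimately show ?thesis by (simp add: T_def mod_hom_zero[OF F L t])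
  qed
  have A: "submodule A R L"
  proof (rule L.submoduleI')
    show "A \<subseteq> carrier L" by (auto simp: A_def T_def)
    show "\<zero>\<^bsub>L\<^esub> \<in> A" unfolding A_def using T_K[OF L.submodule_zero_closed[OF K]] by blast
    show "a \<oplus>\<^bsub>L\<^esub> b \<in> A" if "a \<in> A" "b \<in> A" for a b
      using that T_add unfolding A_def mem_Collect_eq by blast
    show "r \<odot>\<^bsub>L\<^esub> a \<in> A" if "r \<in> carrier R" "a \<in> A" for r a
      using that T_smult unfolding A_def mem_Collect_eq by blast
  qed
  have g_hom: "g \<in> mod_hom R (L\<lparr>carrier := A\<rparr>) I"
    unfolding mod_hom_def
  proof (intro CollectI conjI ballI Pi_I)
    show "g a \<in> carrier I" if "a \<in> carrier (L\<lparr>carrier := A\<rparr>)" for a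
      using that g \<phi>'(1) by (auto simp: A_def T_def)
    show "g (a \<oplus>\<^bsub>L\<lparr>carrier := A\<rparr>\<^esub> b) = g a \<oplus>\<^bsub>I\<^esub> g b"
      if ab: "a \<in> carrier (L\<lparr>carrier := A\<rparr>)" "b \<in> carrier (L\<lparr>carrier := A\<rparr>)" for a b
    proof -
      obtain x y where "T a x" "T b y" using ab by (auto simp: A_def)
      then show ?thesis
        using g[OF T_add[OF \<open>T a x\<close> \<open>T b y\<close>]] g[OF \<open>T a x\<close>] g[OF \<open>T b y\<close>] by (simp add: T_def \<phi>'(2))
    qed
    show "g (r \<odot>\<^bsub>L\<lparr>carrier := A\<rparr>\<^esub> a) = r \<odot>\<^bsub>I\<^esub> g a"
      if ra: "r \<in> carrier R" "a \<in> carrier (L\<lparr>carrier := A\<rparr>)" for r a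
    proof -
      obtain x where x: "T a x" using ra by (auto simp: A_def)
      then show ?thesis
        using g[OF T_smult[OF ra(1) x]] g[OF x] ra(1) by (simp add: T_def \<phi>'(3))
    qed
  qed
  have "\<exists>h\<in>mod_hom R L I. \<forall>x\<in>carrier (L\<lparr>carrier := A\<rparr>). h (id x) = g x"
  proof (rule injective_module_extend[OF inj _ L _ _ g_hom])
    show "module R (L\<lparr>carrier := A\<rparr>)" by (rule submodule.submodule_is_module[OF A L])
    show "id \<in> mod_hom R (L\<lparr>carrier := A\<rparr>) L"
      using L.submoduleE(1)[OF A] by (auto simp: mod_hom_def)
  qed simp
  then obtain h where h_hom: "h \<in> mod_hom R L I" and hg: "\<And>a. a \<in> A \<Longrightarrow> h a = g a" by auto
  have h: "h a = \<phi> x" if "T a x" for a x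
    unfolding g[OF that, symmetric] using that by (intro hg) (unfold A_def mem_Collect_eq, rule exI)
  have "T (t x) x" if "x \<in> carrier F" for x using that t'(1) by (simp add: T_def)
  then show thesis using that[OF h_hom] h[OF T_K] h mod_hom_zero[OF F I \<phi>] by simp
qed

section \<open>Maps induced on tensor products\<close>

context
  fixes R :: "('r, 'e) ring_scheme" and M M' :: "('r, 'm) module" and N N' :: "('r, 'n) module"
    and f :: "'m \<Rightarrow> 'm" and g :: "'n \<Rightarrow> 'n" and F F' :: "('r, 'm \<times> 'n \<Rightarrow> 'r) module"
    and t :: "('m \<times> 'n \<Rightarrow> 'r) \<Rightarrow> 'm \<times> 'n \<Rightarrow> 'r"
  assumes M: "module R M" and N: "module R N" and M': "module R M'" and N': "module R N'"
    and f: "f \<in> mod_hom R M M'" and g: "g \<in> mod_hom R N N'"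
  defines "F \<equiv> free_module R (carrier M \<times> carrier N)"
    and "F' \<equiv> free_module R (carrier M' \<times> carrier N')"
    and "t \<equiv> lin_ext R (free_module R (carrier M' \<times> carrier N')) (\<lambda>(x, y). basis_vec R (f x, g y))"
begin

interpretation M: module R M by (rule M)
interpretation F: module R F unfolding F_def by (rule module_free_module) (rule M.R.is_cring)
interpretation F': module R F' unfolding F'_def by (rule module_free_module) (rule M.R.is_cring)

lemma tensor_map_lift_hom: "t \<in> mod_hom R F F'"
  unfolding t_def F_def F'_def[symmetric]
  using mod_homD(1)[OF f] mod_homD(1)[OF g] basis_vec_tensor[OF M' N'] F'.module_axioms
  by (intro lin_ext_hom) (auto simp: F'_def)

lemma tensor_map_lift_basis_vec:
  "x \<in> carrier M \<Longrightarrow> y \<in> carrier N \<Longrightarrow> t (basis_vec R (x, y)) = basis_vec R (f x, g y)"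
  unfolding t_def F'_def[symmetric]
  using mod_homD(1)[OF f] mod_homD(1)[OF g] basis_vec_tensor[OF M' N']
  by (subst lin_ext_basis_vec[OF F'.module_axioms]) (auto simp: F'_def)

lemma tensor_map_lift_ker: "u \<in> tensor_ker R M N \<Longrightarrow> t u \<in> tensor_ker R M' N'"
  using tensor_ker_rels[OF M' N', folded F'_def] mod_homD[OF f] mod_homD[OF g]
  by (intro tensor_ker_hom[OF M N F'.module_axioms tensor_map_lift_hom[unfolded F_def]
        tensor_ker_submodule[OF M' N', folded F'_def] tensor_map_lift_basis_vec]) simp_all

text \<open>Two representatives differ by an element of \<open>tensor_ker\<close>, which the lift
  \<open>t\<close> to the free modules respects; so a single representative computes the induced
  map.\<close>

lemma tensor_map_coset:
  assumes u: "u \<in> carrier F"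
  shows "tensor_map R M' N' f g (tensor_ker R M N +>\<^bsub>F\<^esub> u) = tensor_ker R M' N' +>\<^bsub>F'\<^esub> t u"
proof -
  note K = tensor_ker_submodule[OF M N, folded F_def]
  note K' = tensor_ker_submodule[OF M' N', folded F'_def]
  have "tensor_map R M' N' f g (tensor_ker R M N +>\<^bsub>F\<^esub> u) =
      (\<Union>v\<in>tensor_ker R M N +>\<^bsub>F\<^esub> u. tensor_ker R M' N' +>\<^bsub>F'\<^esub> t v)"
    unfolding tensor_map_def Let_def t_def F'_def ..
  also have "\<dots> = tensor_ker R M' N' +>\<^bsub>F'\<^esub> t u"
  proof (rule UN_coset_eq[OF F.module_axioms K u])
    fix v assume v: "v \<in> carrier F" "v \<ominus>\<^bsub>F\<^esub> u \<in> tensor_ker R M N"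
    have "t v \<ominus>\<^bsub>F'\<^esub> t u \<in> tensor_ker R M' N'"
      using tensor_map_lift_ker[OF v(2)]
      by (simp add: mod_hom_diff[OF F.module_axioms F'.module_axioms tensor_map_lift_hom v(1) u])
    then show "tensor_ker R M' N' +>\<^bsub>F'\<^esub> t v = tensor_ker R M' N' +>\<^bsub>F'\<^esub> t u"
      using v(1) u mod_homD(1)[OF tensor_map_lift_hom]
      by (simp add: coset_eq_iff[OF F'.module_axioms K'])
  qed
  finally show ?thesis .
qed

end

lemma Hom_carrier: "f \<in> carrier (Hom R M N) \<longleftrightarrow> f \<in> mod_hom R M N \<and> f \<in> extensional (carrier M)"
  and Hom_zero: "\<zero>\<^bsub>Hom R M N\<^esub> = (\<lambda>x\<in>carrier M. \<zero>\<^bsub>N\<^esub>)"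
  and Hom_add: "f \<oplus>\<^bsub>Hom R M N\<^esub> g = (\<lambda>x\<in>carrier M. f x \<oplus>\<^bsub>N\<^esub> g x)"
  and Hom_smult: "r \<odot>\<^bsub>Hom R M N\<^esub> f = (\<lambda>x\<in>carrier M. r \<odot>\<^bsub>N\<^esub> f x)"
  by (simp_all add: Hom_def)

section \<open>Tensor-Hom adjunction with an injective target\<close>

context
  fixes R :: "('r, 'e) ring_scheme" and C :: "('r, 'c) module"
    and P :: "int \<Rightarrow> ('r, 'x) module" and d :: "int \<Rightarrow> 'x \<Rightarrow> 'x"
    and F :: "int \<Rightarrow> ('r, 'c \<times> 'x \<Rightarrow> 'r) module"
    and t :: "int \<Rightarrow> ('c \<times> 'x \<Rightarrow> 'r) \<Rightarrow> 'c \<times> 'x \<Rightarrow> 'r"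
  assumes C: "module R C" and P: "chain_complex R P d"
  defines "F \<equiv> \<lambda>n. free_module R (carrier C \<times> carrier (P n))"
    and "t \<equiv> \<lambda>n. lin_ext R (free_module R (carrier C \<times> carrier (P (n - 1)))) (\<lambda>(x, y). basis_vec R (id x, d n y))"
begin

interpretation C: module R C by (rule C)

lemma module_F: "module R (F n)"
  unfolding F_def by (rule module_free_module) (rule C.R.is_cring)

lemma module_complex: "module R (P n)"
  and complex_diff_hom: "d n \<in> mod_hom R (P n) (P (n - 1))"
  using P unfolding chain_complex_def by auto

lemma id_hom: "id \<in> mod_hom R C C"
  by (simp add: mod_hom_def)

lemmas lift_rules = C module_complex C module_complex id_hom complex_diff_hom

text \<open>Exactness of the tensored complex is restated on the presenting free modules, with
  equality modulo \<open>tensor_ker\<close>; the adjunction below works with such representatives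
  only.\<close>

lemma tensor_homology_zeroD:
  assumes "zero_module (homology (\<lambda>n. tensor R C (P n)) (\<lambda>n. tensor_map R C (P (n - 1)) id (d n)) n)"
    and x: "x \<in> carrier (F n)" and tx: "t n x \<in> tensor_ker R C (P (n - 1))"
  obtains y where "y \<in> carrier (F (n + 1))" "x \<ominus>\<^bsub>F n\<^esub> t (n + 1) y \<in> tensor_ker R C (P n)"
proof -
  let ?X = "\<lambda>n. tensor R C (P n)" and ?d = "\<lambda>n. tensor_map R C (P (n - 1)) id (d n)"
  let ?K = "\<lambda>n. tensor_ker R C (P n)"
  have K: "submodule (?K m) R (F m)" for m
    unfolding F_def by (rule tensor_ker_submodule[OF C module_complex])
  have Xq: "?X m = quot_module (F m) (?K m)" for m by (simp add: tensor_def F_def)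
  have Xc: "carrier (?X m) = (\<lambda>x. ?K m +>\<^bsub>F m\<^esub> x) ` carrier (F m)" for m
    by (simp add: Xq quot_module_carrier[OF module_F K])
  have X0: "\<zero>\<^bsub>?X m\<^esub> = ?K m" for m
    by (simp add: Xq quot_module_zero[OF module_F K])
  have dK: "?d m (?K m +>\<^bsub>F m\<^esub> u) = ?K (m - 1) +>\<^bsub>F (m - 1)\<^esub> t m u" if "u \<in> carrier (F m)" for m u
    using tensor_map_coset[OF lift_rules] that unfolding F_def t_def by blast
  have t_hom: "t m \<in> mod_hom R (F m) (F (m - 1))" for m
    unfolding F_def t_def by (rule tensor_map_lift_hom[OF lift_rules])
  have z: "\<zero>\<^bsub>F m\<^esub> \<in> carrier (F m)" for m
    using module_F[of m] by (simp add: module_def abelian_group_def abelian_monoid.zero_closed)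
  have "?K n +>\<^bsub>F n\<^esub> x \<in> boundaries ?X ?d n"
  proof (rule zero_module_quotD[OF assms(1)[unfolded homology_def]])
    show "?K n +>\<^bsub>F n\<^esub> x \<in> carrier (?X n\<lparr>carrier := cycles ?X ?d n\<rparr>)"
      using x dK[OF x] tx mod_homD(1)[OF t_hom x]
      by (simp add: cycles_def Xc X0 coset_eq_self_iff[OF module_F K])
    have "?K n = ?d (n + 1) (?K (n + 1) +>\<^bsub>F (n + 1)\<^esub> \<zero>\<^bsub>F (n + 1)\<^esub>)"
      unfolding dK[OF z] mod_hom_zero[OF module_F module_F t_hom]
      using coset_eq_self_iff[OF module_F K z, of n] module.submodule_zero_closed[OF module_F K, of n]
      by simp
    then show "\<zero>\<^bsub>?X n\<lparr>carrier := cycles ?X ?d n\<rparr>\<^esub> \<in> boundaries ?X ?d n"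
      unfolding boundaries_def Xc using z by (simp add: X0)
    \<comment> \<open>The law \<open>0 + x = x\<close> for classes is read off from additivity of
      the projection.\<close>
    have "?K n +>\<^bsub>F n\<^esub> \<zero>\<^bsub>F n\<^esub> = ?K n"
      using coset_eq_self_iff[OF module_F K z, of n] module.submodule_zero_closed[OF module_F K, of n]
      by simp
    then show "\<zero>\<^bsub>?X n\<lparr>carrier := cycles ?X ?d n\<rparr>\<^esub> \<oplus>\<^bsub>?X n\<lparr>carrier := cycles ?X ?d n\<rparr>\<^esub> (?K n +>\<^bsub>F n\<^esub> x) = ?K n +>\<^bsub>F n\<^esub> x"
      using mod_homD(2)[OF quot_module_proj[OF module_F K] z x]
        module_F[of n] x by (simp add: Xq quot_module_zero[OF module_F K] module_def abelian_group_def abelian_monoid.l_zero)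
  qed
  then obtain y where y: "y \<in> carrier (F (n + 1))"
    "?K n +>\<^bsub>F n\<^esub> x = ?d (n + 1) (?K (n + 1) +>\<^bsub>F (n + 1)\<^esub> y)"
    unfolding boundaries_def Xc by blast
  have "t (n + 1) y \<in> carrier (F n)" using mod_homD(1)[OF t_hom y(1)] by simp
  then have "x \<ominus>\<^bsub>F n\<^esub> t (n + 1) y \<in> ?K n"
    using y(2) dK[OF y(1)] x by (simp add: coset_eq_iff[OF module_F K])
  then show thesis using that y(1) by blast
qed

text \<open>By adjunction, maps \<open>P n \<rightarrow> Hom C I\<close> are the maps \<open>C \<otimes> P n \<rightarrow> I\<close>, and
  \<open>Hom _ I\<close> is exact.\<close>

lemma Ext_vanishes_Hom_injective:
  assumes inj: "injective_module R I"
    and tor: "zero_module (homology (\<lambda>n. tensor R C (P n)) (\<lambda>n. tensor_map R C (P (n - 1)) id (d n)) n)"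
  shows "Ext_vanishes R P d n (Hom R C I)"
proof (rule Ext_vanishesI)
  fix f assume f: "f \<in> mod_hom R (P n) (Hom R C I)"
    and cocycle: "\<And>x. x \<in> carrier (P (n + 1)) \<Longrightarrow> f (d (n + 1) x) = \<zero>\<^bsub>Hom R C I\<^esub>"
  have I: "module R I" using inj by (simp add: injective_module_def)
  interpret I: module R I by (rule I)
  let ?K = "\<lambda>n. tensor_ker R C (P n)"
  have K: "submodule (?K m) R (F m)" for m
    unfolding F_def by (rule tensor_ker_submodule[OF C module_complex])
  have t_hom: "t m \<in> mod_hom R (F m) (F (m - 1))" for m
    unfolding F_def t_def by (rule tensor_map_lift_hom[OF lift_rules])
  have t_basis: "t m (basis_vec R (c, p)) = basis_vec R (c, d m p)"
    if "c \<in> carrier C" "p \<in> carrier (P m)" for m c p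
    using tensor_map_lift_basis_vec[OF lift_rules that] unfolding t_def by simp
  have e: "basis_vec R (c, p) \<in> carrier (F m)" if "c \<in> carrier C" "p \<in> carrier (P m)" for m c p
    using basis_vec_tensor[OF C module_complex that] by (simp add: F_def)
  have fp: "f p \<in> mod_hom R C I" "f p \<in> extensional (carrier C)" if "p \<in> carrier (P n)" for p
    using mod_homD(1)[OF f that] by (auto simp: Hom_carrier)
  \<comment> \<open>The transpose of \<open>f\<close> under the adjunction, before passing to the
    tensor product; \<open>\<phi>_ker\<close> shows that it factors.\<close>
  define \<phi> where "\<phi> = lin_ext R I (\<lambda>(c, p). f p c)"
  have \<phi>: "\<phi> \<in> mod_hom R (F n) I"
    unfolding \<phi>_def F_def using mod_homD(1)[OF fp(1)] by (intro lin_ext_hom[OF I]) auto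
  have \<phi>_basis: "\<phi> (basis_vec R (c, p)) = f p c" if "c \<in> carrier C" "p \<in> carrier (P n)" for c p
    unfolding \<phi>_def using that mod_homD(1)[OF fp(1)] by (simp add: lin_ext_basis_vec[OF I])
  have zero_sub: "submodule {\<zero>\<^bsub>I\<^esub>} R I" by (rule I.submoduleI') auto
  have \<phi>_ker: "\<phi> u = \<zero>\<^bsub>I\<^esub>" if "u \<in> ?K n" for u
  proof -
    have "\<phi> u \<in> {\<zero>\<^bsub>I\<^esub>}"
    proof (rule tensor_ker_hom[OF C module_complex I \<phi>[unfolded F_def] zero_sub \<phi>_basis _ _ _ _ that])
      interpret P: module R "P n" by (rule module_complex)
      fix c c' p p' r
      show "f p (c \<oplus>\<^bsub>C\<^esub> c') \<ominus>\<^bsub>I\<^esub> (f p c \<oplus>\<^bsub>I\<^esub> f p c') \<in> {\<zero>\<^bsub>I\<^esub>}"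
        if "c \<in> carrier C" "c' \<in> carrier C" "p \<in> carrier (P n)"
        using that by (simp add: mod_homD[OF fp(1)] I.M.minus_self)
      show "f (p \<oplus>\<^bsub>P n\<^esub> p') c \<ominus>\<^bsub>I\<^esub> (f p c \<oplus>\<^bsub>I\<^esub> f p' c) \<in> {\<zero>\<^bsub>I\<^esub>}"
        if "c \<in> carrier C" "p \<in> carrier (P n)" "p' \<in> carrier (P n)"
        using that by (simp add: mod_homD[OF fp(1)] mod_homD(2)[OF f] Hom_add I.M.minus_self)
      show "f p (r \<odot>\<^bsub>C\<^esub> c) \<ominus>\<^bsub>I\<^esub> r \<odot>\<^bsub>I\<^esub> f p c \<in> {\<zero>\<^bsub>I\<^esub>}"
        if "r \<in> carrier R" "c \<in> carrier C" "p \<in> carrier (P n)"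
        using that by (simp add: mod_homD[OF fp(1)] I.M.minus_self)
      show "f (r \<odot>\<^bsub>P n\<^esub> p) c \<ominus>\<^bsub>I\<^esub> r \<odot>\<^bsub>I\<^esub> f p c \<in> {\<zero>\<^bsub>I\<^esub>}"
        if "r \<in> carrier R" "c \<in> carrier C" "p \<in> carrier (P n)"
        using that by (simp add: mod_homD[OF fp(1)] mod_homD(3)[OF f] Hom_smult I.M.minus_self)
    qed
    then show ?thesis by simp
  qed
  have t1: "t (n + 1) \<in> mod_hom R (F (n + 1)) (F n)" using t_hom[of "n + 1"] by simp
  \<comment> \<open>It is enough to look at basis vectors, where \<open>t\<close> acts through
    \<open>d\<close> alone and the cocycle condition on \<open>f\<close> applies.\<close>
  have \<phi>_boundary: "\<phi> (t (n + 1) y) = \<zero>\<^bsub>I\<^esub>" if y: "y \<in> carrier (F (n + 1))" for y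
  proof (rule free_module_hom_eqI[OF I, of "\<lambda>y. \<phi> (t (n + 1) y)" _ "\<lambda>_. \<zero>\<^bsub>I\<^esub>"])
    show "(\<lambda>y. \<phi> (t (n + 1) y)) \<in> mod_hom R (free_module R (carrier C \<times> carrier (P (n + 1)))) I"
      using mod_hom_comp[OF t1 \<phi>] by (simp add: F_def)
    show "(\<lambda>_. \<zero>\<^bsub>I\<^esub>) \<in> mod_hom R (free_module R (carrier C \<times> carrier (P (n + 1)))) I"
      by (simp add: mod_hom_def)
    show "y \<in> carrier (free_module R (carrier C \<times> carrier (P (n + 1))))" using y by (simp add: F_def)
    fix b assume "b \<in> carrier C \<times> carrier (P (n + 1))"
    then obtain c p where b: "b = (c, p)" "c \<in> carrier C" "p \<in> carrier (P (n + 1))" by blast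
    have "d (n + 1) p \<in> carrier (P n)" using mod_homD(1)[OF complex_diff_hom b(3)] by simp
    then show "\<phi> (t (n + 1) (basis_vec R b)) = \<zero>\<^bsub>I\<^esub>"
      unfolding b(1) t_basis[OF b(2,3)] using b(2) cocycle[OF b(3)] by (simp add: \<phi>_basis Hom_zero)
  qed
  \<comment> \<open>Here the vanishing of Tor enters: \<open>x\<close> is a boundary up to an
    element of \<open>?K n\<close>, and \<open>\<phi>\<close> is zero on both. So
    \<open>\<phi>\<close> can be extended along the differential of the tensored complex.\<close>
  have "\<phi> x = \<zero>\<^bsub>I\<^esub>" if x: "x \<in> carrier (F n)" "t n x \<in> ?K (n - 1)" for x
  proof -
    obtain y where y: "y \<in> carrier (F (n + 1))" "x \<ominus>\<^bsub>F n\<^esub> t (n + 1) y \<in> ?K n"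
      using tensor_homology_zeroD[OF tor x] by blast
    show ?thesis
      using \<phi>_ker[OF y(2)] \<phi>_boundary[OF y(1)] x(1) mod_homD(1)[OF t1 y(1)] mod_homD(1)[OF \<phi>]
      by (simp add: mod_hom_diff[OF module_F I \<phi>] I.M.minus_eq_zero_iff)
  qed
  then obtain G where G: "G \<in> mod_hom R (F (n - 1)) I" "\<And>k. k \<in> ?K (n - 1) \<Longrightarrow> G k = \<zero>\<^bsub>I\<^esub>"
    "\<And>x. x \<in> carrier (F n) \<Longrightarrow> G (t n x) = \<phi> x"
    using injective_module_extend_along[OF inj module_F module_F t_hom K \<phi>] by blast
  \<comment> \<open>\<open>G\<close> is transposed back to a map from \<open>P (n - 1)\<close> to
    \<open>Hom R C I\<close>; bilinearity holds because \<open>G\<close> is zero on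
    \<open>?K (n - 1)\<close>.\<close>
  note bil = tensor_hom_bilinear[OF C module_complex I G(1)[unfolded F_def] G(2)]
  define q where "q p = (\<lambda>c\<in>carrier C. G (basis_vec R (c, p)))" for p
  have "q p \<in> carrier (Hom R C I)" if "p \<in> carrier (P (n - 1))" for p
    using that mod_homD(1)[OF G(1) e] bil(1,3) by (simp add: q_def Hom_carrier mod_hom_def)
  then have "q \<in> mod_hom R (P (n - 1)) (Hom R C I)"
    using bil(2,4) unfolding mod_hom_def
    by (auto simp: q_def Hom_add Hom_smult intro!: restrict_ext)
  moreover have "f p = q (d n p)" if p: "p \<in> carrier (P n)" for p
  proof (rule extensionalityI[OF fp(2)[OF p]])
    show "q (d n p) \<in> extensional (carrier C)" by (simp add: q_def)
    show "f p c = q (d n p) c" if "c \<in> carrier C" for c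
      using G(3)[OF e[OF that p]] that p by (simp add: q_def t_basis \<phi>_basis)
  qed
  ultimately show "\<exists>g\<in>mod_hom R (P (n - 1)) (Hom R C I). \<forall>x\<in>carrier (P n). f x = g (d n x)" by blast
qed

end

section \<open>Homology\<close>

lemma submodule_restrict:
  assumes "module R M" "submodule Z R M" "submodule K R M" "K \<subseteq> Z"
  shows "submodule K R (M\<lparr>carrier := Z\<rparr>)"
proof (rule module.module_incl_imp_submodule)
  show "module R (M\<lparr>carrier := Z\<rparr>)" by (rule submodule.submodule_is_module[OF assms(2,1)])
  show "module R (M\<lparr>carrier := Z, carrier := K\<rparr>)"
    using submodule.submodule_is_module[OF assms(3,1)] by simp
qed (simp add: assms(4))

lemma Ext_vanishes_zero_module:
  assumes "module R Y" "zero_module Y"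
  shows "Ext_vanishes R P d n Y"
proof (rule Ext_vanishesI)
  interpret Y: module R Y by fact
  fix f assume "f \<in> mod_hom R (P n) Y"
  then have "f x = \<zero>\<^bsub>Y\<^esub>" if "x \<in> carrier (P n)" for x
    using mod_homD(1)[OF _ that] assms(2) by (auto simp: zero_module_def)
  moreover have "(\<lambda>_. \<zero>\<^bsub>Y\<^esub>) \<in> mod_hom R (P (n - 1)) Y" by (simp add: mod_hom_def)
  ultimately show "\<exists>g\<in>mod_hom R (P (n - 1)) Y. \<forall>x\<in>carrier (P n). f x = g (d n x)"
    by (intro bexI[where x = "\<lambda>_. \<zero>\<^bsub>Y\<^esub>"]) auto
qed

section \<open>Cycles, boundaries and homology of a complex\<close>

context
  fixes R :: "('r, 'e) ring_scheme" and X :: "int \<Rightarrow> ('r, 'x) module" and \<delta> :: "int \<Rightarrow> 'x \<Rightarrow> 'x"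
  assumes X: "chain_complex R X \<delta>"
begin

lemma chain_module: "module R (X n)"
  and chain_hom: "\<delta> n \<in> mod_hom R (X n) (X (n - 1))"
  and chain_hom_Suc: "\<delta> (n + 1) \<in> mod_hom R (X (n + 1)) (X n)"
  and chain_diff: "x \<in> carrier (X (n + 1)) \<Longrightarrow> \<delta> n (\<delta> (n + 1) x) = \<zero>\<^bsub>X (n - 1)\<^esub>"
proof -
  note * = X[unfolded chain_complex_def, rule_format]
  show "module R (X n)" "\<delta> n \<in> mod_hom R (X n) (X (n - 1))" using * by auto
  show "\<delta> (n + 1) \<in> mod_hom R (X (n + 1)) (X n)" using *[of "n + 1"] by simp
  show "x \<in> carrier (X (n + 1)) \<Longrightarrow> \<delta> n (\<delta> (n + 1) x) = \<zero>\<^bsub>X (n - 1)\<^esub>"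
    using *[of "n + 1"] by simp
qed

lemma cycles_submodule: "submodule (cycles X \<delta> n) R (X n)"
  unfolding cycles_def by (rule mod_hom_ker_submodule[OF chain_module chain_module chain_hom])

lemma boundaries_submodule: "submodule (boundaries X \<delta> n) R (X n)"
  unfolding boundaries_def by (rule mod_hom_image_submodule[OF chain_module chain_module chain_hom_Suc])

lemma boundaries_subset_cycles: "boundaries X \<delta> n \<subseteq> cycles X \<delta> n"
  unfolding boundaries_def cycles_def using mod_homD(1)[OF chain_hom_Suc] chain_diff by auto

lemma module_cycles: "module R ((X n)\<lparr>carrier := cycles X \<delta> n\<rparr>)"
  by (rule submodule.submodule_is_module[OF cycles_submodule chain_module])

lemma module_boundaries: "module R ((X n)\<lparr>carrier := boundaries X \<delta> n\<rparr>)"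
  by (rule submodule.submodule_is_module[OF boundaries_submodule chain_module])

lemma boundaries_submodule_cycles: "submodule (boundaries X \<delta> n) R ((X n)\<lparr>carrier := cycles X \<delta> n\<rparr>)"
  by (rule submodule_restrict[OF chain_module cycles_submodule boundaries_submodule boundaries_subset_cycles])

lemma zero_homology_iff: "zero_module (homology X \<delta> n) \<longleftrightarrow> cycles X \<delta> n = boundaries X \<delta> n"
  unfolding homology_def zero_module_quot[OF module_cycles boundaries_submodule_cycles]
  using boundaries_subset_cycles by auto

lemma zero_module_homology:
  assumes "zero_module (X n)"
  shows "zero_module (homology X \<delta> n)"
  using assms boundaries_subset_cycles[of n]
    module.submodule_zero_closed[OF chain_module boundaries_submodule, of n]
  unfolding zero_homology_iff by (auto simp: zero_module_def cycles_def)

text \<open>Composing with the projection onto classes turns the isomorphism into a surjection on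
  cycles whose kernel is the boundaries, the form of short exact sequence that the Ext lemmas
  take.\<close>

lemma homology_iso_hom:
  assumes N: "module R N" and iso: "mod_iso R (homology X \<delta> n) N"
  obtains g where "g \<in> mod_hom R ((X n)\<lparr>carrier := cycles X \<delta> n\<rparr>) N"
    "g ` cycles X \<delta> n = carrier N" "boundaries X \<delta> n = {x \<in> cycles X \<delta> n. g x = \<zero>\<^bsub>N\<^esub>}"
proof -
  let ?Z = "(X n)\<lparr>carrier := cycles X \<delta> n\<rparr>" and ?B = "boundaries X \<delta> n"
  let ?\<pi> = "\<lambda>x. ?B +>\<^bsub>?Z\<^esub> x"
  note q = module_cycles[of n] boundaries_submodule_cycles[of n]
  obtain f where f: "f \<in> mod_hom R (homology X \<delta> n) N"
    and bij: "bij_betw f (carrier (homology X \<delta> n)) (carrier N)"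
    using iso by (auto simp: mod_iso_def)
  have Hc: "carrier (homology X \<delta> n) = ?\<pi> ` cycles X \<delta> n"
    unfolding homology_def quot_module_carrier[OF q] by simp
  have g: "(\<lambda>x. f (?\<pi> x)) \<in> mod_hom R ?Z N"
    by (rule mod_hom_comp[OF quot_module_proj[OF q] f[unfolded homology_def]])
  have z: "\<zero>\<^bsub>X n\<^esub> \<in> cycles X \<delta> n" "\<zero>\<^bsub>X n\<^esub> \<in> ?B"
    using module.submodule_zero_closed[OF chain_module] cycles_submodule boundaries_submodule by blast+
  \<comment> \<open>\<open>f\<close> is injective and sends the zero class, which is
    \<open>?B\<close>, to zero.\<close>
  have "f (?\<pi> x) = \<zero>\<^bsub>N\<^esub> \<longleftrightarrow> x \<in> ?B" if x: "x \<in> cycles X \<delta> n" for x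
  proof -
    have "?\<pi> \<zero>\<^bsub>X n\<^esub> = ?B" using coset_eq_self_iff[OF q, of "\<zero>\<^bsub>X n\<^esub>"] z by simp
    moreover have "f (?\<pi> \<zero>\<^bsub>X n\<^esub>) = \<zero>\<^bsub>N\<^esub>" using mod_hom_zero[OF q(1) N g] by simp
    ultimately have "f (?\<pi> x) = \<zero>\<^bsub>N\<^esub> \<longleftrightarrow> ?\<pi> x = ?B"
      using bij x z(1) unfolding bij_betw_def Hc inj_on_def by (metis image_eqI)
    then show ?thesis using coset_eq_self_iff[OF q, of x] x by simp
  qed
  moreover have "(\<lambda>x. f (?\<pi> x)) ` cycles X \<delta> n = carrier N"
    using bij unfolding bij_betw_def Hc by (simp add: image_image)
  ultimately show thesis using that[OF g] boundaries_subset_cycles[of n] by blast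
qed

end

section \<open>Hom complexes and the link to Ext\<close>

lemma chain_complex_coHom:
  assumes P: "chain_complex R P d" and N: "module R N"
  shows "chain_complex R (coHom_cplx R P N) (coHom_diff P d)"
  unfolding chain_complex_def
proof (intro allI conjI ballI)
  interpret N: module R N by (rule N)
  fix n
  show "module R (coHom_cplx R P N n)"
    unfolding coHom_cplx_def by (rule module_Hom[OF chain_module[OF P] N])
  \<comment> \<open>Degrees are negated in \<open>coHom_cplx\<close>, so the differential out of
    degree \<open>n\<close> is composition with \<open>d (1 - n)\<close>.\<close>
  have n: "- (n - 1) = 1 - n" by simp
  have d: "d (1 - n) \<in> mod_hom R (P (1 - n)) (P (- n))" using chain_hom[OF P, of "1 - n"] by simp
  interpret P1: module R "P (1 - n)" by (rule chain_module[OF P])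
  show "coHom_diff P d n \<in> mod_hom R (coHom_cplx R P N n) (coHom_cplx R P N (n - 1))"
    unfolding mod_hom_def coHom_cplx_def coHom_diff_def n
  proof (intro CollectI conjI ballI Pi_I)
    fix f g r assume f: "f \<in> carrier (Hom R (P (- n)) N)" and g: "g \<in> carrier (Hom R (P (- n)) N)"
    show "(\<lambda>x\<in>carrier (P (1 - n)). f (d (1 - n) x)) \<in> carrier (Hom R (P (1 - n)) N)"
      using mod_hom_comp[OF d, of f N] f by (auto simp: Hom_carrier mod_hom_def)
    show "(\<lambda>x\<in>carrier (P (1 - n)). (f \<oplus>\<^bsub>Hom R (P (- n)) N\<^esub> g) (d (1 - n) x)) =
        (\<lambda>x\<in>carrier (P (1 - n)). f (d (1 - n) x)) \<oplus>\<^bsub>Hom R (P (1 - n)) N\<^esub> (\<lambda>x\<in>carrier (P (1 - n)). g (d (1 - n) x))"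
      by (auto simp: Hom_add mod_homD(1)[OF d] intro!: restrict_ext)
    show "(\<lambda>x\<in>carrier (P (1 - n)). (r \<odot>\<^bsub>Hom R (P (- n)) N\<^esub> f) (d (1 - n) x)) =
        r \<odot>\<^bsub>Hom R (P (1 - n)) N\<^esub> (\<lambda>x\<in>carrier (P (1 - n)). f (d (1 - n) x))"
      by (auto simp: Hom_smult mod_homD(1)[OF d] intro!: restrict_ext)
  qed
  fix f assume f: "f \<in> carrier (coHom_cplx R P N n)"
  then have fh: "f \<in> mod_hom R (P (- n)) N" by (simp add: coHom_cplx_def Hom_carrier)
  have "f (d (1 - n) (d (2 - n) x)) = \<zero>\<^bsub>N\<^esub>" if "x \<in> carrier (P (2 - n))" for x
    using chain_diff[OF P, of x "1 - n"] that mod_hom_zero[OF chain_module[OF P] N fh] by simp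
  moreover have "d (2 - n) x \<in> carrier (P (1 - n))" if "x \<in> carrier (P (2 - n))" for x
    using mod_homD(1)[OF chain_hom[OF P] that] by simp
  ultimately show "coHom_diff P d (n - 1) (coHom_diff P d n f) = \<zero>\<^bsub>coHom_cplx R P N (n - 2)\<^esub>"
    by (auto simp: coHom_diff_def coHom_cplx_def Hom_zero intro!: restrict_ext)
qed

lemma chain_complex_Hom:
  assumes I: "chain_complex R I d" and C: "module R C"
  shows "chain_complex R (Hom_cplx R C I) (Hom_diff C d)"
  unfolding chain_complex_def
proof (intro allI conjI ballI)
  interpret C: module R C by (rule C)
  fix n
  show "module R (Hom_cplx R C I n)"
    unfolding Hom_cplx_def by (rule module_Hom[OF C chain_module[OF I]])
  note d = mod_homD[OF chain_hom[OF I, of n]]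
  show "Hom_diff C d n \<in> mod_hom R (Hom_cplx R C I n) (Hom_cplx R C I (n - 1))"
    unfolding mod_hom_def Hom_cplx_def Hom_diff_def
  proof (intro CollectI conjI ballI Pi_I)
    fix f assume f: "f \<in> carrier (Hom R C (I n))"
    note f' = mod_homD[OF conjunct1[OF f[unfolded Hom_carrier]]]
    show "(\<lambda>c\<in>carrier C. d n (f c)) \<in> carrier (Hom R C (I (n - 1)))"
      by (auto simp: Hom_carrier mod_hom_def d f')
    show "(\<lambda>c\<in>carrier C. d n ((f \<oplus>\<^bsub>Hom R C (I n)\<^esub> g) c)) =
        (\<lambda>c\<in>carrier C. d n (f c)) \<oplus>\<^bsub>Hom R C (I (n - 1))\<^esub> (\<lambda>c\<in>carrier C. d n (g c))"
      if g: "g \<in> carrier (Hom R C (I n))" for g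
      using mod_homD[OF conjunct1[OF g[unfolded Hom_carrier]]]
      by (auto simp: Hom_add d f' intro!: restrict_ext)
    show "(\<lambda>c\<in>carrier C. d n ((r \<odot>\<^bsub>Hom R C (I n)\<^esub> f) c)) =
        r \<odot>\<^bsub>Hom R C (I (n - 1))\<^esub> (\<lambda>c\<in>carrier C. d n (f c))" if "r \<in> carrier R" for r
      using that by (auto simp: Hom_smult d f' intro!: restrict_ext)
  qed
  fix f assume "f \<in> carrier (Hom_cplx R C I n)"
  then have f: "f \<in> mod_hom R C (I n)" by (simp add: Hom_cplx_def Hom_carrier)
  have "d (n - 1) (d n (f c)) = \<zero>\<^bsub>I (n - 2)\<^esub>" if "c \<in> carrier C" for c
    using I mod_homD(1)[OF f that] by (simp add: chain_complex_def)
  then show "Hom_diff C d (n - 1) (Hom_diff C d n f) = \<zero>\<^bsub>Hom_cplx R C I (n - 2)\<^esub>"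
    by (auto simp: Hom_diff_def Hom_cplx_def Hom_zero intro!: restrict_ext)
qed

lemma zero_module_Hom:
  assumes "module R C" "module R N" "zero_module N"
  shows "zero_module (Hom R C N)"
proof -
  have H: "module R (Hom R C N)" by (rule module_Hom[OF assms(1,2)])
  have "f = \<zero>\<^bsub>Hom R C N\<^esub>" if "f \<in> carrier (Hom R C N)" for f
  proof (rule extensionalityI[where A = "carrier C"])
    have f: "f \<in> mod_hom R C N" using that by (simp add: Hom_carrier)
    show "f \<in> extensional (carrier C)" using that by (simp add: Hom_carrier)
    show "\<zero>\<^bsub>Hom R C N\<^esub> \<in> extensional (carrier C)" by (simp add: Hom_zero)
    show "f c = \<zero>\<^bsub>Hom R C N\<^esub> c" if "c \<in> carrier C" for c
      using mod_homD(1)[OF f that] that assms(3) by (simp add: Hom_zero zero_module_def)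
  qed
  moreover have "\<zero>\<^bsub>Hom R C N\<^esub> \<in> carrier (Hom R C N)"
    by (rule module.submodule_zero_closed[OF H module.carrier_is_submodule[OF H]])
  ultimately show ?thesis unfolding zero_module_def by blast
qed

text \<open>Cohomology of degree \<open>i\<close> sits in homological degree \<open>- int i\<close>.
  Elements of \<open>Hom\<close> are extensional while the maps in \<open>Ext_vanishes\<close> are
  arbitrary off the carrier, so each direction cuts a map down by restriction.\<close>

lemma zero_Ext_iff:
  assumes M: "module R M" and N: "module R N"
  shows "zero_module (Ext R i M N) \<longleftrightarrow> Ext_vanishes R (res R M) (res_diff R) (int i) N"
proof -
  let ?P = "res R M" and ?d = "res_diff R"
  let ?X = "coHom_cplx R ?P N" and ?D = "coHom_diff ?P ?d"
  note P = res_free_resolution(1)[OF M]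
  note X = chain_complex_coHom[OF P N]
  have d: "?d (int i + 1) x \<in> carrier (?P (int i))" if "x \<in> carrier (?P (int i + 1))" for x
    by (rule mod_homD(1)[OF chain_hom_Suc[OF P] that])
  have "zero_module (Ext R i M N) \<longleftrightarrow> cycles ?X ?D (- int i) \<subseteq> boundaries ?X ?D (- int i)"
    unfolding Ext_def zero_homology_iff[OF X] using boundaries_subset_cycles[OF X] by blast
  also have "\<dots> \<longleftrightarrow> Ext_vanishes R ?P ?d (int i) N"
  proof
    assume sub: "cycles ?X ?D (- int i) \<subseteq> boundaries ?X ?D (- int i)"
    show "Ext_vanishes R ?P ?d (int i) N"
    proof (rule Ext_vanishesI)
      fix f assume f: "f \<in> mod_hom R (?P (int i)) N"
        and c: "\<And>x. x \<in> carrier (?P (int i + 1)) \<Longrightarrow> f (?d (int i + 1) x) = \<zero>\<^bsub>N\<^esub>"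
      interpret Pi: module R "?P (int i)" by (rule chain_module[OF P])
      define f' where "f' = (\<lambda>x\<in>carrier (?P (int i)). f x)"
      have "f' \<in> carrier (Hom R (?P (int i)) N)"
        using f by (auto simp: f'_def Hom_carrier mod_hom_def)
      moreover have "?D (- int i) f' = \<zero>\<^bsub>?X (- int i - 1)\<^esub>"
        using c d by (auto simp: coHom_diff_def coHom_cplx_def Hom_zero f'_def add.commute intro!: restrict_ext)
      ultimately have "f' \<in> boundaries ?X ?D (- int i)"
        using sub by (auto simp: cycles_def coHom_cplx_def)
      then obtain g where g: "g \<in> carrier (Hom R (?P (int i - 1)) N)"
        "f' = (\<lambda>x\<in>carrier (?P (int i)). g (?d (int i) x))"
        by (auto simp: boundaries_def coHom_cplx_def coHom_diff_def)
      have "f x = g (?d (int i) x)" if "x \<in> carrier (?P (int i))" for x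
        using fun_cong[OF g(2), of x] that by (simp add: f'_def)
      then show "\<exists>g\<in>mod_hom R (?P (int i - 1)) N. \<forall>x\<in>carrier (?P (int i)). f x = g (?d (int i) x)"
        using g(1) by (auto simp: Hom_carrier)
    qed
  next
    assume E: "Ext_vanishes R ?P ?d (int i) N"
    show "cycles ?X ?D (- int i) \<subseteq> boundaries ?X ?D (- int i)"
    proof
      fix f assume "f \<in> cycles ?X ?D (- int i)"
      then have f: "f \<in> mod_hom R (?P (int i)) N" "f \<in> extensional (carrier (?P (int i)))"
        and c: "(\<lambda>x\<in>carrier (?P (int i + 1)). f (?d (int i + 1) x)) = (\<lambda>x\<in>carrier (?P (int i + 1)). \<zero>\<^bsub>N\<^esub>)"
        by (auto simp: cycles_def coHom_cplx_def coHom_diff_def Hom_carrier Hom_zero add.commute)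
      have c': "f (?d (int i + 1) x) = \<zero>\<^bsub>N\<^esub>" if "x \<in> carrier (?P (int i + 1))" for x
        using fun_cong[OF c, of x] that by simp
      obtain g where g: "g \<in> mod_hom R (?P (int i - 1)) N"
        "\<And>x. x \<in> carrier (?P (int i)) \<Longrightarrow> f x = g (?d (int i) x)"
        by (rule Ext_vanishesE[OF E f(1)], rule c', assumption, rule that)
      interpret P1: module R "?P (int i - 1)" by (rule chain_module[OF P])
      define g' where "g' = (\<lambda>x\<in>carrier (?P (int i - 1)). g x)"
      have "g' \<in> carrier (Hom R (?P (int i - 1)) N)"
        using g(1) by (auto simp: g'_def Hom_carrier mod_hom_def)
      moreover have "f = (\<lambda>x\<in>carrier (?P (int i)). g' (?d (int i) x))"
        using g(2) mod_homD(1)[OF chain_hom[OF P]]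
        by (intro extensionalityI[OF f(2)]) (auto simp: g'_def)
      ultimately show "f \<in> boundaries ?X ?D (- int i)"
        by (auto simp: boundaries_def coHom_cplx_def coHom_diff_def)
    qed
  qed
  finally show ?thesis .
qed

section \<open>Complexes whose homology consists of powers of \<open>N\<close>\<close>

text \<open>In the application \<open>P\<close> is the standard resolution of \<open>M\<close> and
  \<open>X\<close> is \<open>Hom_cplx R C I\<close>. Of \<open>C\<close> and \<open>I\<close> two
  traces remain: the acyclicity \<open>Ext_X\<close> and the shape of the homology.\<close>

locale power_homology = free_complex R P d S
  for R :: "('r, 'e) ring_scheme" and P :: "int \<Rightarrow> ('r, 'b \<Rightarrow> 'r) module"
    and d :: "int \<Rightarrow> ('b \<Rightarrow> 'r) \<Rightarrow> 'b \<Rightarrow> 'r" and S :: "int \<Rightarrow> 'b set" +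
  fixes X :: "int \<Rightarrow> ('r, 'x) module" and \<delta> :: "int \<Rightarrow> 'x \<Rightarrow> 'x" and N :: "('r, 'n) module"
  assumes X: "chain_complex R X \<delta>" and N: "module R N"
    and Ext_X: "0 < i \<Longrightarrow> Ext_vanishes R P d i (X n)"
    and homology: "zero_module (homology X \<delta> n) \<or> (\<exists>k. mod_iso R (homology X \<delta> n) (direct_power N k))"
begin

abbreviation Z where "Z n \<equiv> (X n)\<lparr>carrier := cycles X \<delta> n\<rparr>"
abbreviation B where "B n \<equiv> (X n)\<lparr>carrier := boundaries X \<delta> n\<rparr>"

text \<open>The sequence 0 -> Z n -> X n -> B (n - 1) -> 0, in the order and form in which the long
  exact sequence lemmas take their hypotheses.\<close>

lemma cycles_sequence:
  shows "\<delta> n \<in> mod_hom R (X n) (B (n - 1))" "\<delta> n ` carrier (X n) = carrier (B (n - 1))"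
    "cycles X \<delta> n = {x \<in> carrier (X n). \<delta> n x = \<zero>\<^bsub>B (n - 1)\<^esub>}"
proof -
  show im: "\<delta> n ` carrier (X n) = carrier (B (n - 1))" by (simp add: boundaries_def)
  have "boundaries X \<delta> (n - 1) \<subseteq> carrier (X (n - 1))"
    by (rule module.submoduleE(1)[OF chain_module[OF X] boundaries_submodule[OF X]])
  then show "\<delta> n \<in> mod_hom R (X n) (B (n - 1))"
    using chain_hom[OF X] im by (subst mod_hom_restrict_codomain) auto
  show "cycles X \<delta> n = {x \<in> carrier (X n). \<delta> n x = \<zero>\<^bsub>B (n - 1)\<^esub>}"
    by (simp add: cycles_def)
qed

lemmas cycles_sequence_facts = chain_module[OF X] module_boundaries[OF X] cycles_sequence

text \<open>Zero homology is treated as the power with exponent 0, so the induction down the complex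
  makes no case distinction; positivity of \<open>k\<close> is what later allows passing from the
  power back to \<open>N\<close>.\<close>

lemma homology_sequence:
  obtains k g where "g \<in> mod_hom R (Z n) (direct_power N k)"
    "g ` carrier (Z n) = carrier (direct_power N k)"
    "boundaries X \<delta> n = {x \<in> carrier (Z n). g x = \<zero>\<^bsub>direct_power N k\<^esub>}"
    "\<not> zero_module (homology X \<delta> n) \<Longrightarrow> 0 < k"
proof (cases "zero_module (homology X \<delta> n)")
  case True
  \<comment> \<open>The power with exponent 0 has a single element, the everywhere undefined
    function.\<close>
  define g where "g = (\<lambda>(_ :: 'x) (_ :: nat). undefined :: 'n)"
  have z: "cycles X \<delta> n \<noteq> {}"
    using module.submodule_zero_closed[OF chain_module cycles_submodule, OF X X, of n] by blast
  have "g \<in> mod_hom R (Z n) (direct_power N 0)"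
    by (auto simp: mod_hom_def g_def direct_power_def)
  moreover have "g ` carrier (Z n) = carrier (direct_power N 0)"
    using z by (auto simp: g_def direct_power_def)
  moreover have "boundaries X \<delta> n = {x \<in> carrier (Z n). g x = \<zero>\<^bsub>direct_power N 0\<^esub>}"
    using True by (simp add: zero_homology_iff[OF X] g_def direct_power_def restrict_def)
  ultimately show thesis using that True by blast
next
  case False
  then obtain k where "mod_iso R (homology X \<delta> n) (direct_power N k)" using homology by blast
  from homology_iso_hom[OF X module_direct_power[OF N] this]
  obtain g where g: "g \<in> mod_hom R (Z n) (direct_power N k)"
    "g ` cycles X \<delta> n = carrier (direct_power N k)"
    "boundaries X \<delta> n = {x \<in> cycles X \<delta> n. g x = \<zero>\<^bsub>direct_power N k\<^esub>}" .
  \<comment> \<open>With exponent 0 the map \<open>g\<close> would kill all cycles, making every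
    cycle a boundary.\<close>
  have "0 < k"
  proof (rule ccontr)
    assume "\<not> 0 < k"
    then have "f = \<zero>\<^bsub>direct_power N k\<^esub>" if "f \<in> carrier (direct_power N k)" for f
      using that by (auto simp: direct_power_def)
    then have "g x = \<zero>\<^bsub>direct_power N k\<^esub>" if "x \<in> cycles X \<delta> n" for x
      using g(2) that by blast
    then show False using False g(3) zero_homology_iff[OF X] by auto
  qed
  then show thesis using that[of g k] g by simp
qed

text \<open>\<open>Z n\<close> lies between \<open>B n\<close> and a power of \<open>N\<close>, so
  its Ext in degree \<open>i + 1\<close> is zero. The connecting map embeds Ext of
  \<open>B (n - 1)\<close> in degree \<open>i\<close> into it, because \<open>X n\<close> is acyclic
  in degree \<open>i\<close>.\<close>

lemma Ext_vanishes_boundaries_pred: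
  assumes "0 < i" "Ext_vanishes R P d (i + 1) (B n)" "Ext_vanishes R P d (i + 1) N"
  shows "Ext_vanishes R P d i (B (n - 1))"
proof -
  obtain k g where g: "g \<in> mod_hom R (Z n) (direct_power N k)"
    "g ` carrier (Z n) = carrier (direct_power N k)"
    "boundaries X \<delta> n = {x \<in> carrier (Z n). g x = \<zero>\<^bsub>direct_power N k\<^esub>}"
    by (rule homology_sequence)
  have "Ext_vanishes R P d (i + 1) (Z n)"
    by (rule Ext_vanishes_middle[OF module_cycles[OF X] module_direct_power[OF N] g])
      (simp_all add: assms Ext_vanishes_direct_power)
  then show ?thesis
    by (rule Ext_vanishes_quotient[OF cycles_sequence_facts Ext_X[OF assms(1)]])
qed

text \<open>Descending induction from the top of \<open>X\<close>. All degrees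
  \<open>i \<ge> t\<close> are carried along at once, since a step at \<open>i\<close> draws on
  degree \<open>i + 1\<close>.\<close>

lemma Ext_vanishes_boundaries:
  assumes zero: "\<And>n. b < n \<Longrightarrow> zero_module (X n)" and "0 < t"
    and N0: "\<And>i. t < i \<Longrightarrow> Ext_vanishes R P d i N" and "t \<le> i"
  shows "Ext_vanishes R P d i (B n)"
proof -
  \<comment> \<open>Boundaries in degree \<open>n\<close> come from \<open>X (n + 1)\<close>, so
    they are zero already at \<open>n = b\<close>.\<close>
  have top: "Ext_vanishes R P d i (B n)" if "b \<le> n" for i n
  proof (rule Ext_vanishes_zero_module[OF module_boundaries[OF X]])
    show "zero_module (B n)"
      using zero[of "n + 1"] that mod_hom_zero[OF chain_module chain_module chain_hom_Suc, OF X X X, of n]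
      by (simp add: zero_module_def boundaries_def)
  qed
  have "\<forall>i\<ge>t. Ext_vanishes R P d i (B n)" if "n \<le> b" for n
    using that
  proof (induction n rule: int_le_induct)
    case (step n)
    then show ?case using \<open>0 < t\<close> by (auto intro!: Ext_vanishes_boundaries_pred N0)
  qed (use top in blast)
  then show ?thesis using top assms(4) by (cases "n \<le> b") auto
qed

text \<open>The climb starts in degree \<open>a - 1\<close>, where there are no nonzero cycles, and
  each step raises the bound on \<open>i\<close> by one: Ext of \<open>Z (n + 1)\<close> in degree
  \<open>i\<close> sits between Ext of \<open>B n\<close> in degree \<open>i - 1\<close> and Ext of
  \<open>X (n + 1)\<close> in degree \<open>i\<close>. At \<open>n = h\<close> the bound reads
  \<open>h - a < i\<close>.\<close>

lemma Ext_vanishes_cycles: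
  assumes zero: "\<And>n. n < a \<Longrightarrow> zero_module (X n)"
    and hzero: "\<And>n. n < h \<Longrightarrow> zero_module (homology X \<delta> n)"
    and "a - 1 \<le> n" "n \<le> h" "n - (a - 1) \<le> i"
  shows "Ext_vanishes R P d i (Z n)"
  using assms(3-5)
proof (induction n arbitrary: i rule: int_ge_induct)
  case base
  show ?case
  proof (rule Ext_vanishes_zero_module[OF module_cycles[OF X]])
    show "zero_module (Z (a - 1))"
      using zero[of "a - 1"] module.submodule_zero_closed[OF chain_module cycles_submodule, OF X X, of "a - 1"]
      by (auto simp: zero_module_def cycles_def)
  qed
next
  case (step n)
  have "cycles X \<delta> n = boundaries X \<delta> n"
    using hzero[of n] step.prems by (simp add: zero_homology_iff[OF X])
  then have "Ext_vanishes R P d (i - 1) (B n)" using step.IH[of "i - 1"] step.prems by simp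
  \<comment> \<open>The bounds force \<open>i\<close> to be at least 1, so \<open>Ext_X\<close>
    applies.\<close>
  then show ?case
    using Ext_vanishes_kernel[OF cycles_sequence_facts, of "i - 1" "n + 1"] Ext_X step.hyps step.prems by simp
qed

theorem Ext_vanishes_above:
  assumes low: "\<And>n. n < a \<Longrightarrow> zero_module (X n)" and high: "\<And>n. b < n \<Longrightarrow> zero_module (X n)"
    and hlow: "\<And>n. n < h \<Longrightarrow> zero_module (homology X \<delta> n)" and h: "\<not> zero_module (homology X \<delta> h)"
    and "a \<le> h" and N0: "\<And>i. m < i \<Longrightarrow> Ext_vanishes R P d i N" and i: "h - a < i"
  shows "Ext_vanishes R P d i N"
proof (cases "m \<le> h - a")
  case False
  \<comment> \<open>Descent on the vanishing bound, from the given \<open>m\<close> to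
    \<open>h - a\<close>; each step adds the single degree \<open>t\<close>.\<close>
  have all: "\<forall>i>t. Ext_vanishes R P d i N" if "h - a \<le> t" "t \<le> m" for t
    using that(2,1)
  proof (induction t rule: int_le_induct)
    case base
    then show ?case using N0 by blast
  next
    case (step t)
    then have t: "0 < t" "h - a < t" and N': "\<And>i. t < i \<Longrightarrow> Ext_vanishes R P d i N"
      using \<open>a \<le> h\<close> by auto
    \<comment> \<open>The descent stops at \<open>h - a\<close> because of this step: the climb
      reaches Ext of \<open>Z h\<close> in degree \<open>t\<close> only for
      \<open>t > h - a\<close>.\<close>
    have Zt: "Ext_vanishes R P d t (Z h)"
      using t \<open>a \<le> h\<close> by (intro Ext_vanishes_cycles[OF low hlow]) auto
    have Bt: "Ext_vanishes R P d (t + 1) (B h)"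
      using t by (intro Ext_vanishes_boundaries[OF high _ N']) auto
    obtain k g where g: "g \<in> mod_hom R (Z h) (direct_power N k)"
      "g ` carrier (Z h) = carrier (direct_power N k)"
      "boundaries X \<delta> h = {x \<in> carrier (Z h). g x = \<zero>\<^bsub>direct_power N k\<^esub>}"
      "\<not> zero_module (homology X \<delta> h) \<Longrightarrow> 0 < k"
      by (rule homology_sequence[of h], rule that)
    have "Ext_vanishes R P d t (direct_power N k)"
      by (rule Ext_vanishes_quotient[OF module_cycles[OF X] module_direct_power[OF N] g(1-3) Zt])
        (simp add: Bt)
    then have "Ext_vanishes R P d t N"
      using Ext_vanishes_direct_power_iff[OF N g(4)[OF h]] by blast
    then show ?case using N' by (metis zle_diff1_eq linorder_not_le order_le_less)
  qed
  show ?thesis using all[of "h - a"] False i by simp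
qed (use N0 i in auto)

end

text \<open>Both infima in the dimension are taken in the extended reals. Over a nonempty set of
  integers bounded below they are attained, so their difference is an integer and
  \<open>\<infinity> - \<infinity>\<close> does not arise.\<close>

lemma INF_int_attained:
  fixes S :: "int set"
  assumes "S \<noteq> {}" "\<And>n. n \<in> S \<Longrightarrow> l \<le> n"
  obtains m where "m \<in> S" "\<And>n. n < m \<Longrightarrow> n \<notin> S" "(INF n\<in>S. ereal (of_int n)) = ereal (of_int m)"
proof -
  obtain k where "k \<in> S" using assms(1) by blast
  \<comment> \<open>The least element is found through a natural number measure; \<open>nat\<close>
    loses nothing, because \<open>l\<close> bounds \<open>S\<close> from below.\<close>
  define m where "m = (ARG_MIN (\<lambda>n. nat (n - l)) n. n \<in> S)"
  have m: "m \<in> S" and min: "\<And>n. n \<in> S \<Longrightarrow> nat (m - l) \<le> nat (n - l)"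
    unfolding m_def using arg_min_nat_lemma[of "\<lambda>n. n \<in> S" k "\<lambda>n. nat (n - l)"] \<open>k \<in> S\<close> by auto
  have le: "m \<le> n" if "n \<in> S" for n using min[OF that] assms(2)[OF that] assms(2)[OF m] by linarith
  show thesis
  proof
    show "(INF n\<in>S. ereal (of_int n)) = ereal (of_int m)"
      by (rule antisym) (auto intro: INF_lower[OF m, of "\<lambda>n. ereal (of_int n)"] INF_greatest simp: le)
    show "n \<notin> S" if "n < m" for n using le[of n] that by linarith
  qed (rule m)
qed

theorem proposition7p3:
  fixes R :: "('r, 'e) ring_scheme"
    and C :: "('r, 'c) module" and M :: "('r, 'm) module" and N :: "('r, 'n) module"
  assumes "cring R" and "noetherian_ring R"
    and "semidualizing R C"
    and "module R M" and "module R N"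
    and "C_qid TYPE('i) R C N < \<infinity>"
    and "\<And>i. i > 0 \<Longrightarrow> zero_module (Tor R i C M)"
    and "\<exists>n. \<forall>i\<ge>n. zero_module (Ext R i M N)"
  shows "\<forall>i. ereal (real i) > C_qid TYPE('i) R C N \<longrightarrow> zero_module (Ext R i M N)"
proof (intro allI impI)
  fix i assume i: "ereal (real i) > C_qid TYPE('i) R C N"
  note M = assms(4) and N = assms(5)
  have C: "module R C" using assms(3) by (simp add: semidualizing_def)
  let ?P = "res R M" and ?d = "res_diff R"
  note P = res_free_resolution(1)[OF M]
  show "zero_module (Ext R i M N)"
  proof (cases "zero_module N")
    case True
    \<comment> \<open>For zero \<open>N\<close> the dimension is minus infinity by convention, so
      its value yields no resolution to work with.\<close>
    then show ?thesis unfolding zero_Ext_iff[OF M N] by (intro Ext_vanishes_zero_module N)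
  next
    case False
    \<comment> \<open>An infimum below \<open>i\<close> gives one resolution whose own value is
      below \<open>i\<close>; it need not realise the dimension.\<close>
    then obtain I :: "int \<Rightarrow> ('r, 'i) module" and \<delta> where res: "C_quasi_injective_resolution R C N I \<delta>"
      and val: "hinf_complex (Hom_cplx R C I) (Hom_diff C \<delta>) - inf_complex (Hom_cplx R C I) < ereal (real i)"
      using i by (auto simp: C_qid_def INF_less_iff)
    let ?X = "Hom_cplx R C I" and ?\<delta> = "Hom_diff C \<delta>"
    note res' = res[unfolded C_quasi_injective_resolution_def]
    have I: "chain_complex R I \<delta>" using res' by blast
    note X = chain_complex_Hom[OF I C]
    obtain l b where bounded: "\<And>n. n < l \<or> b < n \<Longrightarrow> zero_module (I n)"
      using res' by (auto simp: bounded_complex_def)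
    have zero: "zero_module (?X n)" if "n < l \<or> b < n" for n
      unfolding Hom_cplx_def by (rule zero_module_Hom[OF C chain_module[OF I] bounded[OF that]])
    have hzero: "zero_module (homology ?X ?\<delta> n)" if "zero_module (?X n)" for n
      by (rule zero_module_homology[OF X that])
    have "{n. \<not> zero_module (homology ?X ?\<delta> n)} \<noteq> {}"
      using res' by (auto simp: acyclic_complex_def)
    then obtain h where h: "\<not> zero_module (homology ?X ?\<delta> h)"
      "\<And>n. n < h \<Longrightarrow> zero_module (homology ?X ?\<delta> n)" "hinf_complex ?X ?\<delta> = ereal (of_int h)"
      unfolding hinf_complex_def
      using INF_int_attained[of "{n. \<not> zero_module (homology ?X ?\<delta> n)}" l] zero hzero
      by (metis (mono_tags, lifting) linorder_not_le mem_Collect_eq)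
    then have "{n. \<not> zero_module (?X n)} \<noteq> {}" using hzero by blast
    then obtain a where a: "\<And>n. n < a \<Longrightarrow> zero_module (?X n)" "inf_complex ?X = ereal (of_int a)"
      unfolding inf_complex_def
      using INF_int_attained[of "{n. \<not> zero_module (?X n)}" l] zero
      by (metis (mono_tags, lifting) linorder_not_le mem_Collect_eq)
    have "a \<le> h" using a(1)[of h] h(1) hzero by force
    \<comment> \<open>Both infima are integers, so the value of this resolution is
      \<open>h - a\<close>.\<close>
    have "h - a < int i" using val unfolding h(3) a(2) by simp
    obtain m where m: "\<And>j. m \<le> j \<Longrightarrow> zero_module (Ext R j M N)" using assms(8) by blast
    interpret power_homology R ?P ?d "res_basis R M" ?X ?\<delta> N
    proof (intro power_homology.intro free_complex.intro power_homology_axioms.intro P X N)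
      show "zero_module (homology ?X ?\<delta> n) \<or> (\<exists>k. mod_iso R (homology ?X ?\<delta> n) (direct_power N k))" for n
        using res' by blast
      show "Ext_vanishes R ?P ?d j (?X n)" if "0 < j" for j n
        unfolding Hom_cplx_def
      proof (rule Ext_vanishes_Hom_injective[OF C P])
        show "injective_module R (I n)" using res' by blast
        show "zero_module (homology (\<lambda>n. tensor R C (?P n)) (\<lambda>n. tensor_map R C (?P (n - 1)) id (?d n)) j)"
          using assms(7)[of "nat j"] that by (simp add: Tor_def)
      qed
    qed (simp add: res_def)
    show ?thesis
      unfolding zero_Ext_iff[OF M N]
    proof (rule Ext_vanishes_above[OF a(1) zero[OF disjI2] h(2,1) \<open>a \<le> h\<close> _ \<open>h - a < int i\<close>])
      fix j assume "int m < j"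
      then show "Ext_vanishes R ?P ?d j N" using m[of "nat j"] by (simp add: zero_Ext_iff[OF M N])
    qed
  qed
qed

end
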